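(* Let $X,V$ be Banach lattices and $1\le p<\infty$. Let $A_m:D(A_m)\subseteq X\to X$ be closed and densely defined and $G,P\in\mathcal{L}(D(A_m),V)$ be such that $A:=A_m|_{\ker G}$ generates a $C_0$-semigroup $\mathbb{T}=(T(t))_{t\ge0}$ on $X$ and $G$ is onto. Suppose that $\mathbb{T}$ is positive, $P$ is positive, and $\mathbb{D}_\lambda$ is positive for all sufficiently large $\lambda\in\mathbb{R}$. Assume that (i) $(A,\mathbb{B},\mathbb{P})$ is a positive $L^p$-well-posed weakly regular triple with zero feedthrough, where $\mathbb{P}:=P|_{D(A)}$; (ii) $I_V$ is an admissible positive feedback operator for $(A,\mathbb{B},\mathbb{P})$. Let $\mathcal{A}:=A_m$ with $D(\mathcal{A}):=\{x\in D(A_m):\ Gx=Px\}$, and let $\mathcal{T}$ be the positive $C_0$-semigroup on $X$ generated by $\mathcal{A}$. Then $$s(\mathcal{A})<0\iff s(A)<0\ \text{ and }\ r(P\mathbb{D}_0)<1.$$ In particular, if either of these equivalent conditions is satisfied, the semigroup $\mathcal{T}$ is strongly exponentially stable.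
   Context: $D(A_m)$ carries the graph norm; $s(\cdot)$ is the spectral bound and $r(\cdot)$ the spectral radius. Under the stated hypotheses $\mathcal{A}$ does generate a positive $C_0$-semigroup. A $C_0$-semigroup $\mathcal{T}$ with generator $\mathcal{A}$ is strongly exponentially stable if there is $\alpha>0$ such that for every $x\in D(\mathcal{A})$ there is $M_x>0$ with $\|\mathcal{T}(t)x\|\le M_xe^{-\alpha t}\|x\|$ for all $t\ge0$. For $\lambda\in\rho(A)$, $\mathbb{D}_\lambda=(G|_{\ker(\lambda I-A_m)})^{-1}\in\mathcal{L}(V,X)$ is the Dirichlet operator and $\mathbb{B}=(\lambda I-A_{-1})\mathbb{D}_\lambda\in\mathcal{L}(V,X_{-1}^A)$ (independent of $\lambda$). Here $X_{-1}^A$ is the completion of $X$ for $\|R(\lambda,A)x\|$; $T_{-1}$, with generator $A_{-1}$ (domain $X$), is the extension of $\mathbb{T}$ to $X_{-1}^A$; the cone of $X_{-1}^A$ is the closure of $X_+$. Let $\Phi_tv=\int_0^tT_{-1}(t-s)\mathbb{B}v(s)ds$. The pair $(A,\mathbb{B})$ is positive $L^p$-admissible if $\mathbb{B}\ge0$ and for some $t>0$, $\Phi_tv\in X_+$ for all $v\in L^p_+(\mathbb{R}_+;V)$; $(\mathbb{P},A)$ is positive $L^p$-admissible if $\mathbb{P}\ge0$ and for some $\alpha,\gamma>0$, $\int_0^\alpha\|\mathbb{P}T(t)x\|^pdt\le\gamma^p\|x\|^p$ for all $0\le x\in D(A)$. $(A,\mathbb{B},\mathbb{P})$ is a positive $L^p$-well-posed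 triple if $\mathbb{T}$, $\mathbb{B}$ and $P$ are positive, $(A,\mathbb{B})$ and $(\mathbb{P},A)$ are positive $L^p$-admissible, and for each $\tau>0$ there is $\beta>0$ such that $(\mathbb{F}v)(t):=P\Phi_tv$ satisfies $\|\mathbb{F}v\|_{L^p(0,\tau;V)}\le\beta\|v\|_{L^p(0,\tau;V)}$ for all $0\le v\in W^{1,p}(0,\tau;V)$ with $v(0)=0$; $\mathbb{F}$ then denotes its bounded extension to $L^p(0,\tau;V)$. The transfer function is $\mathbf{H}(\lambda)=PR(\lambda,A_{-1})\mathbb{B}=P\mathbb{D}_\lambda$ for $\mathrm{Re}\,\lambda>\omega_0(A)$ (growth bound). The triple is weakly regular with zero feedthrough if $\lim_{\mathbb{R}\ni\lambda\to+\infty}\langle\mathbf{H}(\lambda)v,u^*\rangle=0$ for all $v\in V$, $u^*\in V'$. $I_V$ is an admissible positive feedback operator if $I-\mathbb{F}$ has a positive inverse in $\mathcal{L}(L^p(0,\tau_0;V))$ for some $\tau_0>0$. *)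

theory Defs
  imports "HOL-Analysis.Analysis" "HOL-Library.Lattice_Algebras"
begin

section \<open>Banach lattices\<close>

class banach_lattice = banach + ordered_real_vector + lattice_ab_group_add_abs +
  assumes norm_mono_abs: "\<bar>x\<bar> \<le> \<bar>y\<bar> \<Longrightarrow> norm x \<le> norm y"

instance real :: banach_lattice
  by standard auto

section \<open>Unbounded operators, resolvents and spectra\<close>

text \<open>An operator with domain \<open>D\<close> is given by the set \<open>D\<close> and a total function of which only
  the values on \<open>D\<close> matter.\<close>

definition linear_op :: "'x::real_vector set \<Rightarrow> ('x \<Rightarrow> 'y::real_vector) \<Rightarrow> bool" where
  "linear_op D A \<longleftrightarrow> subspace D \<and> (\<forall>x\<in>D. \<forall>y\<in>D. A (x + y) = A x + A y)
     \<and> (\<forall>c. \<forall>x\<in>D. A (c *\<^sub>R x) = c *\<^sub>R A x)"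

definition closed_op :: "'x::real_normed_vector set \<Rightarrow> ('x \<Rightarrow> 'y::real_normed_vector) \<Rightarrow> bool" where
  "closed_op D A \<longleftrightarrow> closed ((\<lambda>x. (x, A x)) ` D)"

definition graph_bounded_op ::
  "'x::real_normed_vector set \<Rightarrow> ('x \<Rightarrow> 'y::real_normed_vector) \<Rightarrow> ('x \<Rightarrow> 'v::real_normed_vector) \<Rightarrow> bool" where
  "graph_bounded_op D A G \<longleftrightarrow> linear_op D G \<and> (\<exists>K. \<forall>x\<in>D. norm (G x) \<le> K * (norm x + norm (A x)))"

definition positive_op ::
  "'x::banach_lattice set \<Rightarrow> ('x \<Rightarrow> 'y::banach_lattice) \<Rightarrow> bool" where
  "positive_op D A \<longleftrightarrow> (\<forall>x\<in>D. 0 \<le> x \<longrightarrow> 0 \<le> A x)"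

text \<open>Spectra of operators on a real Banach lattice \<open>X\<close> are those of the complexified operator
  \<open>A(x + iy) = A x + i A y\<close> with domain \<open>D + iD\<close>. The complexification of \<open>X\<close> is modelled by
  pairs \<open>(x, y)\<close>; the norm of the product type is equivalent to the lattice norm of the
  complexification, so bounded invertibility does not depend on the choice between them.\<close>

definition cscale :: "complex \<Rightarrow> 'x::real_vector \<times> 'x \<Rightarrow> 'x \<times> 'x" where
  "cscale l z = (Re l *\<^sub>R fst z - Im l *\<^sub>R snd z, Re l *\<^sub>R snd z + Im l *\<^sub>R fst z)"

definition complex_shift ::
  "('x::real_vector \<Rightarrow> 'x) \<Rightarrow> complex \<Rightarrow> 'x \<times> 'x \<Rightarrow> 'x \<times> 'x" where
  "complex_shift A l z = cscale l z - (A (fst z), A (snd z))"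

definition resolvent_set :: "'x::real_normed_vector set \<Rightarrow> ('x \<Rightarrow> 'x) \<Rightarrow> complex set" where
  "resolvent_set D A = {l. bij_betw (complex_shift A l) (D \<times> D) UNIV
     \<and> (\<exists>K. \<forall>z\<in>D \<times> D. norm z \<le> K * norm (complex_shift A l z))}"

definition spectrum :: "'x::real_normed_vector set \<Rightarrow> ('x \<Rightarrow> 'x) \<Rightarrow> complex set" where
  "spectrum D A = - resolvent_set D A"

text \<open>Both suprema are taken in the extended reals; in particular \<open>spectral_bound D A = -\<infinity>\<close>
  if the spectrum is empty.\<close>

definition spectral_bound :: "'x::real_normed_vector set \<Rightarrow> ('x \<Rightarrow> 'x) \<Rightarrow> ereal" where
  "spectral_bound D A = (SUP l\<in>spectrum D A. ereal (Re l))"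

definition spectral_radius :: "('x::real_normed_vector \<Rightarrow> 'x) \<Rightarrow> ereal" where
  "spectral_radius B = (SUP l\<in>spectrum UNIV B. ereal (cmod l))"

definition resolvent :: "'x::real_vector set \<Rightarrow> ('x \<Rightarrow> 'x) \<Rightarrow> real \<Rightarrow> 'x \<Rightarrow> 'x" where
  "resolvent D A l x = (THE y. y \<in> D \<and> l *\<^sub>R y - A y = x)"

section \<open>Strongly continuous semigroups\<close>

definition c0_semigroup :: "(real \<Rightarrow> 'x::banach \<Rightarrow>\<^sub>L 'x) \<Rightarrow> bool" where
  "c0_semigroup T \<longleftrightarrow> T 0 = id_blinfun \<and> (\<forall>s\<ge>0. \<forall>t\<ge>0. T (s + t) = T s o\<^sub>L T t)
     \<and> (\<forall>x. ((\<lambda>t. blinfun_apply (T t) x) \<longlongrightarrow> x) (at_right 0))"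

definition gen_dom :: "(real \<Rightarrow> 'x::banach \<Rightarrow>\<^sub>L 'x) \<Rightarrow> 'x set" where
  "gen_dom T = {x. \<exists>y. ((\<lambda>h. (blinfun_apply (T h) x - x) /\<^sub>R h) \<longlongrightarrow> y) (at_right 0)}"

definition gen_map :: "(real \<Rightarrow> 'x::banach \<Rightarrow>\<^sub>L 'x) \<Rightarrow> 'x \<Rightarrow> 'x" where
  "gen_map T x = Lim (at_right 0) (\<lambda>h. (blinfun_apply (T h) x - x) /\<^sub>R h)"

definition generates ::
  "'x::banach set \<Rightarrow> ('x \<Rightarrow> 'x) \<Rightarrow> (real \<Rightarrow> 'x \<Rightarrow>\<^sub>L 'x) \<Rightarrow> bool" where
  "generates D A T \<longleftrightarrow> c0_semigroup T \<and> gen_dom T = D \<and> (\<forall>x\<in>D. gen_map T x = A x)"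

definition positive_semigroup :: "(real \<Rightarrow> 'x::banach_lattice \<Rightarrow>\<^sub>L 'x) \<Rightarrow> bool" where
  "positive_semigroup T \<longleftrightarrow> (\<forall>t\<ge>0. positive_op UNIV (blinfun_apply (T t)))"

definition strongly_exp_stable :: "(real \<Rightarrow> 'x::banach \<Rightarrow>\<^sub>L 'x) \<Rightarrow> bool" where
  "strongly_exp_stable T \<longleftrightarrow> (\<exists>\<alpha>>0. \<forall>x\<in>gen_dom T. \<exists>M>0. \<forall>t\<ge>0.
     norm (blinfun_apply (T t) x) \<le> M * exp (- \<alpha> * t) * norm x)"

section \<open>Dirichlet operator, extrapolation space and control operator\<close>

definition ker_dom :: "'x set \<Rightarrow> ('x \<Rightarrow> 'v::zero) \<Rightarrow> 'x set" where
  "ker_dom D G = {x \<in> D. G x = 0}"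

definition dirichlet ::
  "'x::real_vector set \<Rightarrow> ('x \<Rightarrow> 'x) \<Rightarrow> ('x \<Rightarrow> 'v) \<Rightarrow> real \<Rightarrow> 'v \<Rightarrow> 'x" where
  "dirichlet D Am G l v = (THE x. x \<in> D \<and> l *\<^sub>R x - Am x = 0 \<and> G x = v)"

text \<open>The completion of \<open>X\<close> for the norm \<open>\<parallel>R(l, A) x\<parallel>\<close> is determined up to isometric isomorphism
  by its universal description: a Banach space (the type \<open>'e\<close>) together with a linear map \<open>j\<close>
  from \<open>X\<close> with dense range that is isometric for this norm. Different \<open>l\<close> give equivalent norms.\<close>

definition extrapolation_space ::
  "'x::banach set \<Rightarrow> ('x \<Rightarrow> 'x) \<Rightarrow> real \<Rightarrow> ('x \<Rightarrow> 'e::banach) \<Rightarrow> bool" where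
  "extrapolation_space D A l j \<longleftrightarrow>
     linear j \<and> (\<forall>x. norm (j x) = norm (resolvent D A l x)) \<and> closure (range j) = UNIV"

text \<open>Such a completion always exists: up to the isometry \<open>l - A\<^sub>-\<^sub>1\<close> from \<open>X\<close> onto the completion,
  it is \<open>X\<close> itself with \<open>j = R(l, A)\<close>.\<close>

lemma extrapolation_space_exists:
  assumes lin: "linear_op D A" and dense: "closure D = UNIV"
    and l: "complex_of_real l \<in> resolvent_set D A"
  shows "extrapolation_space D A l (resolvent D A l)"
proof -
  let ?R = "resolvent D A l"
  have sub: "subspace D" and add: "\<And>x y. x \<in> D \<Longrightarrow> y \<in> D \<Longrightarrow> A (x + y) = A x + A y"
    and scale: "\<And>c x. x \<in> D \<Longrightarrow> A (c *\<^sub>R x) = c *\<^sub>R A x"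
    using lin by (auto simp: linear_op_def)
  have zero: "0 \<in> D" "A 0 = 0"
    using sub scale[of 0 0] by (auto simp: subspace_0)
  have bij: "bij_betw (complex_shift A (complex_of_real l)) (D \<times> D) UNIV"
    using l by (simp add: resolvent_set_def)
  have shift: "complex_shift A (complex_of_real l) (x, y) = (l *\<^sub>R x - A x, l *\<^sub>R y - A y)" for x y
    by (simp add: complex_shift_def cscale_def)
  have uniq: "x = y" if "x \<in> D" "y \<in> D" "l *\<^sub>R x - A x = l *\<^sub>R y - A y" for x y
    using bij that zero inj_onD[of "complex_shift A (complex_of_real l)" "D \<times> D" "(x, 0)" "(y, 0)"]
    by (auto simp: bij_betw_def shift)
  have ex: "\<exists>y\<in>D. l *\<^sub>R y - A y = x" for x
  proof -
    have "(x, 0) \<in> complex_shift A (complex_of_real l) ` (D \<times> D)"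
      using bij by (simp add: bij_betw_def)
    then show ?thesis
      by (auto simp: shift)
  qed
  have R: "?R x \<in> D \<and> l *\<^sub>R ?R x - A (?R x) = x" for x
    unfolding resolvent_def by (rule theI') (use ex uniq in blast)
  have R_eq: "?R x = y" if "y \<in> D" "l *\<^sub>R y - A y = x" for x y
    using R[of x] that uniq by metis
  have "linear ?R"
  proof (rule linearI)
    show "?R (x + y) = ?R x + ?R y" for x y
    proof (rule R_eq)
      show "?R x + ?R y \<in> D"
        using R sub by (simp add: subspace_add)
      have "l *\<^sub>R (?R x + ?R y) - A (?R x + ?R y)
          = (l *\<^sub>R ?R x - A (?R x)) + (l *\<^sub>R ?R y - A (?R y))"
        using conjunct1[OF R] add by (simp add: algebra_simps)
      also have "\<dots> = x + y"
        using R by metis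
      finally show "l *\<^sub>R (?R x + ?R y) - A (?R x + ?R y) = x + y" .
    qed
    show "?R (c *\<^sub>R x) = c *\<^sub>R ?R x" for c x
    proof (rule R_eq)
      show "c *\<^sub>R ?R x \<in> D"
        using R sub by (simp add: subspace_scale)
      have "l *\<^sub>R (c *\<^sub>R ?R x) - A (c *\<^sub>R ?R x) = c *\<^sub>R (l *\<^sub>R ?R x - A (?R x))"
        using conjunct1[OF R] scale by (simp add: scaleR_diff_right mult.commute)
      also have "\<dots> = c *\<^sub>R x"
        using R by metis
      finally show "l *\<^sub>R (c *\<^sub>R ?R x) - A (c *\<^sub>R ?R x) = c *\<^sub>R x" .
    qed
  qed
  moreover have "range ?R = D"
  proof
    show "range ?R \<subseteq> D"
      using R by blast
    show "D \<subseteq> range ?R"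
      using R_eq by (metis rangeI subsetI)
  qed
  ultimately show ?thesis
    using dense by (simp add: extrapolation_space_def)
qed

definition ext_sg ::
  "(real \<Rightarrow> 'x::banach \<Rightarrow>\<^sub>L 'x) \<Rightarrow> ('x \<Rightarrow> 'e::banach) \<Rightarrow> real \<Rightarrow> 'e \<Rightarrow>\<^sub>L 'e" where
  "ext_sg T j t = (THE S. \<forall>x. blinfun_apply S (j x) = j (blinfun_apply (T t) x))"

text \<open>\<open>\<bool> = (l - A\<^sub>-\<^sub>1) \<D>\<^sub>l\<close>, with \<open>X\<close> identified with its image under \<open>j\<close>.\<close>

definition control_op ::
  "'x::banach set \<Rightarrow> ('x \<Rightarrow> 'x) \<Rightarrow> ('x \<Rightarrow> 'v) \<Rightarrow> (real \<Rightarrow> 'x \<Rightarrow>\<^sub>L 'x) \<Rightarrow> ('x \<Rightarrow> 'e::banach) \<Rightarrow> real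
    \<Rightarrow> 'v \<Rightarrow> 'e" where
  "control_op D Am G T j l v =
     l *\<^sub>R j (dirichlet D Am G l v) - gen_map (ext_sg T j) (j (dirichlet D Am G l v))"

section \<open>Bochner--Lebesgue and Sobolev spaces of vector-valued functions\<close>

text \<open>The values lie in a possibly non-separable Banach space, so measurability is strong
  measurability and not Borel measurability. Elements of \<open>L\<^sup>p\<close> are represented by functions,
  and equality in \<open>L\<^sup>p\<close> is equality almost everywhere.\<close>

definition strongly_measurable :: "'a measure \<Rightarrow> ('a \<Rightarrow> 'v::real_normed_vector) \<Rightarrow> bool" where
  "strongly_measurable M f \<longleftrightarrow>
     (\<exists>s. (\<forall>i::nat. simple_function M (s i)) \<and> (AE x in M. (\<lambda>i. s i x) \<longlonglongrightarrow> f x))"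

definition Lp :: "real \<Rightarrow> real set \<Rightarrow> (real \<Rightarrow> 'v::real_normed_vector) set" where
  "Lp p S = {f. strongly_measurable (lebesgue_on S) f
     \<and> integrable (lebesgue_on S) (\<lambda>s. norm (f s) powr p)}"

definition Lp_norm :: "real \<Rightarrow> real set \<Rightarrow> (real \<Rightarrow> 'v::real_normed_vector) \<Rightarrow> real" where
  "Lp_norm p S f = (LINT s|lebesgue_on S. norm (f s) powr p) powr (1 / p)"

definition Lp_pos :: "real \<Rightarrow> real set \<Rightarrow> (real \<Rightarrow> 'v::banach_lattice) set" where
  "Lp_pos p S = {f \<in> Lp p S. AE s in lebesgue_on S. 0 \<le> f s}"

text \<open>The vector-valued integrals below are Henstock--Kurzweil integrals, since the Bochner integral
  of the library is restricted to separable spaces. Bochner integrable functions on a compact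
  interval are Henstock--Kurzweil integrable with the same integral, and all integrands below are
  Bochner integrable.\<close>

text \<open>The cone of nonnegative functions in \<open>W\<^sup>1\<^sup>,\<^sup>p(0, \<tau>; V)\<close> that vanish at \<open>0\<close>, each given by its
  continuous representative on \<open>[0, \<tau>]\<close>; \<open>w\<close> is the weak derivative.\<close>

definition W1p0_pos :: "real \<Rightarrow> real \<Rightarrow> (real \<Rightarrow> 'v::banach_lattice) set" where
  "W1p0_pos p \<tau> = {v. (\<exists>w\<in>Lp p {0..\<tau>}. \<forall>t\<in>{0..\<tau>}. (w has_integral (v t - v 0)) {0..t})
     \<and> v 0 = 0 \<and> (\<forall>t\<in>{0..\<tau>}. 0 \<le> v t)}"

definition Lp_operator ::
  "real \<Rightarrow> real set \<Rightarrow> ((real \<Rightarrow> 'v::real_normed_vector) \<Rightarrow> (real \<Rightarrow> 'v)) \<Rightarrow> bool" where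
  "Lp_operator p S F \<longleftrightarrow>
     (\<forall>f\<in>Lp p S. F f \<in> Lp p S)
     \<and> (\<forall>f\<in>Lp p S. \<forall>g\<in>Lp p S. AE s in lebesgue_on S. F (\<lambda>r. f r + g r) s = F f s + F g s)
     \<and> (\<forall>c. \<forall>f\<in>Lp p S. AE s in lebesgue_on S. F (\<lambda>r. c *\<^sub>R f r) s = c *\<^sub>R F f s)
     \<and> (\<exists>K. \<forall>f\<in>Lp p S. Lp_norm p S (F f) \<le> K * Lp_norm p S f)"

section \<open>Positive well-posed regular triples\<close>

definition input_map ::
  "(real \<Rightarrow> 'x::banach \<Rightarrow>\<^sub>L 'x) \<Rightarrow> ('x \<Rightarrow> 'e::banach) \<Rightarrow> ('v \<Rightarrow> 'e) \<Rightarrow> real \<Rightarrow> (real \<Rightarrow> 'v) \<Rightarrow> 'e" where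
  "input_map T j B t v = integral {0..t} (\<lambda>s. blinfun_apply (ext_sg T j (t - s)) (B (v s)))"

text \<open>The order on the extrapolation space: its cone is the closure of \<open>X\<^sub>+\<close>.\<close>

definition positive_control :: "('x::banach_lattice \<Rightarrow> 'e::banach) \<Rightarrow> ('v::banach_lattice \<Rightarrow> 'e) \<Rightarrow> bool" where
  "positive_control j B \<longleftrightarrow> (\<forall>v\<ge>0. B v \<in> closure (j ` {x. 0 \<le> x}))"

definition positive_control_admissible ::
  "real \<Rightarrow> (real \<Rightarrow> 'x::banach_lattice \<Rightarrow>\<^sub>L 'x) \<Rightarrow> ('x \<Rightarrow> 'e::banach) \<Rightarrow> ('v::banach_lattice \<Rightarrow> 'e) \<Rightarrow> bool" where
  "positive_control_admissible p T j B \<longleftrightarrow> positive_control j B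
     \<and> (\<exists>t>0. \<forall>v\<in>Lp_pos p {0..}. input_map T j B t v \<in> j ` {x. 0 \<le> x})"

definition positive_observation_admissible ::
  "real \<Rightarrow> 'x::banach_lattice set \<Rightarrow> (real \<Rightarrow> 'x \<Rightarrow>\<^sub>L 'x) \<Rightarrow> ('x \<Rightarrow> 'v::banach_lattice) \<Rightarrow> bool" where
  "positive_observation_admissible p DA T C \<longleftrightarrow> positive_op DA C
     \<and> (\<exists>\<alpha>>0. \<exists>\<gamma>>0. \<forall>x\<in>DA. 0 \<le> x \<longrightarrow>
          (LINT t|lebesgue_on {0..\<alpha>}. norm (C (blinfun_apply (T t) x)) powr p)
            \<le> \<gamma> powr p * norm x powr p)"

definition io_map ::
  "(real \<Rightarrow> 'x::banach \<Rightarrow>\<^sub>L 'x) \<Rightarrow> ('x \<Rightarrow> 'e::banach) \<Rightarrow> ('v \<Rightarrow> 'e) \<Rightarrow> ('x \<Rightarrow> 'v) \<Rightarrow> (real \<Rightarrow> 'v) \<Rightarrow> real \<Rightarrow> 'v" where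
  "io_map T j B P v t = P (inv j (input_map T j B t v))"

definition positive_well_posed ::
  "real \<Rightarrow> 'x::banach_lattice set \<Rightarrow> ('x \<Rightarrow> 'v::banach_lattice) \<Rightarrow> ('x \<Rightarrow> 'v)
    \<Rightarrow> (real \<Rightarrow> 'x \<Rightarrow>\<^sub>L 'x) \<Rightarrow> ('x \<Rightarrow> 'e::banach) \<Rightarrow> ('v \<Rightarrow> 'e) \<Rightarrow> bool" where
  "positive_well_posed p D G P T j B \<longleftrightarrow>
     positive_semigroup T \<and> positive_control j B \<and> positive_op D P
     \<and> positive_control_admissible p T j B
     \<and> positive_observation_admissible p (ker_dom D G) T P
     \<and> (\<forall>\<tau>>0. \<exists>\<beta>>0. \<forall>v\<in>W1p0_pos p \<tau>. io_map T j B P v \<in> Lp p {0..\<tau>}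
          \<and> Lp_norm p {0..\<tau>} (io_map T j B P v) \<le> \<beta> * Lp_norm p {0..\<tau>} v)"

text \<open>The transfer function is \<open>\<^bold>H(l) = P R(l, A\<^sub>-\<^sub>1) \<bool> = P \<D>\<^sub>l\<close>.\<close>

definition weakly_regular_zero_feedthrough ::
  "'x::banach set \<Rightarrow> ('x \<Rightarrow> 'x) \<Rightarrow> ('x \<Rightarrow> 'v::banach) \<Rightarrow> ('x \<Rightarrow> 'v) \<Rightarrow> bool" where
  "weakly_regular_zero_feedthrough D Am G P \<longleftrightarrow>
     (\<forall>v. \<forall>u :: 'v \<Rightarrow>\<^sub>L real.
        ((\<lambda>l. blinfun_apply u (P (dirichlet D Am G l v))) \<longlongrightarrow> 0) at_top)"

text \<open>The bounded extension of the input-output map to \<open>L\<^sup>p(0, \<tau>; V)\<close>. It is unique up to equality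
  almost everywhere, because \<open>W1p0_pos p \<tau>\<close> spans a dense subspace.\<close>

definition io_extension ::
  "real \<Rightarrow> real \<Rightarrow> (real \<Rightarrow> 'x::banach \<Rightarrow>\<^sub>L 'x) \<Rightarrow> ('x \<Rightarrow> 'e::banach) \<Rightarrow> ('v::banach_lattice \<Rightarrow> 'e)
    \<Rightarrow> ('x \<Rightarrow> 'v) \<Rightarrow> ((real \<Rightarrow> 'v) \<Rightarrow> (real \<Rightarrow> 'v)) \<Rightarrow> bool" where
  "io_extension p \<tau> T j B P F \<longleftrightarrow> Lp_operator p {0..\<tau>} F
     \<and> (\<forall>v\<in>W1p0_pos p \<tau>. AE t in lebesgue_on {0..\<tau>}. F v t = io_map T j B P v t)"

definition identity_positive_feedback ::
  "real \<Rightarrow> (real \<Rightarrow> 'x::banach \<Rightarrow>\<^sub>L 'x) \<Rightarrow> ('x \<Rightarrow> 'e::banach) \<Rightarrow> ('v::banach_lattice \<Rightarrow> 'e)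
    \<Rightarrow> ('x \<Rightarrow> 'v) \<Rightarrow> bool" where
  "identity_positive_feedback p T j B P \<longleftrightarrow>
     (\<exists>\<tau>>0. \<exists>F J. io_extension p \<tau> T j B P F \<and> Lp_operator p {0..\<tau>} J
        \<and> (\<forall>f\<in>Lp_pos p {0..\<tau>}. J f \<in> Lp_pos p {0..\<tau>})
        \<and> (\<forall>f\<in>Lp p {0..\<tau>}.
             (AE t in lebesgue_on {0..\<tau>}. J (\<lambda>s. f s - F f s) t = f t)
             \<and> (AE t in lebesgue_on {0..\<tau>}. J f t - F (J f) t = f t)))"

end

theory Submission
  imports Defs
begin

text \<open>
  Write \<open>H(l) = P D\<^sub>l\<close> for the transfer function, \<open>A\<close> for the restriction of \<open>A\<^sub>m\<close> to \<open>ker G\<close> and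
  \<open>C\<close> for its restriction to \<open>{G x = P x}\<close>, the generator of \<open>S\<close>.

  For the generator \<open>A\<close> of a positive semigroup on a Banach lattice, \<open>s(A) < l\<close> holds if and only if
  \<open>l\<close> is a resolvent point with \<open>R(l, A) \<ge> 0\<close>
  (\<open>positive_resolvent_imp_spectral_bound_less\<close>, \<open>spectral_bound_less_imp_positive_resolvent\<close>).
  If \<open>R(l, A) \<ge> 0\<close>, the integrals \<open>\<integral>\<^sub>0\<^sup>t e\<^sup>-\<^sup>l\<^sup>r T(r) x dr\<close> increase and stay below \<open>R(l, A) x\<close> for
  \<open>x \<ge> 0\<close>, so the Laplace transform converges to the right of \<open>l\<close>, also at complex points; the Neumann
  series moves \<open>l\<close> a little to the left. Conversely positivity, known for large \<open>l\<close>, travels down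
  the real axis by Neumann series as long as the resolvents stay bounded (\<open>positive_resolvent_descend\<close>).
  In the same way \<open>r(H) < 1\<close> holds for a positive operator \<open>H\<close> if and only if \<open>I - H\<close> has a positive
  inverse. The theorem thus becomes a statement about positivity of three inverses at \<open>0\<close>.

  If \<open>R(0, A) \<ge> 0\<close> and \<open>(I - H(0))\<^sup>-\<^sup>1 \<ge> 0\<close>, then
  \<open>R(0, C) = R(0, A) + D\<^sub>0 (I - H(0))\<^sup>-\<^sup>1 P R(0, A) \<ge> 0\<close> (\<open>perturbed_positive_resolvent\<close>).
  Conversely let \<open>R(0, C) \<ge> 0\<close>. Since \<open>R(l, A) \<le> R(l, C) \<le> R(0, C)\<close> for \<open>l \<ge> 0\<close>, the positive resolvents
  of \<open>A\<close> are bounded along \<open>[0, \<infinity>)\<close>, and the descent reaches \<open>0\<close>. To invert \<open>I - H(0)\<close>, the operator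
  \<open>G - P\<close> must be onto, and this is where the feedback condition is needed: it makes
  \<open>I - H(l)\<close> invertible with positive inverse for one large \<open>l\<close>. From \<open>x\<^sub>l = D\<^sub>l (I - H(l))\<^sup>-\<^sup>1 v\<close> one passes to
  \<open>x\<^sub>0 = x\<^sub>l + l R(0, C) x\<^sub>l\<close>, which is nonnegative and satisfies \<open>A\<^sub>m x\<^sub>0 = 0\<close> and \<open>G x\<^sub>0 - P x\<^sub>0 = v\<close>. Then
  \<open>g = G x\<^sub>0 = v + P x\<^sub>0 \<ge> 0\<close> solves \<open>g - H(0) g = v\<close>.

  The feedback condition is used as follows (\<open>feedback_partial_sums_bounded\<close>). For the inputs
  \<open>(e\<^sup>l\<^sup>t - e\<^sup>m\<^sup>t) v\<close> the state can be computed, and the output is at least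
  \<open>e\<^sup>l\<^sup>t H(l) v - e\<^sup>m\<^sup>t H(m) v\<close> for \<open>v \<ge> 0\<close>. Taking for \<open>v\<close> a partial sum \<open>V\<close> of \<open>\<Sum>\<^sub>k H(l)\<^sup>k v\<close> gives
  \<open>(I - F) ((e\<^sup>l\<^sup>t - e\<^sup>m\<^sup>t) V) \<le> e\<^sup>l\<^sup>t v + e\<^sup>m\<^sup>t H(m) V\<close>. The positive inverse of \<open>I - F\<close> preserves
  this inequality. For fixed \<open>m\<close> and large \<open>l\<close> the \<open>L\<^sup>p\<close> norm of \<open>e\<^sup>l\<^sup>t - e\<^sup>m\<^sup>t\<close> exceeds any multiple of that of
  \<open>e\<^sup>m\<^sup>t\<close>, so the norms of the partial sums are bounded by a multiple of the norm of \<open>v\<close>. Bounded partial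
  sums of powers of a positive operator already force geometric decay of the powers
  (\<open>positive_partial_sums_imp_power_decay\<close>).

  The stability statement follows from \<open>e\<^sup>-\<^sup>l\<^sup>t S(t) x = x - \<integral>\<^sub>0\<^sup>t e\<^sup>-\<^sup>l\<^sup>r S(r) (l - C) x dr\<close> with
  \<open>s(C) < l < 0\<close>, whose right-hand side is bounded in \<open>t\<close>.
\<close>

section \<open>Order and norm in Banach lattices\<close>

lemma norm_le_of_abs_le:
  fixes x y :: "'x::banach_lattice"
  assumes "- y \<le> x" "x \<le> y"
  shows "norm x \<le> norm y"
proof -
  have "\<bar>x\<bar> \<le> y"
    using assms by (metis abs_leI minus_le_iff)
  then have "\<bar>x\<bar> \<le> \<bar>y\<bar>"
    using abs_ge_self order_trans by blast
  then show ?thesis by (rule norm_mono_abs)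
qed

lemma norm_mono_nonneg:
  fixes x y :: "'x::banach_lattice"
  assumes "0 \<le> x" "x \<le> y"
  shows "norm x \<le> norm y"
  by (rule norm_le_of_abs_le) (use assms in \<open>auto intro: order_trans[of _ 0]\<close>)

lemma norm_abs_eq [simp]: "norm \<bar>x\<bar> = norm (x::'x::banach_lattice)"
  by (rule antisym; rule norm_mono_abs) simp_all

text \<open>The negative part of a limit is dominated by the distance to the nonnegative approximants.\<close>

lemma closed_nonneg_cone: "closed {x::'x::banach_lattice. 0 \<le> x}"
proof (rule closed_sequential_limits[THEN iffD2], intro allI impI, elim conjE)
  fix f and l :: 'x
  assume f: "\<forall>n. f n \<in> {x. 0 \<le> x}" and lim: "f \<longlonglongrightarrow> l"
  have bound: "norm (sup (- l) 0) \<le> norm (f n - l)" for n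
  proof -
    have "- l \<le> f n - l" using f by simp
    also have "\<dots> \<le> \<bar>f n - l\<bar>" by (rule abs_ge_self)
    finally have "sup (- l) 0 \<le> \<bar>f n - l\<bar>" by simp
    then have "norm (sup (- l) 0) \<le> norm \<bar>f n - l\<bar>"
      by (intro norm_mono_nonneg) auto
    then show ?thesis by simp
  qed
  have "(\<lambda>n. norm (f n - l)) \<longlonglongrightarrow> 0"
    using lim by (simp add: LIM_zero_iff tendsto_norm_zero_iff)
  from LIMSEQ_le_const[OF this, of "norm (sup (- l) 0)"] bound
  have "norm (sup (- l) 0) \<le> 0" by blast
  then have "sup (- l) 0 = 0" by simp
  then have "- l \<le> 0" by (metis sup_ge1)
  then show "l \<in> {x. 0 \<le> x}" by simp
qed

lemma tendsto_nonneg: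
  fixes f :: "'a \<Rightarrow> 'x::banach_lattice"
  assumes "(f \<longlongrightarrow> l) F" "F \<noteq> bot" "\<forall>\<^sub>F i in F. 0 \<le> f i"
  shows "0 \<le> l"
  using Lim_in_closed_set[OF closed_nonneg_cone, of f F l] assms by simp

lemma tendsto_mono_le:
  fixes f g :: "'a \<Rightarrow> 'x::banach_lattice"
  assumes "(f \<longlongrightarrow> l) F" "(g \<longlongrightarrow> m) F" "F \<noteq> bot" "\<forall>\<^sub>F i in F. f i \<le> g i"
  shows "l \<le> m"
  using tendsto_nonneg[OF tendsto_diff[OF assms(2,1)] assms(3)] assms(4) by simp

text \<open>Riemann sums over fine divisions are nonnegative, and the cone is closed.\<close>

lemma has_integral_nonneg_lattice:
  fixes f :: "real \<Rightarrow> 'x::banach_lattice"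
  assumes int: "(f has_integral y) {a..b}" and nonneg: "\<And>t. t \<in> {a..b} \<Longrightarrow> 0 \<le> f t"
  shows "0 \<le> y"
proof -
  have "\<exists>s. 0 \<le> s \<and> norm (s - y) < e" if "e > 0" for e
  proof -
    obtain \<gamma> where g: "gauge \<gamma>"
      and \<gamma>: "\<And>\<D>. \<D> tagged_division_of {a..b} \<and> \<gamma> fine \<D> \<Longrightarrow>
        norm ((\<Sum>(x, k)\<in>\<D>. measure lborel k *\<^sub>R f x) - y) < e"
      using int[unfolded has_integral_real, rule_format, OF \<open>e > 0\<close>] by blast
    obtain \<D> where d: "\<D> tagged_division_of {a..b}" "\<gamma> fine \<D>"
      using fine_division_exists_real[OF g, of a b] by blast
    have "0 \<le> (\<Sum>(x, k)\<in>\<D>. measure lborel k *\<^sub>R f x)"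
    proof (rule sum_nonneg, clarify)
      fix x k assume "(x, k) \<in> \<D>"
      then have "x \<in> {a..b}" using tagged_division_ofD(2,3)[OF d(1)] by blast
      then show "0 \<le> measure lborel k *\<^sub>R f x"
        using nonneg by (simp add: scaleR_nonneg_nonneg)
    qed
    then show ?thesis using \<gamma>[of \<D>] d by (intro exI conjI) auto
  qed
  then have "\<forall>n. \<exists>s. 0 \<le> s \<and> norm (s - y) < 1 / real (Suc n)" by simp
  then obtain s where s: "\<And>n. 0 \<le> s n" "\<And>n. norm (s n - y) < 1 / real (Suc n)" by metis
  have "(\<lambda>n. s n - y) \<longlonglongrightarrow> 0"
  proof (rule Lim_null_comparison)
    show "\<forall>\<^sub>F n in sequentially. norm (s n - y) \<le> 1 / real (Suc n)"
      by (intro always_eventually allI less_imp_le s(2))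
    show "(\<lambda>n. 1 / real (Suc n)) \<longlonglongrightarrow> 0" using LIMSEQ_inverse_real_of_nat by (simp add: inverse_eq_divide)
  qed
  then have "s \<longlonglongrightarrow> y" by (simp add: LIM_zero_iff)
  then show ?thesis by (rule tendsto_nonneg) (simp_all add: s(1))
qed

lemma integral_mono_lattice:
  fixes f g :: "real \<Rightarrow> 'x::banach_lattice"
  assumes "f integrable_on {a..b}" "g integrable_on {a..b}"
    and "\<And>t. t \<in> {a..b} \<Longrightarrow> f t \<le> g t"
  shows "integral {a..b} f \<le> integral {a..b} g"
  using has_integral_nonneg_lattice[OF has_integral_diff[OF integrable_integral[OF assms(2)]
      integrable_integral[OF assms(1)]]] assms(3) by simp

section \<open>Positive operators\<close>

lemma positive_linear_abs_le:
  fixes Q :: "'x::banach_lattice \<Rightarrow> 'y::banach_lattice"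
  assumes lin: "linear Q" and pos: "\<And>x. 0 \<le> x \<Longrightarrow> 0 \<le> Q x"
  shows "- Q \<bar>x\<bar> \<le> Q x" "Q x \<le> Q \<bar>x\<bar>"
proof -
  have "0 \<le> \<bar>x\<bar> - (- x)"
    by (simp only: diff_ge_0_iff_ge abs_ge_minus_self)
  then have "0 \<le> Q (\<bar>x\<bar> - (- x))" by (rule pos)
  also have "\<dots> = Q x - (- Q \<bar>x\<bar>)"
    by (simp only: linear_diff[OF lin] linear_neg[OF lin] diff_minus_eq_add linear_add[OF lin] add.commute[of "Q x"])
  finally show "- Q \<bar>x\<bar> \<le> Q x"
    by (simp only: diff_ge_0_iff_ge)
  have "0 \<le> Q (\<bar>x\<bar> - x)" by (rule pos) (simp add: abs_ge_self)
  then show "Q x \<le> Q \<bar>x\<bar>" by (simp add: linear_diff[OF lin])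
qed

lemma positive_linear_norm_abs:
  fixes Q :: "'x::banach_lattice \<Rightarrow> 'y::banach_lattice"
  assumes "linear Q" and "\<And>x. 0 \<le> x \<Longrightarrow> 0 \<le> Q x"
  shows "norm (Q x) \<le> norm (Q \<bar>x\<bar>)"
  by (rule norm_le_of_abs_le) (use positive_linear_abs_le[OF assms] in auto)

lemma positive_linear_norm_le:
  fixes Q :: "'x::banach_lattice \<Rightarrow> 'y::banach_lattice"
  assumes "linear Q" "\<And>x. 0 \<le> x \<Longrightarrow> 0 \<le> Q x" "\<And>x. 0 \<le> x \<Longrightarrow> norm (Q x) \<le> K * norm x"
  shows "norm (Q x) \<le> K * norm x"
  using positive_linear_norm_abs[OF assms(1,2)] assms(3)[of "\<bar>x\<bar>"] order_trans by fastforce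

lemma positive_linear_mono:
  fixes Q :: "'x::banach_lattice \<Rightarrow> 'y::banach_lattice"
  assumes "linear Q" "\<And>x. 0 \<le> x \<Longrightarrow> 0 \<le> Q x" "x \<le> y"
  shows "Q x \<le> Q y"
  using assms(2)[of "y - x"] assms(3) by (simp add: linear_diff[OF assms(1)])

text \<open>Order replaces the Baire category argument: if the bound failed, a series of small nonnegative
  vectors would converge to a single vector that dominates all of them, and positivity would make the
  family unbounded at this vector.\<close>

lemma positive_uniform_boundedness:
  fixes Q :: "'i \<Rightarrow> 'x::banach_lattice \<Rightarrow> 'y::banach_lattice"
  assumes lin: "\<And>i. i \<in> I \<Longrightarrow> linear (Q i)"
    and pos: "\<And>i x. i \<in> I \<Longrightarrow> 0 \<le> x \<Longrightarrow> 0 \<le> Q i x"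
    and pointwise: "\<And>x. 0 \<le> x \<Longrightarrow> \<exists>M. \<forall>i\<in>I. norm (Q i x) \<le> M"
  shows "\<exists>M. \<forall>i\<in>I. \<forall>x. norm (Q i x) \<le> M * norm x"
proof (rule ccontr)
  assume "\<not> ?thesis"
  then have "\<forall>n::nat. \<exists>i x. i \<in> I \<and> norm (Q i x) > 4 ^ n * norm x"
    by (metis not_le)
  then obtain i x where i: "\<And>n. i n \<in> I" and big: "\<And>n. norm (Q (i n) (x n)) > 4 ^ n * norm (x n)"
    by metis
  have x0: "norm (x n) > 0" for n
    using big[of n] linear_0[OF lin[OF i]] by (cases "x n = 0") auto
  \<comment> \<open>Norm \<open>2\<^sup>-\<^sup>n\<close> makes the series summable, while the images still have norm at least \<open>2\<^sup>n\<close>.\<close>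
  define u where "u n = (1 / (2 ^ n * norm (x n))) *\<^sub>R \<bar>x n\<bar>" for n
  have u_nonneg: "0 \<le> u n" for n
    unfolding u_def by (intro scaleR_nonneg_nonneg) auto
  have norm_u: "norm (u n) = (1 / 2) ^ n" for n
    using x0[of n] by (simp add: u_def power_divide)
  have big_u: "norm (Q (i n) (u n)) \<ge> 2 ^ n" for n
  proof -
    have "4 ^ n * norm (x n) \<le> norm (Q (i n) \<bar>x n\<bar>)"
      using big[of n] positive_linear_norm_abs[OF lin[OF i] pos[OF i], of n "x n"] by simp
    then have "4 ^ n * norm (x n) / (2 ^ n * norm (x n)) \<le> norm (Q (i n) \<bar>x n\<bar>) / (2 ^ n * norm (x n))"
      using x0[of n] by (intro divide_right_mono) auto
    moreover have "4 ^ n * norm (x n) / (2 ^ n * norm (x n)) = (2::real) ^ n"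
      using x0[of n] by (simp add: power_mult_distrib[symmetric] field_simps)
    ultimately show ?thesis
      using x0[of n] by (simp add: u_def linear_scale[OF lin[OF i]] field_simps)
  qed
  have summ: "summable u"
    by (rule summable_norm_cancel) (simp add: norm_u summable_geometric)
  have le: "u n \<le> suminf u" for n
  proof (rule tendsto_mono_le[OF tendsto_const summable_LIMSEQ[OF summ]])
    show "\<forall>\<^sub>F m in sequentially. u n \<le> sum u {..<m}"
      using eventually_gt_at_top[of n]
    proof eventually_elim
      case (elim m)
      have "sum u {..<m} = u n + sum u ({..<m} - {n})"
        using elim by (intro sum.remove) auto
      moreover have "0 \<le> sum u ({..<m} - {n})"
        by (intro sum_nonneg u_nonneg)
      ultimately show ?case by (metis add.right_neutral add_left_mono)
    qed
  qed simp
  have "0 \<le> suminf u" using le[of 0] u_nonneg[of 0] by order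
  then obtain M where M: "\<And>i. i \<in> I \<Longrightarrow> norm (Q i (suminf u)) \<le> M" using pointwise by blast
  obtain n where n: "M < 2 ^ n" using real_arch_pow[of 2 M] by auto
  have "norm (Q (i n) (u n)) \<le> norm (Q (i n) (suminf u))"
    by (intro norm_mono_nonneg pos[OF i] u_nonneg positive_linear_mono[OF lin[OF i] pos[OF i]] le)
  with big_u[of n] M[OF i[of n]] n show False by linarith
qed

lemma positive_linear_bounded:
  fixes Q :: "'x::banach_lattice \<Rightarrow> 'y::banach_lattice"
  assumes lin: "linear Q" and pos: "\<And>x. 0 \<le> x \<Longrightarrow> 0 \<le> Q x"
  shows "bounded_linear Q"
proof -
  have "\<exists>M. \<forall>i\<in>UNIV :: unit set. \<forall>x. norm (Q x) \<le> M * norm x"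
    by (rule positive_uniform_boundedness) (use assms in auto)
  then obtain M where "\<And>x. norm (Q x) \<le> norm x * M" by (auto simp: mult.commute)
  then show ?thesis
    using lin by (intro bounded_linear_intro[where K = M]) (auto simp: linear_add linear_scale)
qed

section \<open>Neumann series\<close>

text \<open>A geometric bound on the powers is assumed instead of \<open>\<parallel>N\<parallel> < 1\<close>, because for the transfer function
  only the powers are known to be small.\<close>

lemma neumann_inverse:
  fixes N :: "'z::banach \<Rightarrow> 'z"
  assumes N: "bounded_linear N" and C: "\<And>n z. norm ((N ^^ n) z) \<le> C * q ^ n * norm z"
    and q: "0 \<le> q" "q < 1"
  shows "\<exists>Q. bounded_linear Q \<and> (\<forall>z. Q z - N (Q z) = z) \<and> (\<forall>z. Q (z - N z) = z)
    \<and> (\<forall>z. (\<lambda>n. (N ^^ n) z) sums Q z)"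
proof -
  define Q where "Q z = (\<Sum>n. (N ^^ n) z)" for z
  have lin: "linear (N ^^ n)" for n
  proof (induction n)
    case 0
    then show ?case by (simp add: id_def linear_ident)
  next
    case (Suc n)
    have "linear (N \<circ> (N ^^ n))"
      using linear_compose[OF Suc] N bounded_linear.linear by blast
    then show ?case by (simp add: o_def)
  qed
  have geo: "summable (\<lambda>n. C * q ^ n * norm z)" for z :: 'z
    using q by (intro summable_mult summable_mult2 summable_geometric) auto
  have summ: "summable (\<lambda>n. (N ^^ n) z)" for z
    by (rule summable_comparison_test'[OF geo[of z]]) (use C in auto)
  have sums: "(\<lambda>n. (N ^^ n) z) sums Q z" for z
    unfolding Q_def using summ by (rule summable_sums)
  have NQ: "N (Q z) = Q z - z" for z
  proof -
    have "(\<lambda>n. (N ^^ Suc n) z) sums N (Q z)"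
      using bounded_linear.sums[OF N sums[of z]] by simp
    then show ?thesis using sums_Suc_iff[of "\<lambda>n. (N ^^ n) z" "N (Q z)"] sums[of z] sums_unique2
      by (metis add_diff_cancel_right' funpow_0)
  qed
  have QN: "Q (N z) = Q z - z" for z
  proof -
    have "(\<lambda>n. (N ^^ Suc n) z) sums Q (N z)"
      using sums[of "N z"] by (simp add: funpow_swap1)
    then show ?thesis using sums_Suc_iff[of "\<lambda>n. (N ^^ n) z" "Q (N z)"] sums[of z] sums_unique2
      by (metis add_diff_cancel_right' funpow_0)
  qed
  have add: "Q (x + y) = Q x + Q y" for x y
    using sums_add[OF sums[of x] sums[of y]] sums[of "x + y"] sums_unique2
    by (simp add: linear_add[OF lin]) blast
  have scale: "Q (c *\<^sub>R x) = c *\<^sub>R Q x" for c x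
    using sums_scaleR_right[OF sums[of x]] sums[of "c *\<^sub>R x"] sums_unique2
    by (simp add: linear_scale[OF lin]) blast
  have bound: "norm (Q z) \<le> norm z * (\<Sum>n. C * q ^ n)" for z
  proof -
    have geo1: "summable (\<lambda>n. C * q ^ n)" using q by (intro summable_mult summable_geometric) auto
    have "norm (Q z) \<le> (\<Sum>n. C * q ^ n * norm z)"
      unfolding Q_def by (rule norm_suminf_le[OF C geo])
    also have "\<dots> = norm z * (\<Sum>n. C * q ^ n)"
      using suminf_mult2[OF geo1, of "norm z"] by (simp add: mult.commute)
    finally show ?thesis .
  qed
  have "bounded_linear Q" by (rule bounded_linear_intro[OF add scale bound])
  then show ?thesis
    using NQ QN sums add by (intro exI[of _ Q]) (auto simp: bounded_linear.linear linear_diff)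
qed

section \<open>Integrals of orbits\<close>

lemma integral_translate:
  fixes f :: "real \<Rightarrow> 'z::banach"
  assumes "f integrable_on {a + c..b + c}"
  shows "integral {a..b} (\<lambda>r. f (r + c)) = integral {a + c..b + c} f"
proof -
  have "(f has_integral integral {a + c..b + c} f) (cbox (a + c) (b + c))"
    using assms by (simp add: integrable_integral)
  from has_integral_affinity'[OF this, of 1 c] show ?thesis
    by (intro integral_unique) simp
qed

lemma has_integral_reflect_interval:
  fixes f :: "real \<Rightarrow> 'z::banach"
  assumes "(f has_integral y) {0..t}"
  shows "((\<lambda>s. f (t - s)) has_integral y) {0..t}"
proof -
  have "(\<lambda>s. t - s) ` {0..t} = {0..t}"
  proof (intro equalityI subsetI)
    show "s \<in> (\<lambda>s. t - s) ` {0..t}" if "s \<in> {0..t}" for s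
      using that by (intro image_eqI[of _ _ "t - s"]) auto
  qed auto
  then show ?thesis
    using has_integral_affinity[of f y 0 t "-1" t] assms by simp
qed

text \<open>The generator as a relation. In this form it makes sense for the rescaled flows on \<open>X \<times> X\<close> below,
  which are given by plain functions.\<close>

definition has_generator_value :: "(real \<Rightarrow> 'z::real_normed_vector \<Rightarrow> 'z) \<Rightarrow> 'z \<Rightarrow> 'z \<Rightarrow> bool" where
  "has_generator_value U z y \<longleftrightarrow> ((\<lambda>h. (U h z - z) /\<^sub>R h) \<longlongrightarrow> y) (at_right 0)"

text \<open>Local boundedness is an assumption here; for positive semigroups it follows from
  \<open>positive_uniform_boundedness\<close>.\<close>

locale semiflow =
  fixes U :: "real \<Rightarrow> 'z::banach \<Rightarrow> 'z"
  assumes bounded_linear_flow: "0 \<le> t \<Longrightarrow> bounded_linear (U t)"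
    and flow_zero: "U 0 z = z"
    and flow_add: "0 \<le> s \<Longrightarrow> 0 \<le> t \<Longrightarrow> U (s + t) z = U s (U t z)"
    and flow_continuous: "continuous_on {0..} (\<lambda>t. U t z)"
    and flow_locally_bounded: "\<exists>M. \<forall>r\<in>{0..t}. \<forall>z. norm (U r z) \<le> M * norm z"
begin

definition orbit_integral :: "real \<Rightarrow> 'z \<Rightarrow> 'z" where
  "orbit_integral t z = integral {0..t} (\<lambda>r. U r z)"

lemma orbit_integrable: "0 \<le> s \<Longrightarrow> (\<lambda>r. U r z) integrable_on {s..t}"
  by (rule integrable_continuous_real, rule continuous_on_subset[OF flow_continuous]) auto

lemma orbit_integral_combine:
  assumes "0 \<le> s" "s \<le> t"
  shows "orbit_integral t z - orbit_integral s z = integral {s..t} (\<lambda>r. U r z)"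
  using Henstock_Kurzweil_Integration.integral_combine[OF assms orbit_integrable[of 0 z t]]
  unfolding orbit_integral_def by (simp add: algebra_simps)

lemma flow_commute: "0 \<le> s \<Longrightarrow> 0 \<le> t \<Longrightarrow> U s (U t z) = U t (U s z)"
  using flow_add[of s t z] flow_add[of t s z] by (simp add: add.commute)

lemma flow_orbit_integral:
  assumes "0 \<le> h" "0 \<le> t"
  shows "U h (orbit_integral t z) = orbit_integral (t + h) z - orbit_integral h z"
proof -
  have "U h (orbit_integral t z) = integral {0..t} (\<lambda>r. U h (U r z))"
    unfolding orbit_integral_def
    using integral_linear[OF orbit_integrable[of 0 z t] bounded_linear_flow[OF assms(1)]]
    by (simp add: o_def)
  also have "\<dots> = integral {0..t} (\<lambda>r. U (r + h) z)"
    by (rule integral_cong) (use assms flow_add flow_commute in auto)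
  also have "\<dots> = integral {0 + h..t + h} (\<lambda>r. U r z)"
    by (rule integral_translate) (use assms orbit_integrable in auto)
  also have "\<dots> = orbit_integral (t + h) z - orbit_integral h z"
    using orbit_integral_combine[of h "t + h" z] assms by simp
  finally show ?thesis .
qed

text \<open>Both sides equal \<open>\<integral>\<^sub>0\<^sup>t\<^sup>+\<^sup>h - \<integral>\<^sub>0\<^sup>t - \<integral>\<^sub>0\<^sup>h\<close>, which is symmetric in \<open>t\<close> and \<open>h\<close>. Dividing by \<open>h\<close> turns
  difference quotients of the integral into means of the orbit.\<close>

lemma flow_orbit_integral_diff:
  assumes "0 \<le> h" "0 \<le> t"
  shows "U h (orbit_integral t z) - orbit_integral t z = U t (orbit_integral h z) - orbit_integral h z"
  using flow_orbit_integral[OF assms] flow_orbit_integral[OF assms(2,1)] by (simp add: add.commute)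

lemma orbit_mean_tendsto: "((\<lambda>h. orbit_integral h z /\<^sub>R h) \<longlongrightarrow> z) (at_right 0)"
proof -
  have cont: "continuous_on {0..1} (\<lambda>r. U r z)"
    by (rule continuous_on_subset[OF flow_continuous]) auto
  have "((\<lambda>u. integral {0..u} (\<lambda>r. U r z)) has_vector_derivative U 0 z) (at 0 within {0..1})"
    by (rule integral_has_vector_derivative[OF cont]) auto
  then have "((\<lambda>h. (1 / norm (h - 0)) *\<^sub>R (orbit_integral h z - (orbit_integral 0 z + (h - 0) *\<^sub>R z)))
      \<longlongrightarrow> 0) (at_right 0)"
    unfolding has_vector_derivative_def has_derivative_within orbit_integral_def
    by (simp add: flow_zero at_within_Icc_at_right)
  moreover have "\<forall>\<^sub>F h in at_right 0. (1 / norm (h - 0)) *\<^sub>R (orbit_integral h z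
      - (orbit_integral 0 z + (h - 0) *\<^sub>R z)) = orbit_integral h z /\<^sub>R h - z"
    using eventually_at_right_less[of 0]
    by eventually_elim (simp add: orbit_integral_def scaleR_diff_right divide_inverse)
  ultimately have "((\<lambda>h. orbit_integral h z /\<^sub>R h - z) \<longlongrightarrow> 0) (at_right 0)"
    by (rule Lim_transform_eventually)
  then show ?thesis by (simp add: LIM_zero_iff)
qed

lemma orbit_integral_difference_quotient:
  assumes "0 \<le> t"
  shows "((\<lambda>h. (U t (orbit_integral h z) - orbit_integral h z) /\<^sub>R h) \<longlongrightarrow> U t z - z) (at_right 0)"
proof -
  interpret bounded_linear "U t" by (rule bounded_linear_flow[OF assms])
  have "((\<lambda>h. U t (orbit_integral h z /\<^sub>R h) - orbit_integral h z /\<^sub>R h) \<longlongrightarrow> U t z - z) (at_right 0)"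
    by (intro tendsto_diff tendsto orbit_mean_tendsto)
  then show ?thesis by (simp add: scaleR scaleR_diff_right)
qed

lemma orbit_integral_generator:
  assumes "0 \<le> t"
  shows "has_generator_value U (orbit_integral t z) (U t z - z)"
  unfolding has_generator_value_def
proof (rule Lim_transform_eventually[OF orbit_integral_difference_quotient[OF assms]])
  show "\<forall>\<^sub>F h in at_right 0. (U t (orbit_integral h z) - orbit_integral h z) /\<^sub>R h
      = (U h (orbit_integral t z) - orbit_integral t z) /\<^sub>R h"
    using eventually_at_right_less[of 0]
    by eventually_elim (simp add: flow_orbit_integral_diff[OF _ assms])
qed

lemma generator_domain_dense: "closure {z. \<exists>y. has_generator_value U z y} = UNIV"
proof -
  have "z \<in> closure {z. \<exists>y. has_generator_value U z y}" for z
  proof (rule Lim_in_closed_set[OF closed_closure _ _ orbit_mean_tendsto])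
    show "\<forall>\<^sub>F h in at_right 0. orbit_integral h z /\<^sub>R h \<in> closure {z. \<exists>y. has_generator_value U z y}"
      using eventually_at_right_less[of 0]
    proof eventually_elim
      case (elim h)
      have "((\<lambda>k. ((U k (orbit_integral h z) - orbit_integral h z) /\<^sub>R k) /\<^sub>R h) \<longlongrightarrow> (U h z - z) /\<^sub>R h) (at_right 0)"
        using orbit_integral_generator[of h z] elim unfolding has_generator_value_def
        by (intro tendsto_scaleR tendsto_const) auto
      moreover have "\<forall>\<^sub>F k in at_right 0. ((U k (orbit_integral h z) - orbit_integral h z) /\<^sub>R k) /\<^sub>R h
          = (U k (orbit_integral h z /\<^sub>R h) - orbit_integral h z /\<^sub>R h) /\<^sub>R k"
        using eventually_at_right_less[of 0]
      proof eventually_elim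
        case (elim k)
        then have "linear (U k)" by (simp add: bounded_linear_flow bounded_linear.linear)
        then show ?case by (simp add: linear_scale scaleR_diff_right mult.commute)
      qed
      ultimately have "has_generator_value U (orbit_integral h z /\<^sub>R h) ((U h z - z) /\<^sub>R h)"
        unfolding has_generator_value_def by (rule Lim_transform_eventually)
      then show ?case by (intro subsetD[OF closure_subset] CollectI exI)
    qed
  qed simp
  then show ?thesis by blast
qed

lemma orbit_integral_bounded_linear:
  assumes "0 \<le> t"
  shows "bounded_linear (orbit_integral t)"
proof -
  obtain M where M: "\<And>r z. r \<in> {0..t} \<Longrightarrow> norm (U r z) \<le> M * norm z"
    using flow_locally_bounded[of t] by blast
  show ?thesis
  proof (rule bounded_linear_intro)
    fix x y z :: 'z and c :: real
    have lin: "linear (U r)" if "r \<in> {0..t}" for r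
      using bounded_linear_flow[of r] that by (simp add: bounded_linear.linear)
    have "integral {0..t} (\<lambda>r. U r (x + y)) = integral {0..t} (\<lambda>r. U r x + U r y)"
      by (rule integral_cong) (simp add: linear_add[OF lin])
    then show "orbit_integral t (x + y) = orbit_integral t x + orbit_integral t y"
      unfolding orbit_integral_def using orbit_integrable[of 0] by (simp add: Henstock_Kurzweil_Integration.integral_add)
    have "integral {0..t} (\<lambda>r. U r (c *\<^sub>R x)) = integral {0..t} (\<lambda>r. c *\<^sub>R U r x)"
      by (rule integral_cong) (simp add: linear_scale[OF lin])
    then show "orbit_integral t (c *\<^sub>R x) = c *\<^sub>R orbit_integral t x"
      unfolding orbit_integral_def by simp
    have "norm (integral {0..t} (\<lambda>r. U r z)) \<le> (M * norm z) * (t - 0)"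
      by (rule integral_bound[OF assms])
        (auto intro: M continuous_on_subset[OF flow_continuous])
    then show "norm (orbit_integral t z) \<le> norm z * (M * t)"
      unfolding orbit_integral_def by (simp add: algebra_simps)
  qed
qed

text \<open>Both sides are limits of \<open>\<integral>\<^sub>0\<^sup>t U(r) (U(h) z - z) / h dr\<close> as \<open>h\<close> tends to \<open>0\<close>, which avoids
  differentiating the orbit at positive times.\<close>

lemma orbit_integral_of_generator_value:
  assumes "has_generator_value U z y" "0 \<le> t"
  shows "orbit_integral t y = U t z - z"
proof (rule tendsto_unique[OF trivial_limit_at_right_real])
  interpret I: bounded_linear "orbit_integral t"
    by (rule orbit_integral_bounded_linear[OF assms(2)])
  show "((\<lambda>h. orbit_integral t ((U h z - z) /\<^sub>R h)) \<longlongrightarrow> orbit_integral t y) (at_right 0)"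
    by (rule I.tendsto) (use assms(1) in \<open>simp add: has_generator_value_def\<close>)
  show "((\<lambda>h. orbit_integral t ((U h z - z) /\<^sub>R h)) \<longlongrightarrow> U t z - z) (at_right 0)"
  proof (rule Lim_transform_eventually[OF orbit_integral_difference_quotient[OF assms(2)]])
    show "\<forall>\<^sub>F h in at_right 0. (U t (orbit_integral h z) - orbit_integral h z) /\<^sub>R h
        = orbit_integral t ((U h z - z) /\<^sub>R h)"
      using eventually_at_right_less[of 0]
    proof eventually_elim
      case (elim h)
      have "orbit_integral t (U h z) = integral {0..t} (\<lambda>r. U h (U r z))"
        unfolding orbit_integral_def by (rule integral_cong) (use elim flow_commute in auto)
      also have "\<dots> = U h (orbit_integral t z)"
        unfolding orbit_integral_def
        using integral_linear[OF orbit_integrable[of 0 z t] bounded_linear_flow[of h]] elim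
        by (simp add: o_def)
      finally show ?case
        using flow_orbit_integral_diff[of h t z] elim assms(2) by (simp add: I.scaleR I.diff)
    qed
  qed
qed

text \<open>\<open>Q z = \<integral>\<^sub>0\<^sup>\<infinity> U(r) z dr\<close> inverts the generator up to sign because \<open>U(h) Q z - Q z = - \<integral>\<^sub>0\<^sup>h U(r) z dr\<close>.
  A vector in the kernel of the generator has a constant orbit, whose integral converges only if it
  is zero. The integrals of \<open>U(r) z\<close> need not converge absolutely.\<close>

lemma generator_inverse:
  assumes c: "0 < c"
    and K: "\<And>z s t. 0 \<le> s \<Longrightarrow> s \<le> t \<Longrightarrow> norm (integral {s..t} (\<lambda>r. U r z)) \<le> K * exp (- c * s) * norm z"
  obtains Q where "\<And>z. norm (Q z) \<le> K * norm z"
    "\<And>z. (\<lambda>n. orbit_integral (real n) z) \<longlonglongrightarrow> Q z"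
    "\<And>z. has_generator_value U (Q z) (- z)"
    "\<And>z. has_generator_value U z 0 \<Longrightarrow> z = 0"
proof -
  have decay: "(\<lambda>n. K * exp (- c * real n) * norm z) \<longlonglongrightarrow> 0" for z :: 'z
  proof -
    have "norm (exp (- c)) < 1"
      unfolding real_norm_def abs_exp_cancel exp_less_one_iff using c by simp
    then have "(\<lambda>n. exp (- c) ^ n) \<longlonglongrightarrow> 0"
      by (rule LIMSEQ_power_zero)
    then have "(\<lambda>n. K * (exp (- c) ^ n) * norm z) \<longlonglongrightarrow> K * 0 * norm z"
      by (intro tendsto_mult tendsto_const)
    then show ?thesis by (simp add: exp_of_nat_mult[symmetric] mult.commute)
  qed
  have tail: "norm (orbit_integral t z - orbit_integral s z) \<le> K * exp (- c * s) * norm z"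
    if "0 \<le> s" "s \<le> t" for s t z
    using K[OF that, of z] orbit_integral_combine[OF that, of z] by simp
  have "Cauchy (\<lambda>n. orbit_integral (real n) z)" for z
  proof (rule metric_CauchyI)
    fix e :: real assume "e > 0"
    then obtain N where N: "K * exp (- c * real N) * norm z < e / 2"
      using order_tendstoD(2)[OF decay[of z], of "e / 2"] by (auto simp: eventually_sequentially)
    have "dist (orbit_integral (real n) z) (orbit_integral (real N) z) < e / 2" if "n \<ge> N" for n
      using tail[of "real N" "real n" z] that N by (simp add: dist_norm)
    then show "\<exists>M. \<forall>m\<ge>M. \<forall>n\<ge>M. dist (orbit_integral (real m) z) (orbit_integral (real n) z) < e"
      by (intro exI[of _ N]) (metis dist_triangle_half_l dist_commute)
  qed
  then have "convergent (\<lambda>n. orbit_integral (real n) z)" for z by (rule Cauchy_convergent)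
  then obtain Q where Q: "\<And>z. (\<lambda>n. orbit_integral (real n) z) \<longlonglongrightarrow> Q z"
    unfolding convergent_def by metis
  have bound: "norm (Q z) \<le> K * norm z" for z
  proof (rule LIMSEQ_le_const2[OF tendsto_norm[OF Q]])
    show "\<exists>N. \<forall>n\<ge>N. norm (orbit_integral (real n) z) \<le> K * norm z"
      using K[of 0 _ z] by (auto simp: orbit_integral_def)
  qed
  have gen: "has_generator_value U (Q z) (- z)" for z
  proof -
    have eq: "U h (Q z) - Q z = - orbit_integral h z" if h: "0 \<le> h" for h
    proof -
      interpret bounded_linear "U h" by (rule bounded_linear_flow[OF h])
      have shifted: "(\<lambda>n. orbit_integral (real n + h) z) \<longlonglongrightarrow> Q z"
      proof -
        have "(\<lambda>n. orbit_integral (real n + h) z - orbit_integral (real n) z) \<longlonglongrightarrow> 0"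
          by (rule Lim_null_comparison[OF _ decay[of z]], intro always_eventually allI tail) (use h in auto)
        from tendsto_add[OF this Q[of z]] show ?thesis by simp
      qed
      have "(\<lambda>n. U h (orbit_integral (real n) z)) \<longlonglongrightarrow> Q z - orbit_integral h z"
        using tendsto_diff[OF shifted tendsto_const[of "orbit_integral h z"]]
        by (simp add: flow_orbit_integral[OF h])
      moreover have "(\<lambda>n. U h (orbit_integral (real n) z)) \<longlonglongrightarrow> U h (Q z)"
        by (rule tendsto[OF Q])
      ultimately show ?thesis using LIMSEQ_unique by fastforce
    qed
    show ?thesis
      unfolding has_generator_value_def
    proof (rule Lim_transform_eventually[OF tendsto_minus[OF orbit_mean_tendsto]])
      show "\<forall>\<^sub>F h in at_right 0. - (orbit_integral h z /\<^sub>R h) = (U h (Q z) - Q z) /\<^sub>R h"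
        using eventually_at_right_less[of 0] by eventually_elim (simp add: eq)
    qed
  qed
  have inj: "z = 0" if "has_generator_value U z 0" for z
  proof -
    have fixed: "U t z = z" if "0 \<le> t" for t
      using orbit_integral_of_generator_value[OF \<open>has_generator_value U z 0\<close> that]
        linear_0[OF bounded_linear.linear[OF orbit_integral_bounded_linear[OF that]]] by simp
    have "orbit_integral (real n) z = real n *\<^sub>R z" for n
    proof -
      have "orbit_integral (real n) z = integral {0..real n} (\<lambda>r. z)"
        unfolding orbit_integral_def by (rule integral_cong) (simp add: fixed)
      then show ?thesis by simp
    qed
    then have le: "real n * norm z \<le> K * norm z" for n
      using K[of 0 "real n" z] by (simp add: orbit_integral_def)
    obtain n where "K < real n" using reals_Archimedean2 by blast
    with le[of n] show ?thesis by (metis mult_le_cancel_right norm_ge_zero not_less norm_le_zero_iff)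
  qed
  show ?thesis using that bound Q gen inj by blast
qed

end

section \<open>Positive resolvents at real points\<close>

text \<open>Two-sided inverses on the real space; at real points the complexified spectral notions reduce to
  them, and order makes sense for them.\<close>

definition resolvent_op :: "'x::real_normed_vector set \<Rightarrow> ('x \<Rightarrow> 'x) \<Rightarrow> real \<Rightarrow> ('x \<Rightarrow> 'x) \<Rightarrow> bool" where
  "resolvent_op D A l R \<longleftrightarrow> bounded_linear R \<and> (\<forall>x. R x \<in> D \<and> l *\<^sub>R R x - A (R x) = x)
     \<and> (\<forall>x\<in>D. R (l *\<^sub>R x - A x) = x)"

definition positive_resolvent :: "'x::banach_lattice set \<Rightarrow> ('x \<Rightarrow> 'x) \<Rightarrow> real \<Rightarrow> ('x \<Rightarrow> 'x) \<Rightarrow> bool" where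
  "positive_resolvent D A l R \<longleftrightarrow> resolvent_op D A l R \<and> (\<forall>x\<ge>0. 0 \<le> R x)"

lemma complex_shift_of_real:
  "complex_shift A (complex_of_real l) z = (l *\<^sub>R fst z - A (fst z), l *\<^sub>R snd z - A (snd z))"
  by (simp add: complex_shift_def cscale_def)

lemma norm_fst_le_prod: "norm (fst z) \<le> norm z"
  by (metis norm_fst_le prod.collapse)

lemma norm_snd_le_prod: "norm (snd z) \<le> norm z"
  by (metis norm_snd_le prod.collapse)

lemma norm_prod_le_add: "norm z \<le> norm (fst z) + norm (snd z)"
  by (metis norm_Pair_le prod.collapse)

lemma resolvent_set_imp_resolvent_op:
  assumes lin: "linear_op D A" and l: "complex_of_real l \<in> resolvent_set D A"
  shows "\<exists>R. resolvent_op D A l R"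
proof -
  let ?S = "complex_shift A (complex_of_real l)"
  have sub: "subspace D" and add: "\<And>x y. x \<in> D \<Longrightarrow> y \<in> D \<Longrightarrow> A (x + y) = A x + A y"
    and scale: "\<And>c x. x \<in> D \<Longrightarrow> A (c *\<^sub>R x) = c *\<^sub>R A x"
    using lin by (auto simp: linear_op_def)
  have zero: "0 \<in> D" "A 0 = 0"
    using sub scale[of 0 0] by (auto simp: subspace_0)
  obtain K where bij: "bij_betw ?S (D \<times> D) UNIV"
    and K: "\<And>z. z \<in> D \<times> D \<Longrightarrow> norm z \<le> K * norm (?S z)"
    using l unfolding resolvent_set_def by blast
  have bound: "norm x \<le> norm (l *\<^sub>R x - A x) * K" if "x \<in> D" for x
    using K[of "(x, 0)"] that zero by (simp add: complex_shift_of_real norm_Pair mult.commute)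
  have ex: "\<exists>y\<in>D. l *\<^sub>R y - A y = x" for x
  proof -
    have "(x, 0) \<in> ?S ` (D \<times> D)"
      using bij by (simp add: bij_betw_def)
    then show ?thesis by (auto simp: complex_shift_of_real)
  qed
  then obtain R where R: "\<And>x. R x \<in> D" "\<And>x. l *\<^sub>R R x - A (R x) = x" by metis
  have diff: "A (x - y) = A x - A y" if "x \<in> D" "y \<in> D" for x y
    using add[of x "(-1) *\<^sub>R y"] scale[of y "-1"] that subspace_scale[OF sub, of y "-1"] by simp
  have R_eq: "R x = y" if "y \<in> D" "l *\<^sub>R y - A y = x" for x y
  proof -
    have "R x - y \<in> D" using R that sub by (simp add: subspace_diff)
    moreover have "l *\<^sub>R (R x - y) - A (R x - y) = 0"
      using R[of x] that by (simp add: diff scaleR_diff_right algebra_simps)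
    ultimately have "norm (R x - y) \<le> 0" using bound by fastforce
    then show ?thesis by simp
  qed
  have "bounded_linear R"
  proof (rule bounded_linear_intro)
    fix x y :: 'a and c :: real
    show "R (x + y) = R x + R y"
    proof (rule R_eq)
      show "R x + R y \<in> D" using R sub by (simp add: subspace_add)
      have "l *\<^sub>R (R x + R y) - A (R x + R y) = (l *\<^sub>R R x - A (R x)) + (l *\<^sub>R R y - A (R y))"
        using R(1) add by (simp add: algebra_simps)
      then show "l *\<^sub>R (R x + R y) - A (R x + R y) = x + y" by (simp only: R(2))
    qed
    show "R (c *\<^sub>R x) = c *\<^sub>R R x"
    proof (rule R_eq)
      show "c *\<^sub>R R x \<in> D" using R sub by (simp add: subspace_scale)
      have "l *\<^sub>R (c *\<^sub>R R x) - A (c *\<^sub>R R x) = c *\<^sub>R (l *\<^sub>R R x - A (R x))"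
        using R(1) scale by (simp add: scaleR_diff_right mult.commute)
      then show "l *\<^sub>R (c *\<^sub>R R x) - A (c *\<^sub>R R x) = c *\<^sub>R x" by (simp only: R(2))
    qed
    show "norm (R x) \<le> norm x * K" using bound[OF R(1), of x] by (simp only: R(2))
  qed
  then show ?thesis using R R_eq unfolding resolvent_op_def by blast
qed

lemma resolvent_op_unique:
  assumes "resolvent_op D A l R" "y \<in> D" "l *\<^sub>R y - A y = x"
  shows "R x = y"
  using assms unfolding resolvent_op_def by blast

lemma resolvent_identity:
  assumes R: "resolvent_op D A l R" and Q: "resolvent_op D A m Q"
  shows "R x = Q (x + (m - l) *\<^sub>R R x)"
proof -
  have "R x \<in> D" "l *\<^sub>R R x - A (R x) = x" using R unfolding resolvent_op_def by auto
  then show ?thesis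
    using resolvent_op_unique[OF Q, of "R x" "x + (m - l) *\<^sub>R R x"] by (simp add: algebra_simps)
qed

text \<open>The Neumann series for the resolvent at \<open>l - d\<close> has positive terms.\<close>

lemma positive_resolvent_step_down:
  fixes D :: "'x::banach_lattice set"
  assumes R: "positive_resolvent D A l R" and M: "\<And>x. norm (R x) \<le> M * norm x"
    and d: "0 \<le> d" "0 \<le> M" "d * M < 1"
  shows "\<exists>R'. positive_resolvent D A (l - d) R'"
proof -
  have bl: "bounded_linear R" and RD: "\<And>x. R x \<in> D" "\<And>x. l *\<^sub>R R x - A (R x) = x"
    and DR: "\<And>x. x \<in> D \<Longrightarrow> R (l *\<^sub>R x - A x) = x" and pos: "\<And>x. 0 \<le> x \<Longrightarrow> 0 \<le> R x"
    using R unfolding positive_resolvent_def resolvent_op_def by auto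
  interpret R: bounded_linear R by (rule bl)
  define N where "N x = d *\<^sub>R R x" for x
  have blN: "bounded_linear N"
    unfolding N_def using bl by (rule bounded_linear_const_scaleR)
  have pow: "norm ((N ^^ n) x) \<le> 1 * (d * M) ^ n * norm x" for n x
  proof (induction n)
    case (Suc n)
    have "norm ((N ^^ Suc n) x) \<le> d * (M * norm ((N ^^ n) x))"
      using M d by (simp add: N_def mult_left_mono)
    also have "\<dots> \<le> d * (M * (1 * (d * M) ^ n * norm x))"
      using Suc d by (intro mult_left_mono) auto
    finally show ?case by (simp add: algebra_simps)
  qed simp
  obtain Q where Q: "bounded_linear Q" "\<And>z. Q z - N (Q z) = z" "\<And>z. Q (z - N z) = z"
    "\<And>z. (\<lambda>n. (N ^^ n) z) sums Q z"
    using neumann_inverse[OF blN pow] d by auto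
  have Npos: "0 \<le> (N ^^ n) x" if "0 \<le> x" for n x
    by (induction n) (use that pos d in \<open>auto simp: N_def scaleR_nonneg_nonneg\<close>)
  have Qpos: "0 \<le> Q x" if "0 \<le> x" for x
    by (rule tendsto_nonneg[OF Q(4)[unfolded sums_def]]) (intro sequentially_bot always_eventually allI sum_nonneg Npos that)+
  have "resolvent_op D A (l - d) (\<lambda>x. R (Q x))"
    unfolding resolvent_op_def
  proof (intro conjI allI ballI)
    show "bounded_linear (\<lambda>x. R (Q x))" using bounded_linear_compose[OF bl Q(1)] .
    show "R (Q x) \<in> D" for x by (rule RD)
    have "(l - d) *\<^sub>R R (Q x) - A (R (Q x)) = (l *\<^sub>R R (Q x) - A (R (Q x))) - N (Q x)" for x
      by (simp add: N_def algebra_simps)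
    then show "(l - d) *\<^sub>R R (Q x) - A (R (Q x)) = x" for x
      by (simp only: RD(2) Q(2))
    fix x assume x: "x \<in> D"
    define w where "w = l *\<^sub>R x - A x"
    have xw: "x = R w" using DR[OF x] by (simp add: w_def)
    have "(l - d) *\<^sub>R x - A x = w - N w"
      using xw by (simp add: w_def N_def algebra_simps)
    then show "R (Q ((l - d) *\<^sub>R x - A x)) = x" using Q(3) xw by simp
  qed
  then show ?thesis using pos Qpos unfolding positive_resolvent_def by blast
qed

text \<open>Let \<open>m\<close> be the infimum of the points that positivity reaches. Close to \<open>m\<close> the norms are bounded,
  hence the Neumann series steps down by a fixed length, and this can only stop at the lower end of
  the interval. The bound is required only on the right of each point and only for positive
  resolvents: a comparison of operators may supply it without any knowledge of the spectrum.\<close>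

lemma positive_resolvent_descend:
  fixes D :: "'x::banach_lattice set"
  assumes top: "positive_resolvent D A \<Lambda> R\<^sub>0" and le: "l\<^sub>0 \<le> \<Lambda>"
    and bound: "\<And>m. l\<^sub>0 \<le> m \<Longrightarrow> m \<le> \<Lambda> \<Longrightarrow> \<exists>M \<delta>. \<delta> > 0 \<and>
      (\<forall>l R. m \<le> l \<and> l < m + \<delta> \<and> l \<le> \<Lambda> \<and> positive_resolvent D A l R \<longrightarrow> (\<forall>x. norm (R x) \<le> M * norm x))"
  shows "\<exists>R. positive_resolvent D A l\<^sub>0 R"
proof -
  define S where "S = {l. l\<^sub>0 \<le> l \<and> l \<le> \<Lambda> \<and> (\<exists>R. positive_resolvent D A l R)}"
  have "\<Lambda> \<in> S" using top le by (auto simp: S_def)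
  have bdd: "bdd_below S" by (auto simp: S_def intro: bdd_belowI[of _ l\<^sub>0])
  define m where "m = Inf S"
  have m: "l\<^sub>0 \<le> m" "m \<le> \<Lambda>"
    unfolding m_def using \<open>\<Lambda> \<in> S\<close> bdd by (auto simp: S_def intro!: cInf_greatest cInf_lower)
  obtain M \<delta> where \<delta>: "\<delta> > 0" and M: "\<And>l R x. m \<le> l \<Longrightarrow> l < m + \<delta> \<Longrightarrow> l \<le> \<Lambda> \<Longrightarrow>
      positive_resolvent D A l R \<Longrightarrow> norm (R x) \<le> M * norm x"
    using bound[OF m] by blast
  define M' where "M' = max M 1"
  have "m < m + min \<delta> (1 / (2 * M'))" using \<delta> by (simp add: M'_def)
  then obtain l where l: "l \<in> S" "l < m + min \<delta> (1 / (2 * M'))"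
    using cInf_lessD[of S "m + min \<delta> (1 / (2 * M'))"] \<open>\<Lambda> \<in> S\<close> unfolding m_def by blast
  have "m \<le> l" unfolding m_def using l(1) bdd by (rule cInf_lower)
  obtain R where R: "positive_resolvent D A l R" using l(1) by (auto simp: S_def)
  have bR: "norm (R x) \<le> M' * norm x" for x
  proof -
    have "norm (R x) \<le> M * norm x"
      using M[OF \<open>m \<le> l\<close> _ _ R] l by (auto simp: S_def)
    also have "\<dots> \<le> M' * norm x" by (intro mult_right_mono) (auto simp: M'_def)
    finally show ?thesis .
  qed
  \<comment> \<open>The second bound keeps the Neumann series convergent; it exceeds the distance of \<open>l\<close> from \<open>m\<close>.\<close>
  define d where "d = min (l - l\<^sub>0) (1 / (2 * M'))"
  have "0 \<le> d" using l(1) by (simp add: d_def S_def M'_def)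
  moreover have "d * M' < 1"
  proof -
    have "d * M' \<le> 1 / (2 * M') * M'" by (intro mult_right_mono) (auto simp: d_def M'_def)
    then show ?thesis by (simp add: M'_def split: if_splits)
  qed
  moreover have "0 \<le> M'" by (simp add: M'_def)
  ultimately obtain R' where R': "positive_resolvent D A (l - d) R'"
    using positive_resolvent_step_down[OF R bR, of d] by blast
  have "d \<le> l - l\<^sub>0" by (simp add: d_def)
  then have "l - d \<in> S" using l(1) \<open>0 \<le> d\<close> R' unfolding S_def by auto
  then have "m \<le> l - d" unfolding m_def using bdd by (rule cInf_lower)
  then have "d = l - l\<^sub>0" using l(2) by (auto simp: d_def)
  then show ?thesis using R' by auto
qed

text \<open>If \<open>m\<close> itself is a resolvent point, the resolvent identity bounds \<open>R(l)\<close> by \<open>2 \<parallel>R(m)\<parallel>\<close> near \<open>m\<close>.\<close>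

lemma positive_resolvent_descend_resolvent_set:
  fixes D :: "'x::banach_lattice set"
  assumes lin: "linear_op D A" and top: "positive_resolvent D A \<Lambda> R\<^sub>0" and le: "l\<^sub>0 \<le> \<Lambda>"
    and res: "\<And>m. l\<^sub>0 \<le> m \<Longrightarrow> m \<le> \<Lambda> \<Longrightarrow> complex_of_real m \<in> resolvent_set D A"
  shows "\<exists>R. positive_resolvent D A l\<^sub>0 R"
proof (rule positive_resolvent_descend[OF top le])
  fix m assume m: "l\<^sub>0 \<le> m" "m \<le> \<Lambda>"
  obtain Q where Q: "resolvent_op D A m Q"
    using resolvent_set_imp_resolvent_op[OF lin res[OF m]] by blast
  then obtain K where K: "K > 0" "\<And>x. norm (Q x) \<le> norm x * K"
    using bounded_linear.pos_bounded unfolding resolvent_op_def by blast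
  have "norm (R x) \<le> 2 * K * norm x"
    if "m \<le> l" "l < m + 1 / (2 * K)" "positive_resolvent D A l R" for l R x
  proof -
    have "R x = Q (x + (m - l) *\<^sub>R R x)"
      using resolvent_identity[OF _ Q] that unfolding positive_resolvent_def by blast
    then have "norm (R x) \<le> norm (x + (m - l) *\<^sub>R R x) * K" using K(2) by metis
    also have "\<dots> \<le> (norm x + (l - m) * norm (R x)) * K"
      using K(1) that norm_triangle_ineq[of x "(m - l) *\<^sub>R R x"] by (intro mult_right_mono) auto
    also have "\<dots> \<le> (norm x + 1 / (2 * K) * norm (R x)) * K"
      using K(1) that by (intro mult_right_mono add_left_mono) auto
    also have "\<dots> = (2 * K * norm x) / 2 + norm (R x) / 2" using K(1) by (simp add: field_simps)
    finally show ?thesis by simp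
  qed
  then show "\<exists>M \<delta>. \<delta> > 0 \<and> (\<forall>l R. m \<le> l \<and> l < m + \<delta> \<and> l \<le> \<Lambda> \<and> positive_resolvent D A l R
      \<longrightarrow> (\<forall>x. norm (R x) \<le> M * norm x))"
    using K(1) by (intro exI[of _ "2 * K"] exI[of _ "1 / (2 * K)"]) auto
qed

lemma above_spectral_bound:
  assumes "spectral_bound D A < ereal l"
  shows "complex_of_real l \<in> resolvent_set D A"
proof (rule ccontr)
  assume "\<not> ?thesis"
  then have "complex_of_real l \<in> spectrum D A" by (simp add: spectrum_def)
  then have "ereal (Re (complex_of_real l)) \<le> spectral_bound D A"
    unfolding spectral_bound_def by (rule SUP_upper)
  with assms show False by simp
qed

section \<open>Positive semigroups\<close>

text \<open>Otherwise there are \<open>t\<^sub>n \<rightarrow> 0\<close> with unbounded \<open>\<parallel>T(t\<^sub>n)\<parallel>\<close>, although \<open>T(t\<^sub>n) x \<rightarrow> x\<close> for every \<open>x\<close>; this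
  contradicts uniform boundedness.\<close>

lemma positive_c0_semigroup_bounded_near_zero:
  fixes T :: "real \<Rightarrow> 'x::banach_lattice \<Rightarrow>\<^sub>L 'x"
  assumes c0: "c0_semigroup T" and pos: "positive_semigroup T"
  shows "\<exists>\<delta>>0. \<exists>M. \<forall>t\<in>{0..\<delta>}. \<forall>x. norm (T t x) \<le> M * norm x"
proof (rule ccontr)
  assume neg: "\<not> ?thesis"
  have ex: "\<exists>t\<in>{0..1 / real (Suc n)}. \<exists>x. norm (T t x) > real (Suc n) * norm x" for n
  proof (rule ccontr)
    assume "\<not> ?thesis"
    then have "\<forall>t\<in>{0..1 / real (Suc n)}. \<forall>x. norm (T t x) \<le> real (Suc n) * norm x"
      by (auto simp: not_less)
    moreover have "1 / real (Suc n) > 0" by simp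
    ultimately show False using neg by blast
  qed
  then obtain t x where t: "\<And>n. t n \<in> {0..1 / real (Suc n)}"
    and x: "\<And>n. norm (T (t n) (x n)) > real (Suc n) * norm (x n)" by metis
  have T0: "T 0 = id_blinfun" and cont: "\<And>x. ((\<lambda>t. T t x) \<longlongrightarrow> x) (at_right 0)"
    using c0 unfolding c0_semigroup_def by auto
  have tpos: "t n > 0" for n
  proof -
    have "t n \<noteq> 0"
    proof
      assume "t n = 0"
      then have "norm (x n) > real (Suc n) * norm (x n)" using x[of n] T0 by simp
      moreover have "norm (x n) * 1 \<le> norm (x n) * real (Suc n)"
        by (intro mult_left_mono) auto
      ultimately show False by (simp add: mult.commute)
    qed
    then show ?thesis using t[of n] by auto
  qed
  have "t \<longlonglongrightarrow> 0"
  proof (rule Lim_null_comparison)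
    show "\<forall>\<^sub>F n in sequentially. norm (t n) \<le> 1 / real (Suc n)"
      using t by (intro always_eventually) (simp add: abs_of_nonneg)
    show "(\<lambda>n. 1 / real (Suc n)) \<longlonglongrightarrow> 0"
      using LIMSEQ_inverse_real_of_nat by (simp add: inverse_eq_divide)
  qed
  then have tlim: "filterlim t (at_right 0) sequentially"
    using tpos by (auto simp: filterlim_at intro!: always_eventually less_imp_neq[symmetric])
  have "\<exists>M. \<forall>n\<in>UNIV. \<forall>x. norm (T (t n) x) \<le> M * norm x"
  proof (rule positive_uniform_boundedness)
    show "linear (blinfun_apply (T (t n)))" for n
      using blinfun.bounded_linear_right bounded_linear.linear by blast
    show "0 \<le> T (t n) x" if "0 \<le> x" for n x
      using pos tpos[of n] that unfolding positive_semigroup_def positive_op_def by auto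
    show "\<exists>M. \<forall>n\<in>UNIV. norm (T (t n) x) \<le> M" for x
    proof -
      have "(\<lambda>n. T (t n) x) \<longlonglongrightarrow> x" by (rule filterlim_compose[OF cont tlim])
      then have "Bseq (\<lambda>n. T (t n) x)" by (intro convergent_imp_Bseq convergentI)
      then show ?thesis unfolding Bseq_def by blast
    qed
  qed
  then obtain M where M: "\<And>n x. norm (T (t n) x) \<le> M * norm x" by blast
  obtain n where n: "M < real n" using reals_Archimedean2 by blast
  have "norm (x n) \<ge> 0" by simp
  have "M * norm (x n) \<le> real (Suc n) * norm (x n)" using n by (intro mult_right_mono) auto
  with M[of n "x n"] x[of n] show False by linarith
qed

lemma c0_semigroup_growth:
  fixes T :: "real \<Rightarrow> 'x::banach \<Rightarrow>\<^sub>L 'x"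
  assumes c0: "c0_semigroup T" and \<delta>: "\<delta> > 0"
    and M: "\<And>t x. t \<in> {0..\<delta>} \<Longrightarrow> norm (T t x) \<le> M * norm x"
  shows "\<exists>M \<omega>. 1 \<le> M \<and> 0 \<le> \<omega> \<and> (\<forall>t\<ge>0. \<forall>x. norm (T t x) \<le> M * exp (\<omega> * t) * norm x)"
proof -
  have add: "\<And>s t x. 0 \<le> s \<Longrightarrow> 0 \<le> t \<Longrightarrow> T (s + t) x = T s (T t x)"
    using c0 unfolding c0_semigroup_def by simp
  define M' where "M' = max M 1"
  have M': "norm (T t x) \<le> M' * norm x" if "t \<in> {0..\<delta>}" for t x
    using M[OF that, of x] mult_right_mono[of M M' "norm x"] by (simp add: M'_def)
  have "1 \<le> M'" by (simp add: M'_def)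
  have pow: "norm (T t x) \<le> M' ^ Suc k * norm x" if "0 \<le> t" "t \<le> real (Suc k) * \<delta>" for t x k
    using that
  proof (induction k arbitrary: t x)
    case 0
    then show ?case using M' by simp
  next
    case (Suc k)
    show ?case
    proof (cases "t \<le> \<delta>")
      case True
      have "M' * norm x \<le> M' ^ Suc (Suc k) * norm x"
        using \<open>1 \<le> M'\<close> power_increasing[of 1 "Suc (Suc k)" M'] by (intro mult_right_mono) auto
      then show ?thesis using M'[of t x] True Suc.prems by simp
    next
      case False
      have "norm (T (\<delta> + (t - \<delta>)) x) = norm (T \<delta> (T (t - \<delta>) x))"
        using add[of \<delta> "t - \<delta>" x] False \<delta> by simp
      also have "\<dots> \<le> M' * norm (T (t - \<delta>) x)" using M' \<delta> by simp
      also have "\<dots> \<le> M' * (M' ^ Suc k * norm x)"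
        using \<open>1 \<le> M'\<close> False Suc.prems by (intro mult_left_mono Suc.IH) (auto simp: algebra_simps)
      finally show ?thesis by (simp add: algebra_simps)
    qed
  qed
  have "norm (T t x) \<le> M' * exp (ln M' / \<delta> * t) * norm x" if "0 \<le> t" for t x
  proof -
    define k where "k = nat \<lfloor>t / \<delta>\<rfloor>"
    have k: "real k \<le> t / \<delta>" "t / \<delta> \<le> real (Suc k)"
      using that \<delta> by (auto simp: k_def) linarith
    then have "t \<le> real (Suc k) * \<delta>" using \<delta> by (simp add: field_simps)
    from pow[OF that this] have "norm (T t x) \<le> M' * M' ^ k * norm x" by simp
    also have "M' ^ k = exp (ln M' * real k)"
      using \<open>1 \<le> M'\<close> by (metis exp_ln exp_of_nat2_mult less_le_trans zero_less_one)
    also have "M' * exp (ln M' * real k) * norm x \<le> M' * exp (ln M' / \<delta> * t) * norm x"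
      using \<open>1 \<le> M'\<close> mult_left_mono[OF k(1), of "ln M'"]
      by (intro mult_right_mono mult_left_mono) auto
    finally show ?thesis .
  qed
  then show ?thesis using \<open>1 \<le> M'\<close> \<delta> by (intro exI[of _ M'] exI[of _ "ln M' / \<delta>"]) auto
qed

lemma semiflow_of_c0_semigroup:
  fixes T :: "real \<Rightarrow> 'x::banach \<Rightarrow>\<^sub>L 'x"
  assumes c0: "c0_semigroup T" and M: "1 \<le> M" "0 \<le> \<omega>"
    and growth: "\<And>t x. 0 \<le> t \<Longrightarrow> norm (T t x) \<le> M * exp (\<omega> * t) * norm x"
  shows "semiflow (\<lambda>t. blinfun_apply (T t))"
proof (rule semiflow.intro)
  have T0: "T 0 = id_blinfun" and cont: "\<And>x. ((\<lambda>t. T t x) \<longlongrightarrow> x) (at_right 0)"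
    and add: "\<And>s t x. 0 \<le> s \<Longrightarrow> 0 \<le> t \<Longrightarrow> T (s + t) x = T s (T t x)"
    using c0 unfolding c0_semigroup_def by auto
  show "bounded_linear (blinfun_apply (T t))" if "0 \<le> t" for t by (rule blinfun.bounded_linear_right)
  show "T 0 z = z" for z using T0 by simp
  show "T (s + t) z = T s (T t z)" if "0 \<le> s" "0 \<le> t" for s t z using add that .
  have local: "norm (T r z) \<le> M * exp (\<omega> * t) * norm z" if "0 \<le> r" "r \<le> t" for r t z
  proof -
    have "norm (T r z) \<le> M * exp (\<omega> * r) * norm z" using growth that by simp
    also have "\<dots> \<le> M * exp (\<omega> * t) * norm z"
      using M that by (intro mult_right_mono mult_left_mono) (auto intro: mult_left_mono)
    finally show ?thesis .
  qed
  then show "\<exists>M. \<forall>r\<in>{0..t}. \<forall>z. norm (T r z) \<le> M * norm z" for t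
    by (intro exI[of _ "M * exp (\<omega> * t)"]) auto
  show "continuous_on {0..} (\<lambda>t. T t z)" for z
    unfolding continuous_on_iff
  proof (intro ballI allI impI)
    fix t e :: real assume t: "t \<in> {0..}" and e: "e > 0"
    define C where "C = M * exp (\<omega> * (t + 1))"
    have "C > 0" using M by (simp add: C_def)
    have "\<forall>\<^sub>F h in at_right 0. dist (T h z) z < e / C"
      using tendstoD[OF cont[of z], of "e / C"] e \<open>C > 0\<close> by simp
    then obtain d where d: "d > 0" "\<And>h. 0 < h \<Longrightarrow> h < d \<Longrightarrow> dist (T h z) z < e / C"
      unfolding eventually_at_right_field by auto
    have small: "norm (T h z - z) < e / C" if "0 \<le> h" "h < d" for h
      using d(2)[of h] that T0 e \<open>C > 0\<close> by (cases "h = 0") (auto simp: dist_norm)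
    have key: "norm (T (a + h) z - T a z) < e" if "0 \<le> a" "a \<le> t + 1" "0 \<le> h" "h < d" for a h
    proof -
      have "norm (T (a + h) z - T a z) = norm (T a (T h z - z))"
        using that by (simp add: add blinfun.diff_right)
      also have "\<dots> \<le> C * norm (T h z - z)"
        unfolding C_def using local that by blast
      also have "\<dots> < C * (e / C)" using small that \<open>C > 0\<close> by (intro mult_strict_left_mono) auto
      finally show ?thesis using \<open>C > 0\<close> by simp
    qed
    show "\<exists>d>0. \<forall>s\<in>{0..}. dist s t < d \<longrightarrow> dist (T s z) (T t z) < e"
    proof (intro exI[of _ "min d 1"] conjI ballI impI)
      show "min d 1 > 0" using d(1) by simp
      fix s assume s: "s \<in> {0..}" "dist s t < min d 1"
      show "dist (T s z) (T t z) < e"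
      proof (cases "t \<le> s")
        case True
        then show ?thesis using key[of t "s - t"] s t by (simp add: dist_norm)
      next
        case False
        then show ?thesis using key[of s "t - s"] s t by (simp add: dist_norm norm_minus_commute)
      qed
    qed
  qed
qed

section \<open>Complexified, rescaled orbits\<close>

lemma cscale_add: "cscale a (z + w) = cscale a z + cscale a w"
  by (simp add: cscale_def algebra_simps)

lemma cscale_diff: "cscale a (z - w) = cscale a z - cscale a w"
  by (simp add: cscale_def algebra_simps)

lemma cscale_diff_left: "cscale (a - b) z = cscale a z - cscale b z"
  by (simp add: cscale_def algebra_simps)

lemma cscale_scaleR: "cscale a (c *\<^sub>R z) = c *\<^sub>R cscale a z"
  by (simp add: cscale_def algebra_simps)

lemma cscale_scaleR_left: "cscale (c *\<^sub>R a) z = c *\<^sub>R cscale a z"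
  by (simp add: cscale_def algebra_simps)

lemma cscale_mult: "cscale (a * b) z = cscale a (cscale b z)"
  by (simp add: cscale_def algebra_simps)

lemma cscale_one [simp]: "cscale 1 z = z"
  by (simp add: cscale_def)

lemma norm_cscale: "norm (cscale a z) \<le> 4 * cmod a * norm (z :: 'x::real_normed_vector \<times> 'x)"
proof -
  have *: "norm (c *\<^sub>R x) \<le> cmod a * norm z"
    if "\<bar>c\<bar> \<le> cmod a" "norm x \<le> norm z" for c and x :: 'x
    using that by (simp add: mult_mono)
  have "norm (cscale a z) \<le> norm (fst (cscale a z)) + norm (snd (cscale a z))"
    by (rule norm_prod_le_add)
  also have "\<dots> \<le> (norm (Re a *\<^sub>R fst z) + norm (Im a *\<^sub>R snd z))
      + (norm (Re a *\<^sub>R snd z) + norm (Im a *\<^sub>R fst z))"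
    unfolding cscale_def fst_conv snd_conv by (intro add_mono norm_triangle_ineq norm_triangle_ineq4)
  also have "\<dots> \<le> (cmod a * norm z + cmod a * norm z) + (cmod a * norm z + cmod a * norm z)"
    by (intro add_mono * abs_Re_le_cmod abs_Im_le_cmod norm_fst_le_prod norm_snd_le_prod)
  finally show ?thesis by simp
qed

lemma tendsto_cscale:
  fixes g :: "'a \<Rightarrow> 'x::real_normed_vector \<times> 'x"
  assumes "(f \<longlongrightarrow> a) F" "(g \<longlongrightarrow> z) F"
  shows "((\<lambda>i. cscale (f i) (g i)) \<longlongrightarrow> cscale a z) F"
  unfolding cscale_def by (intro tendsto_intros assms)

text \<open>Product rule at \<open>0\<close> for \<open>e\<^sup>a\<^sup>h V(h) z\<close>. Applied with \<open>a\<close> and \<open>- a\<close> it gives an equivalence.\<close>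

lemma has_generator_value_rescale:
  fixes V W :: "real \<Rightarrow> 'x::real_normed_vector \<times> 'x \<Rightarrow> 'x \<times> 'x"
  assumes V: "has_generator_value V z y"
    and W: "\<And>h. 0 < h \<Longrightarrow> W h z = cscale (exp (a * of_real h)) (V h z)"
  shows "has_generator_value W z (y + cscale a z)"
  unfolding has_generator_value_def
proof (rule Lim_transform_eventually)
  let ?e = "\<lambda>h::real. exp (a * of_real h)"
  have "(?e has_vector_derivative a * ?e 0) (at 0 within {0..1})"
    by (rule has_vector_derivative_real_field[where f = "\<lambda>z. exp (a * z)"])
      (auto intro!: derivative_eq_intros)
  then have "((\<lambda>h. (1 / norm (h - 0)) *\<^sub>R (?e h - (?e 0 + (h - 0) *\<^sub>R (a * ?e 0))))
      \<longlongrightarrow> 0) (at_right 0)"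
    unfolding has_vector_derivative_def has_derivative_within
    by (simp add: at_within_Icc_at_right)
  moreover have "\<forall>\<^sub>F h in at_right 0. (1 / norm (h - 0)) *\<^sub>R (?e h - (?e 0 + (h - 0) *\<^sub>R (a * ?e 0)))
      = (?e h - 1) /\<^sub>R h - a"
    using eventually_at_right_less[of 0]
  proof eventually_elim
    case (elim h)
    then have "(1 / norm (h - 0)) *\<^sub>R (h *\<^sub>R a) = a" by simp
    then show ?case using elim by (simp add: scaleR_diff_right scaleR_add_right divide_inverse)
  qed
  ultimately have "((\<lambda>h. (?e h - 1) /\<^sub>R h - a) \<longlongrightarrow> 0) (at_right 0)"
    by (rule Lim_transform_eventually)
  then have e1: "((\<lambda>h::real. (?e h - 1) /\<^sub>R h) \<longlongrightarrow> a) (at_right 0)"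
    by (simp add: LIM_zero_iff)
  have "(?e \<longlongrightarrow> ?e 0) (at_right 0)"
    by (intro tendsto_intros)
  then have e0: "(?e \<longlongrightarrow> 1) (at_right 0)" by simp
  have "((\<lambda>h. cscale (?e h) ((V h z - z) /\<^sub>R h) + cscale ((?e h - 1) /\<^sub>R h) z)
      \<longlongrightarrow> cscale 1 y + cscale a z) (at_right 0)"
    by (intro tendsto_add tendsto_cscale e0 e1 tendsto_const V[unfolded has_generator_value_def])
  then show "((\<lambda>h. cscale (?e h) ((V h z - z) /\<^sub>R h) + cscale ((?e h - 1) /\<^sub>R h) z)
      \<longlongrightarrow> y + cscale a z) (at_right 0)" by simp
  show "\<forall>\<^sub>F h in at_right 0. cscale (?e h) ((V h z - z) /\<^sub>R h)
      + cscale ((?e h - 1) /\<^sub>R h) z = (W h z - z) /\<^sub>R h"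
    using eventually_at_right_less[of 0]
    by eventually_elim (simp add: W cscale_scaleR cscale_scaleR_left cscale_diff cscale_diff_left algebra_simps)
qed

text \<open>The complexified semigroup \<open>e\<^sup>-\<^sup>\<zeta>\<^sup>t T(t)\<close>, considered as a real semiflow on \<open>X \<times> X\<close>, so that the
  complex resolvent is obtained from the real statement \<open>generator_inverse\<close>.\<close>

definition complex_flow :: "(real \<Rightarrow> 'x::banach \<Rightarrow>\<^sub>L 'x) \<Rightarrow> complex \<Rightarrow> real \<Rightarrow> 'x \<times> 'x \<Rightarrow> 'x \<times> 'x" where
  "complex_flow T \<zeta> t z = cscale (exp (- \<zeta> * of_real t)) (T t (fst z), T t (snd z))"

lemma has_generator_value_Pair:
  fixes T :: "real \<Rightarrow> 'x::banach \<Rightarrow>\<^sub>L 'x"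
  shows "has_generator_value (\<lambda>h z. (T h (fst z), T h (snd z))) z y \<longleftrightarrow>
    has_generator_value (\<lambda>h. blinfun_apply (T h)) (fst z) (fst y) \<and>
    has_generator_value (\<lambda>h. blinfun_apply (T h)) (snd z) (snd y)" (is "?L \<longleftrightarrow> ?R")
proof
  assume L: ?L
  show ?R
    using tendsto_fst[OF L[unfolded has_generator_value_def]]
      tendsto_snd[OF L[unfolded has_generator_value_def]]
    by (simp add: has_generator_value_def)
next
  assume R: ?R
  have "((\<lambda>h. ((T h (fst z) - fst z) /\<^sub>R h, (T h (snd z) - snd z) /\<^sub>R h)) \<longlongrightarrow> (fst y, snd y)) (at_right 0)"
    using R unfolding has_generator_value_def by (intro tendsto_Pair) auto
  moreover have "(\<lambda>h. ((T h (fst z) - fst z) /\<^sub>R h, (T h (snd z) - snd z) /\<^sub>R h))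
      = (\<lambda>h. ((T h (fst z), T h (snd z)) - z) /\<^sub>R h)"
    by (intro ext) (simp add: prod_eq_iff)
  ultimately show ?L by (simp add: has_generator_value_def)
qed

lemma complex_flow_semiflow:
  fixes T :: "real \<Rightarrow> 'x::banach \<Rightarrow>\<^sub>L 'x"
  assumes "semiflow (\<lambda>t. blinfun_apply (T t))"
  shows "semiflow (complex_flow T \<zeta>)"
proof -
  interpret T: semiflow "\<lambda>t. blinfun_apply (T t)" by fact
  have local: "\<exists>M. \<forall>r\<in>{0..t}. \<forall>z. norm (complex_flow T \<zeta> r z) \<le> M * norm z" for t
  proof -
    obtain M where M: "\<And>r x. r \<in> {0..t} \<Longrightarrow> norm (T r x) \<le> M * norm x"
      using T.flow_locally_bounded[of t] by blast
    define M' where "M' = max M 0"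
    have M': "norm (T r x) \<le> M' * norm z" if "r \<in> {0..t}" "norm x \<le> norm z" for r x and z :: "'x \<times> 'x"
    proof -
      have "M * norm x \<le> M' * norm z" using that by (intro mult_mono) (auto simp: M'_def)
      then show ?thesis using M[OF that(1), of x] by linarith
    qed
    define C where "C = exp (\<bar>Re \<zeta>\<bar> * t)"
    have "norm (complex_flow T \<zeta> r z) \<le> (4 * C * (2 * M')) * norm z" if r: "r \<in> {0..t}" for r z
    proof -
      have "cmod (exp (- \<zeta> * of_real r)) = exp (- Re \<zeta> * r)" by simp
      also have "\<dots> \<le> exp (\<bar>Re \<zeta>\<bar> * r)"
        unfolding exp_le_cancel_iff using r by (intro mult_right_mono) auto
      also have "\<dots> \<le> C" unfolding C_def exp_le_cancel_iff using r by (intro mult_left_mono) auto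
      finally have c: "cmod (exp (- \<zeta> * of_real r)) \<le> C" .
      have n: "norm (T r (fst z), T r (snd z)) \<le> 2 * M' * norm z"
        using norm_prod_le_add[of "(T r (fst z), T r (snd z))"] M'[OF r norm_fst_le_prod[of z]]
          M'[OF r norm_snd_le_prod[of z]] by simp
      have "norm (complex_flow T \<zeta> r z) \<le> 4 * cmod (exp (- \<zeta> * of_real r)) * norm (T r (fst z), T r (snd z))"
        unfolding complex_flow_def by (rule norm_cscale)
      also have "\<dots> \<le> 4 * C * (2 * M' * norm z)"
        using c n by (intro mult_mono) (auto simp: C_def)
      finally show ?thesis by (simp add: algebra_simps)
    qed
    then show ?thesis by blast
  qed
  show ?thesis
  proof (rule semiflow.intro)
    show "\<exists>M. \<forall>r\<in>{0..t}. \<forall>z. norm (complex_flow T \<zeta> r z) \<le> M * norm z" for t by (rule local)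
    show "bounded_linear (complex_flow T \<zeta> t)" if "0 \<le> t" for t
    proof -
      obtain M where "\<forall>r\<in>{0..t}. \<forall>z. norm (complex_flow T \<zeta> r z) \<le> M * norm z"
        using local[of t] by blast
      then have M: "norm (complex_flow T \<zeta> t z) \<le> M * norm z" for z
        using that by (simp del: split_paired_All)
      show ?thesis
      proof (rule bounded_linear_intro)
        show "complex_flow T \<zeta> t (x + y) = complex_flow T \<zeta> t x + complex_flow T \<zeta> t y" for x y
          by (simp add: complex_flow_def blinfun.add_right cscale_add[symmetric])
        show "complex_flow T \<zeta> t (c *\<^sub>R x) = c *\<^sub>R complex_flow T \<zeta> t x" for c x
          by (simp add: complex_flow_def blinfun.scaleR_right cscale_scaleR[symmetric])
        show "norm (complex_flow T \<zeta> t x) \<le> norm x * M" for x using M[of x] by (simp add: mult.commute)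
      qed
    qed
    show "complex_flow T \<zeta> 0 z = z" for z
      by (simp add: complex_flow_def T.flow_zero)
    show "complex_flow T \<zeta> (s + t) z = complex_flow T \<zeta> s (complex_flow T \<zeta> t z)"
      if "0 \<le> s" "0 \<le> t" for s t z
    proof -
      have "exp (- \<zeta> * of_real (s + t)) = exp (- \<zeta> * of_real s) * exp (- \<zeta> * of_real t)"
        by (simp add: exp_add[symmetric] algebra_simps)
      then show ?thesis
        unfolding complex_flow_def
        by (simp add: cscale_mult T.flow_add[OF that])
          (simp add: cscale_def blinfun.diff_right blinfun.add_right blinfun.scaleR_right)
    qed
    show "continuous_on {0..} (\<lambda>t. complex_flow T \<zeta> t z)" for z
    proof -
      have "continuous_on {0..} (\<lambda>t. Re (exp (- \<zeta> * complex_of_real t)))"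
        "continuous_on {0..} (\<lambda>t. Im (exp (- \<zeta> * complex_of_real t)))"
        by (intro continuous_intros)+
      then show ?thesis
        unfolding complex_flow_def cscale_def fst_conv snd_conv
        by (intro continuous_on_Pair continuous_on_add continuous_on_diff continuous_on_scaleR T.flow_continuous)
    qed
  qed
qed

section \<open>The spectral bound of a positive semigroup\<close>

lemma complex_flow_of_real:
  "complex_flow T (complex_of_real l) r z
    = (exp (- l * r) *\<^sub>R T r (fst z), exp (- l * r) *\<^sub>R T r (snd z))"
proof -
  have "exp (- complex_of_real l * of_real r) = complex_of_real (exp (- l * r))"
    by (simp add: exp_of_real[symmetric])
  then show ?thesis by (simp add: complex_flow_def cscale_def)
qed

lemma integral_fst:
  fixes f :: "real \<Rightarrow> 'a::banach \<times> 'b::banach"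
  assumes "f integrable_on S"
  shows "fst (integral S f) = integral S (\<lambda>r. fst (f r))"
  using integral_linear[OF assms bounded_linear_fst] by (simp add: o_def)

lemma integral_snd:
  fixes f :: "real \<Rightarrow> 'a::banach \<times> 'b::banach"
  assumes "f integrable_on S"
  shows "snd (integral S f) = integral S (\<lambda>r. snd (f r))"
  using integral_linear[OF assms bounded_linear_snd] by (simp add: o_def)

locale positive_generator =
  fixes D :: "'x::banach_lattice set" and A :: "'x \<Rightarrow> 'x" and T :: "real \<Rightarrow> 'x \<Rightarrow>\<^sub>L 'x"
  assumes linear_generator: "linear_op D A"
    and generates: "generates D A T"
    and positive: "positive_semigroup T"
begin

lemma semigroup_nonneg: "0 \<le> t \<Longrightarrow> 0 \<le> x \<Longrightarrow> 0 \<le> T t x"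
  using positive unfolding positive_semigroup_def positive_op_def by auto

lemma semigroup_linear: "linear (blinfun_apply (T t))"
  using blinfun.bounded_linear_right bounded_linear.linear by blast

lemma growth_bound:
  "\<exists>M \<omega>. 1 \<le> M \<and> 0 \<le> \<omega> \<and> (\<forall>t\<ge>0. \<forall>x. norm (T t x) \<le> M * exp (\<omega> * t) * norm x)"
proof -
  have c0: "c0_semigroup T" using generates unfolding generates_def by blast
  obtain \<delta> M where "\<delta> > 0" "\<And>t x. t \<in> {0..\<delta>} \<Longrightarrow> norm (T t x) \<le> M * norm x"
    using positive_c0_semigroup_bounded_near_zero[OF c0 positive] by blast
  then show ?thesis using c0_semigroup_growth[OF c0] by blast
qed

lemma semiflow_semigroup: "semiflow (\<lambda>t. blinfun_apply (T t))"
proof -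
  obtain M \<omega> where "1 \<le> M" "0 \<le> \<omega>" "\<And>t x. 0 \<le> t \<Longrightarrow> norm (T t x) \<le> M * exp (\<omega> * t) * norm x"
    using growth_bound by blast
  then show ?thesis
    using semiflow_of_c0_semigroup generates unfolding generates_def by blast
qed

sublocale flow: semiflow "\<lambda>t. blinfun_apply (T t)"
  by (rule semiflow_semigroup)

lemma semiflow_complex_flow: "semiflow (complex_flow T \<zeta>)"
  by (rule complex_flow_semiflow[OF semiflow_semigroup])

lemma semigroup_continuous: "0 \<le> s \<Longrightarrow> continuous_on {s..t} (\<lambda>r. T r x)"
  by (rule continuous_on_subset[OF flow.flow_continuous]) auto

lemma weighted_orbit_integrable:
  "0 \<le> s \<Longrightarrow> continuous_on {s..t} k \<Longrightarrow> (\<lambda>r. k r *\<^sub>R T r x) integrable_on {s..t}"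
  by (intro integrable_continuous_real continuous_on_scaleR semigroup_continuous)

lemma generator_value_iff:
  "has_generator_value (\<lambda>h. blinfun_apply (T h)) x y \<longleftrightarrow> x \<in> D \<and> y = A x"
proof
  assume *: "has_generator_value (\<lambda>h. blinfun_apply (T h)) x y"
  then have "x \<in> D" using generates unfolding generates_def gen_dom_def has_generator_value_def by blast
  moreover have "gen_map T x = y"
    unfolding gen_map_def
    by (rule tendsto_Lim[OF trivial_limit_at_right_real]) (use * in \<open>simp add: has_generator_value_def\<close>)
  ultimately show "x \<in> D \<and> y = A x" using generates unfolding generates_def by auto
next
  assume *: "x \<in> D \<and> y = A x"
  then obtain y' where y': "((\<lambda>h. (T h x - x) /\<^sub>R h) \<longlongrightarrow> y') (at_right 0)"
    using generates unfolding generates_def gen_dom_def by blast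
  have "gen_map T x = y'"
    unfolding gen_map_def by (rule tendsto_Lim[OF trivial_limit_at_right_real y'])
  then have "y' = y" using * generates unfolding generates_def by auto
  then show "has_generator_value (\<lambda>h. blinfun_apply (T h)) x y"
    using y' unfolding has_generator_value_def by simp
qed

lemma domain_dense: "closure D = UNIV"
proof -
  have "{z. \<exists>y. has_generator_value (\<lambda>t. blinfun_apply (T t)) z y} = D"
    by (auto simp: generator_value_iff)
  then show ?thesis using flow.generator_domain_dense by simp
qed

lemma generator_commute:
  assumes "x \<in> D" "0 \<le> t"
  shows "T t x \<in> D" "A (T t x) = T t (A x)"
proof -
  have "has_generator_value (\<lambda>h. blinfun_apply (T h)) x (A x)" using assms by (simp add: generator_value_iff)
  then have lim: "((\<lambda>h. T t ((T h x - x) /\<^sub>R h)) \<longlongrightarrow> T t (A x)) (at_right 0)"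
    unfolding has_generator_value_def
    by (rule bounded_linear.tendsto[OF blinfun.bounded_linear_right])
  have "has_generator_value (\<lambda>h. blinfun_apply (T h)) (T t x) (T t (A x))"
    unfolding has_generator_value_def
  proof (rule Lim_transform_eventually[OF lim])
    show "\<forall>\<^sub>F h in at_right 0. T t ((T h x - x) /\<^sub>R h) = (T h (T t x) - T t x) /\<^sub>R h"
      using eventually_at_right_less[of 0]
      by eventually_elim
        (simp add: blinfun.scaleR_right blinfun.diff_right flow.flow_commute[OF assms(2)])
  qed
  then show "T t x \<in> D" "A (T t x) = T t (A x)" by (simp_all add: generator_value_iff)
qed

lemma resolvent_commute:
  assumes R: "resolvent_op D A l R" and t: "0 \<le> t"
  shows "R (T t x) = T t (R x)"
proof (rule resolvent_op_unique[OF R])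
  have Rx: "R x \<in> D" "l *\<^sub>R R x - A (R x) = x" using R unfolding resolvent_op_def by auto
  show "T t (R x) \<in> D" by (rule generator_commute[OF Rx(1) t])
  have "l *\<^sub>R T t (R x) - A (T t (R x)) = T t (l *\<^sub>R R x - A (R x))"
    by (simp add: generator_commute[OF Rx(1) t] blinfun.scaleR_right blinfun.diff_right)
  then show "l *\<^sub>R T t (R x) - A (T t (R x)) = T t x" by (simp only: Rx)
qed

lemma complex_flow_generator_value:
  "has_generator_value (complex_flow T \<zeta>) z y \<longleftrightarrow> z \<in> D \<times> D \<and> y = - complex_shift A \<zeta> z"
proof -
  let ?V = "\<lambda>h z. (T h (fst z), T h (snd z))"
  have V: "has_generator_value ?V z w \<longleftrightarrow> z \<in> D \<times> D \<and> w = (A (fst z), A (snd z))" for w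
    unfolding has_generator_value_Pair generator_value_iff by (cases z; cases w) auto
  have minus: "cscale (- a) v = - cscale a v" for a and v :: "'x \<times> 'x"
    by (simp add: cscale_def algebra_simps)
  show ?thesis
  proof
    assume L: "has_generator_value (complex_flow T \<zeta>) z y"
    have "has_generator_value ?V z (y + cscale \<zeta> z)"
    proof (rule has_generator_value_rescale[OF L])
      fix h :: real
      show "?V h z = cscale (exp (\<zeta> * of_real h)) (complex_flow T \<zeta> h z)"
        by (simp add: complex_flow_def cscale_mult[symmetric] exp_add[symmetric])
    qed
    then show "z \<in> D \<times> D \<and> y = - complex_shift A \<zeta> z"
      unfolding V complex_shift_def by (auto simp: algebra_simps)
  next
    assume "z \<in> D \<times> D \<and> y = - complex_shift A \<zeta> z"
    then have R: "has_generator_value ?V z (y + cscale \<zeta> z)"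
      unfolding V complex_shift_def by (auto simp: algebra_simps)
    have "has_generator_value (complex_flow T \<zeta>) z ((y + cscale \<zeta> z) + cscale (- \<zeta>) z)"
      by (rule has_generator_value_rescale[OF R]) (simp add: complex_flow_def)
    then show "has_generator_value (complex_flow T \<zeta>) z y" by (simp add: minus)
  qed
qed

lemma resolvent_orbit_integral:
  assumes R: "resolvent_op D A l R" and t: "0 \<le> t"
  shows "((\<lambda>r. exp (- l * r) *\<^sub>R T r x) has_integral (R x - exp (- l * t) *\<^sub>R T t (R x))) {0..t}"
proof -
  interpret C: semiflow "complex_flow T (complex_of_real l)" by (rule semiflow_complex_flow)
  have Rx: "R x \<in> D" "l *\<^sub>R R x - A (R x) = x" using R unfolding resolvent_op_def by auto
  have D0: "0 \<in> D" using linear_generator unfolding linear_op_def by (simp add: subspace_0)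
  then have "A (0 *\<^sub>R 0) = 0 *\<^sub>R A 0" using linear_generator unfolding linear_op_def by blast
  then have A0: "A 0 = 0" by simp
  have "has_generator_value (complex_flow T (complex_of_real l)) (R x, 0) (- (x, 0))"
    using Rx D0 A0 unfolding complex_flow_generator_value complex_shift_of_real by simp
  from C.orbit_integral_of_generator_value[OF this t]
  have "fst (C.orbit_integral t (- (x, 0))) = exp (- l * t) *\<^sub>R T t (R x) - R x"
    by (simp add: complex_flow_of_real)
  moreover have "fst (C.orbit_integral t (- (x, 0))) = integral {0..t} (\<lambda>r. - (exp (- l * r) *\<^sub>R T r x))"
    unfolding C.orbit_integral_def integral_fst[OF C.orbit_integrable[OF order_refl]]
    by (simp add: complex_flow_of_real blinfun.minus_right)
  ultimately have "- integral {0..t} (\<lambda>r. exp (- l * r) *\<^sub>R T r x) = exp (- l * t) *\<^sub>R T t (R x) - R x"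
    unfolding Henstock_Kurzweil_Integration.integral_neg by metis
  then have "integral {0..t} (\<lambda>r. exp (- l * r) *\<^sub>R T r x) = R x - exp (- l * t) *\<^sub>R T t (R x)"
    unfolding equation_minus_iff[of "integral _ _"] minus_equation_iff[of "integral _ _"] minus_diff_eq by simp
  moreover have "(\<lambda>r. exp (- l * r) *\<^sub>R T r x) integrable_on {0..t}"
    by (intro weighted_orbit_integrable continuous_intros) simp
  ultimately show ?thesis using integrable_integral by metis
qed

text \<open>Arbitrary weights dominated by a multiple of \<open>e\<^sup>-\<^sup>l\<^sup>r\<close> are admitted, since for complex points the
  weights are real and imaginary parts of \<open>e\<^sup>-\<^sup>\<zeta>\<^sup>r\<close>. The factor \<open>\<epsilon>\<close> carries the decay at
  infinity.\<close>

definition laplace_bounded :: "real \<Rightarrow> real \<Rightarrow> bool" where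
  "laplace_bounded l K \<longleftrightarrow> (\<forall>x k s t \<epsilon>. 0 \<le> s \<longrightarrow> s \<le> t \<longrightarrow> continuous_on {s..t} k \<longrightarrow>
     (\<forall>r\<in>{s..t}. \<bar>k r\<bar> \<le> \<epsilon> * exp (- l * r)) \<longrightarrow>
     norm (integral {s..t} (\<lambda>r. k r *\<^sub>R T r x)) \<le> \<epsilon> * K * norm x)"

lemma laplace_boundedD:
  assumes "laplace_bounded l K" "0 \<le> s" "s \<le> t" "continuous_on {s..t} k"
    "\<And>r. r \<in> {s..t} \<Longrightarrow> \<bar>k r\<bar> \<le> \<epsilon> * exp (- l * r)"
  shows "norm (integral {s..t} (\<lambda>r. k r *\<^sub>R T r x)) \<le> \<epsilon> * K * norm x"
  using assms unfolding laplace_bounded_def by blast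

lemma complex_flow_integral_bound:
  assumes bd: "laplace_bounded l K" and K: "0 \<le> K" and st: "0 \<le> s" "s \<le> t" and l: "l < Re \<zeta>"
  shows "norm (integral {s..t} (\<lambda>r. complex_flow T \<zeta> r z)) \<le> 4 * K * exp (- (Re \<zeta> - l) * s) * norm z"
proof -
  let ?I = "integral {s..t} (\<lambda>r. complex_flow T \<zeta> r z)" and ?J = "\<lambda>k x. integral {s..t} (\<lambda>r. k r *\<^sub>R T r x)"
  interpret C: semiflow "complex_flow T \<zeta>" by (rule semiflow_complex_flow)
  define k1 where "k1 r = Re (exp (- \<zeta> * of_real r))" for r
  define k2 where "k2 r = Im (exp (- \<zeta> * of_real r))" for r
  \<comment> \<open>The largest value on \<open>[s, t]\<close> of the quotient of \<open>\<bar>exp (- \<zeta> r)\<bar>\<close> and \<open>exp (- l r)\<close>.\<close>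
  define \<epsilon> where "\<epsilon> = exp (- (Re \<zeta> - l) * s)"
  have cont: "continuous_on {s..t} k1" "continuous_on {s..t} k2"
    unfolding k1_def k2_def by (intro continuous_intros)+
  have c: "cmod (exp (- \<zeta> * of_real r)) \<le> \<epsilon> * exp (- l * r)" if "r \<in> {s..t}" for r
  proof -
    have "cmod (exp (- \<zeta> * of_real r)) = exp (- (Re \<zeta> - l) * r) * exp (- l * r)"
      by (simp add: exp_add[symmetric] algebra_simps)
    also have "\<dots> \<le> \<epsilon> * exp (- l * r)"
      unfolding \<epsilon>_def using that l by (intro mult_right_mono) (auto intro!: mult_left_mono)
    finally show ?thesis .
  qed
  have k1: "\<bar>k1 r\<bar> \<le> \<epsilon> * exp (- l * r)" and k2: "\<bar>k2 r\<bar> \<le> \<epsilon> * exp (- l * r)" if "r \<in> {s..t}" for r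
    using c[OF that] abs_Re_le_cmod[of "exp (- \<zeta> * of_real r)"] abs_Im_le_cmod[of "exp (- \<zeta> * of_real r)"]
    unfolding k1_def k2_def by linarith+
  have b1: "norm (?J k1 x) \<le> \<epsilon> * K * norm x"
    and b2: "norm (?J k2 x) \<le> \<epsilon> * K * norm x" for x
    by (rule laplace_boundedD[OF bd st cont(1) k1]; assumption)
      (rule laplace_boundedD[OF bd st cont(2) k2]; assumption)
  note i1 = weighted_orbit_integrable[OF st(1) cont(1)] and i2 = weighted_orbit_integrable[OF st(1) cont(2)]
  have mono: "\<epsilon> * K * norm x \<le> \<epsilon> * K * norm z" if "norm x \<le> norm z" for x :: 'x
    using that K by (intro mult_left_mono) (auto simp: \<epsilon>_def)
  note int = C.orbit_integrable[OF st(1), of z t]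
  have f_eq: "fst ?I
      = ?J k1 (fst z) - ?J k2 (snd z)"
    unfolding integral_fst[OF int] Henstock_Kurzweil_Integration.integral_diff[OF i1 i2, symmetric]
    by (simp add: complex_flow_def cscale_def k1_def k2_def)
  have f: "norm (fst ?I) \<le> 2 * (\<epsilon> * K * norm z)"
    unfolding f_eq
    using norm_triangle_ineq4[of "?J k1 (fst z)" "?J k2 (snd z)"]
      b1[of "fst z"] b2[of "snd z"] mono[OF norm_fst_le_prod[of z]] mono[OF norm_snd_le_prod[of z]] by linarith
  have s_eq: "snd ?I
      = ?J k1 (snd z) + ?J k2 (fst z)"
    unfolding integral_snd[OF int] Henstock_Kurzweil_Integration.integral_add[OF i1 i2, symmetric]
    by (simp add: complex_flow_def cscale_def k1_def k2_def)
  have s: "norm (snd ?I) \<le> 2 * (\<epsilon> * K * norm z)"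
    unfolding s_eq
    using norm_triangle_ineq[of "?J k1 (snd z)" "?J k2 (fst z)"]
      b1[of "snd z"] b2[of "fst z"] mono[OF norm_fst_le_prod[of z]] mono[OF norm_snd_le_prod[of z]] by linarith
  have "norm ?I \<le> 4 * (\<epsilon> * K * norm z)"
    using norm_prod_le_add[of ?I] f s by linarith
  then show ?thesis by (simp add: \<epsilon>_def algebra_simps)
qed

lemma laplace_bounded_half_plane:
  assumes bd: "laplace_bounded l K" and K: "0 \<le> K" and l: "l < Re \<zeta>"
  obtains Q where "\<And>z. Q z \<in> D \<times> D" "\<And>z. complex_shift A \<zeta> (Q z) = z"
    "\<And>z. (\<lambda>n. integral {0..real n} (\<lambda>r. complex_flow T \<zeta> r z)) \<longlonglongrightarrow> Q z"
    "\<zeta> \<in> resolvent_set D A"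
proof -
  interpret C: semiflow "complex_flow T \<zeta>" by (rule semiflow_complex_flow)
  have "0 < Re \<zeta> - l" using l by simp
  obtain Q where Q: "\<And>z. norm (Q z) \<le> 4 * K * norm z"
    "\<And>z. (\<lambda>n. C.orbit_integral (real n) z) \<longlonglongrightarrow> Q z"
    "\<And>z. has_generator_value (complex_flow T \<zeta>) (Q z) (- z)"
    "\<And>z. has_generator_value (complex_flow T \<zeta>) z 0 \<Longrightarrow> z = 0"
    using C.generator_inverse[OF \<open>0 < Re \<zeta> - l\<close> complex_flow_integral_bound[OF bd K _ _ l]] by blast
  have Q1: "Q z \<in> D \<times> D" and Q2: "complex_shift A \<zeta> (Q z) = z" for z
    using Q(3)[of z] unfolding complex_flow_generator_value by simp_all
  have inj: "z = w" if "z \<in> D \<times> D" "w \<in> D \<times> D" "complex_shift A \<zeta> z = complex_shift A \<zeta> w" for z w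
  proof -
    have "A (x - y) = A x - A y" if "x \<in> D" "y \<in> D" for x y
      using linear_generator that subspace_scale[of D y "-1"] unfolding linear_op_def
      by (metis add_uminus_conv_diff scaleR_minus1_left)
    then have "complex_shift A \<zeta> (z - w) = complex_shift A \<zeta> z - complex_shift A \<zeta> w"
      using that(1,2) unfolding complex_shift_def cscale_diff by (auto simp: mem_Times_iff)
    moreover have "z - w \<in> D \<times> D"
      using that(1,2) linear_generator unfolding linear_op_def by (auto simp: subspace_diff)
    ultimately have "has_generator_value (complex_flow T \<zeta>) (z - w) 0"
      using that(3) unfolding complex_flow_generator_value by simp
    then show ?thesis using Q(4) by fastforce
  qed
  have QS: "Q (complex_shift A \<zeta> z) = z" if "z \<in> D \<times> D" for z
    using inj[OF Q1 that Q2] .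
  have "bij_betw (complex_shift A \<zeta>) (D \<times> D) UNIV"
    by (rule bij_betwI[of _ _ _ Q]) (use Q1 Q2 QS in auto)
  moreover have "norm z \<le> 4 * K * norm (complex_shift A \<zeta> z)" if "z \<in> D \<times> D" for z
    using Q(1)[of "complex_shift A \<zeta> z"] QS[OF that] by simp
  ultimately have "\<zeta> \<in> resolvent_set D A" unfolding resolvent_set_def by blast
  then show ?thesis using that Q1 Q2 Q(2) unfolding C.orbit_integral_def by blast
qed

lemma laplace_bounded_positive_resolvent:
  assumes bd: "laplace_bounded l K" and K: "0 \<le> K" and l: "l < m"
  shows "\<exists>R. positive_resolvent D A m R"
proof -
  have "l < Re (complex_of_real m)" using l by simp
  from laplace_bounded_half_plane[OF bd K this]
  obtain Q where Q: "\<And>z. Q z \<in> D \<times> D" "\<And>z. complex_shift A (complex_of_real m) (Q z) = z"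
    "\<And>z. (\<lambda>n. integral {0..real n} (\<lambda>r. complex_flow T (complex_of_real m) r z)) \<longlonglongrightarrow> Q z"
    and m: "complex_of_real m \<in> resolvent_set D A" by blast
  interpret C: semiflow "complex_flow T (complex_of_real m)" by (rule semiflow_complex_flow)
  obtain R where R: "resolvent_op D A m R"
    using resolvent_set_imp_resolvent_op[OF linear_generator m] by blast
  have Req: "R x = fst (Q (x, 0))" for x
    by (rule resolvent_op_unique[OF R])
      (use Q(1)[of "(x, 0)"] Q(2)[of "(x, 0)"] in \<open>auto simp: complex_shift_of_real mem_Times_iff\<close>)
  have "0 \<le> R x" if "0 \<le> x" for x
    unfolding Req
  proof (rule tendsto_nonneg[OF tendsto_fst[OF Q(3)] sequentially_bot], intro always_eventually allI)
    fix n
    have "((\<lambda>r. exp (- m * r) *\<^sub>R T r x) has_integral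
        fst (integral {0..real n} (\<lambda>r. complex_flow T (complex_of_real m) r (x, 0)))) {0..real n}"
      using has_integral_linear[OF integrable_integral[OF C.orbit_integrable[of 0 "(x, 0)" "real n"]] bounded_linear_fst]
      by (simp add: o_def complex_flow_of_real)
    then show "0 \<le> fst (integral {0..real n} (\<lambda>r. complex_flow T (complex_of_real m) r (x, 0)))"
      by (rule has_integral_nonneg_lattice) (use semigroup_nonneg that in \<open>auto intro: scaleR_nonneg_nonneg\<close>)
  qed
  then show ?thesis using R unfolding positive_resolvent_def by blast
qed

text \<open>Beyond the growth bound the Laplace transform converges absolutely.\<close>

lemma ex_large_positive_resolvent: "\<exists>\<Lambda>. \<forall>l\<ge>\<Lambda>. \<exists>R. positive_resolvent D A l R"
proof -
  obtain M \<omega> where M: "1 \<le> M" "0 \<le> \<omega>" "\<And>t x. 0 \<le> t \<Longrightarrow> norm (T t x) \<le> M * exp (\<omega> * t) * norm x"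
    using growth_bound by blast
  have "laplace_bounded (\<omega> + 1) M"
    unfolding laplace_bounded_def
  proof (intro allI impI)
    fix x k and s t \<epsilon> :: real
    assume st: "0 \<le> s" "s \<le> t" and k: "continuous_on {s..t} k"
      and bk: "\<forall>r\<in>{s..t}. \<bar>k r\<bar> \<le> \<epsilon> * exp (- (\<omega> + 1) * r)"
    have "0 \<le> \<epsilon> * exp (- (\<omega> + 1) * s)" using bk st by (meson abs_ge_zero atLeastAtMost_iff order_refl order_trans)
    then have \<epsilon>: "0 \<le> \<epsilon>" by (simp add: zero_le_mult_iff)
    have ftc: "((\<lambda>r. exp (- r)) has_integral (- exp (- t) - - exp (- s))) {s..t}"
      by (rule fundamental_theorem_of_calculus[OF st(2)])
        (auto intro!: derivative_eq_intros simp: has_real_derivative_iff_has_vector_derivative[symmetric])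
    have "norm (integral {s..t} (\<lambda>r. k r *\<^sub>R T r x)) \<le> integral {s..t} (\<lambda>r. \<epsilon> * M * norm x * exp (- r))"
    proof (rule integral_norm_bound_integral)
      show "(\<lambda>r. k r *\<^sub>R T r x) integrable_on {s..t}" by (rule weighted_orbit_integrable[OF st(1) k])
      show "(\<lambda>r. \<epsilon> * M * norm x * exp (- r)) integrable_on {s..t}"
        by (intro integrable_continuous_real continuous_intros)
      fix r assume r: "r \<in> {s..t}"
      have "norm (k r *\<^sub>R T r x) \<le> (\<epsilon> * exp (- (\<omega> + 1) * r)) * (M * exp (\<omega> * r) * norm x)"
        using bk r st M(3)[of r x] by (simp only: norm_scaleR, intro mult_mono) (auto simp: \<epsilon>)
      also have "\<dots> = \<epsilon> * M * norm x * (exp (- (\<omega> + 1) * r) * exp (\<omega> * r))" by (simp add: mult_ac)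
      also have "exp (- (\<omega> + 1) * r) * exp (\<omega> * r) = exp (- r)"
        by (simp add: exp_add[symmetric] algebra_simps)
      finally show "norm (k r *\<^sub>R T r x) \<le> \<epsilon> * M * norm x * exp (- r)" .
    qed
    also have "\<dots> = \<epsilon> * M * norm x * (exp (- s) - exp (- t))"
      using has_integral_mult_right[OF ftc, of "\<epsilon> * M * norm x"] by (intro integral_unique) simp
    also have "\<dots> \<le> \<epsilon> * M * norm x * 1"
    proof (intro mult_left_mono)
      have "exp (- s) \<le> 1" using st by simp
      then show "exp (- s) - exp (- t) \<le> 1" using exp_ge_zero[of "- t"] by linarith
    qed (use \<epsilon> M in auto)
    finally show "norm (integral {s..t} (\<lambda>r. k r *\<^sub>R T r x)) \<le> \<epsilon> * M * norm x" by simp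
  qed
  then show ?thesis
    using laplace_bounded_positive_resolvent[of "\<omega> + 1" M] M(1) by (intro exI[of _ "\<omega> + 2"]) auto
qed

text \<open>A weighted orbit integral lies between \<open>\<plusminus>\<epsilon> \<integral>\<^sub>s\<^sup>t e\<^sup>-\<^sup>l\<^sup>r T(r) \<bar>x\<bar> dr\<close>, and these lie between \<open>\<plusminus>\<epsilon> R \<bar>x\<bar>\<close>
  because the remainder \<open>e\<^sup>-\<^sup>l\<^sup>t T(t) R \<bar>x\<bar>\<close> is nonnegative.\<close>

lemma positive_resolvent_laplace_bounded:
  assumes R: "positive_resolvent D A l R" and K: "\<And>x. norm (R x) \<le> K * norm x"
  shows "laplace_bounded l K"
  unfolding laplace_bounded_def
proof (intro allI impI)
  fix x k and s t \<epsilon> :: real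
  assume st: "0 \<le> s" "s \<le> t" and k: "continuous_on {s..t} k"
    and bk: "\<forall>r\<in>{s..t}. \<bar>k r\<bar> \<le> \<epsilon> * exp (- l * r)"
  have res: "resolvent_op D A l R" and Rpos: "\<And>x. 0 \<le> x \<Longrightarrow> 0 \<le> R x"
    using R unfolding positive_resolvent_def by auto
  have "0 \<le> \<epsilon> * exp (- l * s)" using bk st by (meson abs_ge_zero atLeastAtMost_iff order_refl order_trans)
  then have \<epsilon>: "0 \<le> \<epsilon>" by (simp add: zero_le_mult_iff)
  let ?f = "\<lambda>r. exp (- l * r) *\<^sub>R T r \<bar>x\<bar>"
  have f_int: "?f integrable_on {a..b}" if "0 \<le> a" for a b
    by (intro weighted_orbit_integrable that continuous_intros)
  have f_nonneg: "0 \<le> ?f r" if "0 \<le> r" for r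
    using semigroup_nonneg that by (intro scaleR_nonneg_nonneg) auto
  have t: "0 \<le> t" using st by simp
  have "0 \<le> integral {0..s} ?f"
    by (rule has_integral_nonneg_lattice[OF integrable_integral[OF f_int]]) (use f_nonneg in auto)
  then have "integral {s..t} ?f \<le> integral {0..s} ?f + integral {s..t} ?f"
    by (simp only: le_add_same_cancel2)
  also have "\<dots> = integral {0..t} ?f"
    by (rule Henstock_Kurzweil_Integration.integral_combine[OF st f_int[of 0 t]]) simp
  also have "integral {0..t} ?f = R \<bar>x\<bar> - exp (- l * t) *\<^sub>R T t (R \<bar>x\<bar>)"
    using resolvent_orbit_integral[OF res t] by (rule integral_unique)
  also have "\<dots> \<le> R \<bar>x\<bar>"
    using semigroup_nonneg[OF t Rpos[of "\<bar>x\<bar>"]] by (simp add: scaleR_nonneg_nonneg)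
  finally have f_le: "\<epsilon> *\<^sub>R integral {s..t} ?f \<le> \<epsilon> *\<^sub>R R \<bar>x\<bar>"
    using \<epsilon> by (rule scaleR_left_mono)
  have bound: "- (\<epsilon> *\<^sub>R ?f r) \<le> k r *\<^sub>R T r x \<and> k r *\<^sub>R T r x \<le> \<epsilon> *\<^sub>R ?f r" if r: "r \<in> {s..t}" for r
  proof -
    have r0: "0 \<le> r" using r st by simp
    have lin: "- T r \<bar>x\<bar> \<le> T r x" "T r x \<le> T r \<bar>x\<bar>"
      using positive_linear_abs_le[OF semigroup_linear semigroup_nonneg[OF r0]] by auto
    have c: "\<bar>k r\<bar> *\<^sub>R T r \<bar>x\<bar> \<le> \<epsilon> *\<^sub>R ?f r"
      using bk r scaleR_right_mono[of "\<bar>k r\<bar>" "\<epsilon> * exp (- l * r)" "T r \<bar>x\<bar>"] semigroup_nonneg[OF r0] by simp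
    have "- (\<bar>k r\<bar> *\<^sub>R T r \<bar>x\<bar>) \<le> k r *\<^sub>R T r x \<and> k r *\<^sub>R T r x \<le> \<bar>k r\<bar> *\<^sub>R T r \<bar>x\<bar>"
    proof (cases "0 \<le> k r")
      case True
      then show ?thesis
        using scaleR_left_mono[OF lin(1), of "k r"] scaleR_left_mono[OF lin(2), of "k r"] by simp
    next
      case False
      have "k r *\<^sub>R T r \<bar>x\<bar> \<le> - (k r *\<^sub>R T r x)"
        using scaleR_left_mono[OF lin(1), of "- k r"] False by simp
      then have "k r *\<^sub>R T r x \<le> - (k r *\<^sub>R T r \<bar>x\<bar>)"
        by (rule le_minus_iff[THEN iffD1])
      then show ?thesis
        using scaleR_left_mono[OF lin(2), of "- k r"] False by simp
    qed
    then show ?thesis using c by (meson neg_le_iff_le order_trans)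
  qed
  have k_int: "(\<lambda>r. k r *\<^sub>R T r x) integrable_on {s..t}" by (rule weighted_orbit_integrable[OF st(1) k])
  have \<epsilon>f_int: "(\<lambda>r. \<epsilon> *\<^sub>R ?f r) integrable_on {s..t}" "(\<lambda>r. - (\<epsilon> *\<^sub>R ?f r)) integrable_on {s..t}"
    using f_int[OF st(1)] by (intro integrable_neg integrable_cmul; assumption)+
  have up: "integral {s..t} (\<lambda>r. k r *\<^sub>R T r x) \<le> \<epsilon> *\<^sub>R integral {s..t} ?f"
    using integral_mono_lattice[OF k_int \<epsilon>f_int(1)] bound unfolding integral_cmul by blast
  have lo: "- (\<epsilon> *\<^sub>R integral {s..t} ?f) \<le> integral {s..t} (\<lambda>r. k r *\<^sub>R T r x)"
    using integral_mono_lattice[OF \<epsilon>f_int(2) k_int] bound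
    unfolding integral_cmul Henstock_Kurzweil_Integration.integral_neg by blast
  have "norm (integral {s..t} (\<lambda>r. k r *\<^sub>R T r x)) \<le> norm (\<epsilon> *\<^sub>R R \<bar>x\<bar>)"
  proof (rule norm_le_of_abs_le)
    show "- (\<epsilon> *\<^sub>R R \<bar>x\<bar>) \<le> integral {s..t} (\<lambda>r. k r *\<^sub>R T r x)"
      using lo f_le by (meson neg_le_iff_le order_trans)
    show "integral {s..t} (\<lambda>r. k r *\<^sub>R T r x) \<le> \<epsilon> *\<^sub>R R \<bar>x\<bar>"
      using up f_le by (rule order_trans)
  qed
  also have "\<dots> \<le> \<epsilon> * (K * norm x)" using K[of "\<bar>x\<bar>"] \<epsilon> by (simp add: mult_left_mono)
  finally show "norm (integral {s..t} (\<lambda>r. k r *\<^sub>R T r x)) \<le> \<epsilon> * K * norm x" by simp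
qed

lemma positive_resolvent_norm_bound:
  assumes "positive_resolvent D A l R"
  obtains K where "0 < K" "\<And>x. norm (R x) \<le> K * norm x"
  using assms bounded_linear.pos_bounded[of R] unfolding positive_resolvent_def resolvent_op_def
  by (metis mult.commute)

text \<open>Strict inequality comes from the step to \<open>l - d\<close>: the half-plane that avoids the spectrum starts
  to the left of \<open>l\<close>.\<close>

theorem positive_resolvent_imp_spectral_bound_less:
  assumes R: "positive_resolvent D A l R"
  shows "spectral_bound D A < ereal l"
proof -
  obtain K where K: "0 < K" "\<And>x. norm (R x) \<le> K * norm x"
    using positive_resolvent_norm_bound[OF R] by blast
  define d where "d = 1 / (2 * K)"
  have d: "0 < d" "d * K < 1" using K(1) by (auto simp: d_def)
  obtain R' where R': "positive_resolvent D A (l - d) R'"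
    using positive_resolvent_step_down[OF R K(2)] d K(1) by (meson less_imp_le)
  obtain K' where K': "0 < K'" "\<And>x. norm (R' x) \<le> K' * norm x"
    using positive_resolvent_norm_bound[OF R'] by blast
  have bd: "laplace_bounded (l - d) K'" by (rule positive_resolvent_laplace_bounded[OF R' K'(2)])
  have "Re \<zeta> \<le> l - d" if "\<zeta> \<in> spectrum D A" for \<zeta>
  proof (rule ccontr)
    assume "\<not> ?thesis"
    then have "l - d < Re \<zeta>" by simp
    from laplace_bounded_half_plane[OF bd _ this] K'(1) have "\<zeta> \<in> resolvent_set D A"
      by (meson less_imp_le)
    then show False using that by (simp add: spectrum_def)
  qed
  then have "spectral_bound D A \<le> ereal (l - d)"
    unfolding spectral_bound_def by (intro SUP_least) simp
  also have "\<dots> < ereal l" using d by simp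
  finally show ?thesis .
qed

theorem spectral_bound_less_imp_positive_resolvent:
  assumes "spectral_bound D A < ereal l"
  shows "\<exists>R. positive_resolvent D A l R"
proof -
  obtain \<Lambda> R where \<Lambda>: "l \<le> \<Lambda>" "positive_resolvent D A \<Lambda> R"
    using ex_large_positive_resolvent by (meson max.cobounded1 max.cobounded2)
  show ?thesis
  proof (rule positive_resolvent_descend_resolvent_set[OF linear_generator \<Lambda>(2,1)])
    fix m assume "l \<le> m"
    then have "spectral_bound D A < ereal m" using assms by (meson ereal_less_eq(3) less_le_trans)
    then show "complex_of_real m \<in> resolvent_set D A" by (rule above_spectral_bound)
  qed
qed

text \<open>Only orbits starting in the domain are controlled: for \<open>x = R y\<close> the rescaled orbit
  \<open>e\<^sup>-\<^sup>l\<^sup>t T(t) x\<close> differs from \<open>x\<close> by an orbit integral of \<open>y\<close>, which is bounded by \<open>R \<bar>y\<bar>\<close>. The constant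
  depends on \<open>y = (l - A) x\<close>, hence on \<open>x\<close>.\<close>

theorem spectral_bound_negative_imp_stable:
  assumes "spectral_bound D A < 0"
  shows "strongly_exp_stable T"
proof -
  obtain l :: real where l: "spectral_bound D A < ereal l" "l < 0"
    using ereal_dense3[of "spectral_bound D A" 0] assms
    by (metis ereal_less(2) ereal_dense2 ereal_less_ereal_Ex less_ereal.simps(1) zero_ereal_def)
  obtain R where R: "positive_resolvent D A l R"
    using spectral_bound_less_imp_positive_resolvent[OF l(1)] by blast
  obtain K where K: "0 < K" "\<And>x. norm (R x) \<le> K * norm x"
    using positive_resolvent_norm_bound[OF R] by blast
  have res: "resolvent_op D A l R" using R unfolding positive_resolvent_def by blast
  show ?thesis
    unfolding strongly_exp_stable_def
  proof (rule exI[of _ "- l"], intro conjI ballI)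
    show "0 < - l" using l(2) by simp
    fix x assume "x \<in> gen_dom T"
    then have x: "x \<in> D" using generates unfolding generates_def by simp
    define y where "y = l *\<^sub>R x - A x"
    have Ry: "R y = x" using res x unfolding resolvent_op_def y_def by blast
    define C where "C = norm x + K * norm y"
    have C: "norm (T t x) \<le> C * exp (l * t)" if t: "0 \<le> t" for t
    proof -
      have "integral {0..t} (\<lambda>r. exp (- l * r) *\<^sub>R T r y) = x - exp (- l * t) *\<^sub>R T t x"
        using resolvent_orbit_integral[OF res t, of y] unfolding Ry by (rule integral_unique)
      moreover have "norm (integral {0..t} (\<lambda>r. exp (- l * r) *\<^sub>R T r y)) \<le> 1 * K * norm y"
        by (rule laplace_boundedD[OF positive_resolvent_laplace_bounded[OF R K(2)] order_refl t])
          (auto intro!: continuous_intros)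
      ultimately have "norm (x - exp (- l * t) *\<^sub>R T t x) \<le> K * norm y" by simp
      then have "norm (exp (- l * t) *\<^sub>R T t x) \<le> C"
        using norm_triangle_ineq4[of x "x - exp (- l * t) *\<^sub>R T t x"] unfolding C_def by simp
      then have "exp (- l * t) * norm (T t x) \<le> C" by simp
      then have "exp (l * t) * (exp (- l * t) * norm (T t x)) \<le> exp (l * t) * C"
        by (intro mult_left_mono) auto
      moreover have "exp (l * t) * exp (- l * t) = 1" by (simp add: exp_add[symmetric])
      ultimately show ?thesis by (metis mult.assoc mult.commute mult_1)
    qed
    show "\<exists>M>0. \<forall>t\<ge>0. norm (T t x) \<le> M * exp (- (- l) * t) * norm x"
    proof (cases "x = 0")
      case True
      then show ?thesis by (intro exI[of _ 1]) auto
    next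
      case False
      have "0 < C" using False K(1) unfolding C_def by (intro add_pos_nonneg) auto
      then show ?thesis using C False by (intro exI[of _ "C / norm x"]) auto
    qed
  qed
qed

end

section \<open>Positive operators of spectral radius less than one\<close>

lemma funpow_linear:
  fixes H :: "'v::real_vector \<Rightarrow> 'v"
  assumes "linear H"
  shows "linear (H ^^ n)"
proof (induction n)
  case 0
  show ?case by (simp add: linear_iff)
next
  case (Suc n)
  have "linear (H \<circ> (H ^^ n))" by (rule linear_compose[OF Suc assms])
  then show ?case by (simp add: o_def)
qed

lemma funpow_nonneg:
  fixes H :: "'v::banach_lattice \<Rightarrow> 'v"
  assumes "\<And>v. 0 \<le> v \<Longrightarrow> 0 \<le> H v" "0 \<le> v"
  shows "0 \<le> (H ^^ n) v"
  by (induction n) (use assms in auto)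

text \<open>The square of \<open>\<Sum>\<^sub>k\<^sub>\<le>\<^sub>n H\<^sup>k\<close> contains \<open>H\<^sup>n\<close> with multiplicity \<open>n + 1\<close>, and its other terms are
  positive. Hence \<open>(n + 1) \<parallel>H\<^sup>n\<parallel>\<close> is bounded, some power has norm at most \<open>1/2\<close>, and the decay is geometric.\<close>

lemma positive_partial_sums_imp_power_decay:
  fixes H :: "'v::banach_lattice \<Rightarrow> 'v"
  assumes lin: "linear H" and pos: "\<And>v. 0 \<le> v \<Longrightarrow> 0 \<le> H v"
    and C: "\<And>n v. 0 \<le> v \<Longrightarrow> norm (\<Sum>k<n. (H ^^ k) v) \<le> C * norm v"
  obtains K q where "0 \<le> K" "0 < q" "q < 1" "\<And>n v. norm ((H ^^ n) v) \<le> K * q ^ n * norm v"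
proof -
  define B where "B = max C 0"
  have B: "norm (\<Sum>k<n. (H ^^ k) v) \<le> B * norm v" if "0 \<le> v" for n v
    using C[OF that, of n] mult_right_mono[of C B "norm v"] by (simp add: B_def)
  have B0: "0 \<le> B" by (simp add: B_def)
  note plin = funpow_linear[OF lin] and ppos = funpow_nonneg[of H, OF pos]
  have square: "real (Suc n) * norm ((H ^^ n) v) \<le> B * (B * norm v)" if v: "0 \<le> v" for n v
  proof -
    define s where "s = (\<Sum>k<Suc n. (H ^^ k) v)"
    have s0: "0 \<le> s" unfolding s_def by (intro sum_nonneg ppos v)
    have le: "(H ^^ n) v \<le> (H ^^ i) s" if "i < Suc n" for i
    proof -
      have "s = (H ^^ (n - i)) v + (\<Sum>k\<in>{..<Suc n} - {n - i}. (H ^^ k) v)"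
        unfolding s_def by (rule sum.remove) auto
      moreover have "0 \<le> (\<Sum>k\<in>{..<Suc n} - {n - i}. (H ^^ k) v)" by (intro sum_nonneg ppos v)
      ultimately have "(H ^^ (n - i)) v \<le> s" by (metis add.right_neutral add_left_mono)
      then have "(H ^^ i) ((H ^^ (n - i)) v) \<le> (H ^^ i) s"
        by (intro positive_linear_mono[of "H ^^ i"] plin ppos)
      moreover have "(H ^^ i) ((H ^^ (n - i)) v) = (H ^^ n) v"
        using that by (simp add: funpow_add[symmetric, unfolded o_def, THEN fun_cong])
      ultimately show ?thesis by simp
    qed
    have "real (Suc n) *\<^sub>R (H ^^ n) v = (\<Sum>i<Suc n. (H ^^ n) v)"
      by (simp only: sum_constant_scaleR card_lessThan)
    also have "\<dots> \<le> (\<Sum>i<Suc n. (H ^^ i) s)" by (intro sum_mono le) simp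
    finally have "norm (real (Suc n) *\<^sub>R (H ^^ n) v) \<le> norm (\<Sum>i<Suc n. (H ^^ i) s)"
      by (intro norm_mono_nonneg scaleR_nonneg_nonneg ppos v) auto
    also have "\<dots> \<le> B * norm s" by (rule B[OF s0])
    also have "\<dots> \<le> B * (B * norm v)"
      unfolding s_def by (intro mult_left_mono B v B0)
    finally show ?thesis by simp
  qed
  obtain N where N: "2 * (B * B) < real N" using reals_Archimedean2 by blast
  then have "N \<noteq> 0" using B0 by (intro notI) (simp add: mult_nonneg_nonneg leD)
  have bounded: "norm ((H ^^ n) v) \<le> (B * B) * norm v" for n v
  proof (rule positive_linear_norm_le[OF plin ppos])
    fix v :: 'v assume v: "0 \<le> v"
    have "1 * norm ((H ^^ n) v) \<le> real (Suc n) * norm ((H ^^ n) v)" by (intro mult_right_mono) auto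
    then show "norm ((H ^^ n) v) \<le> (B * B) * norm v" using square[OF v, of n] by simp
  qed simp
  have half: "norm ((H ^^ N) v) \<le> 1 / 2 * norm v" for v
  proof (rule positive_linear_norm_le[OF plin ppos])
    fix v :: 'v assume v: "0 \<le> v"
    have "real N * norm ((H ^^ N) v) \<le> real (Suc N) * norm ((H ^^ N) v)"
      by (intro mult_right_mono) auto
    also have "\<dots> \<le> (B * B) * norm v" using square[OF v, of N] by simp
    also have "\<dots> \<le> real N / 2 * norm v" using N by (intro mult_right_mono) auto
    finally show "norm ((H ^^ N) v) \<le> 1 / 2 * norm v" using \<open>N \<noteq> 0\<close> by simp
  qed simp
  have halves: "norm (((H ^^ N) ^^ m) v) \<le> (1 / 2) ^ m * norm v" for m v
  proof (induction m)
    case (Suc m)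
    have "norm (((H ^^ N) ^^ Suc m) v) \<le> 1 / 2 * norm (((H ^^ N) ^^ m) v)" using half by simp
    also have "\<dots> \<le> 1 / 2 * ((1 / 2) ^ m * norm v)" by (intro mult_left_mono Suc.IH) auto
    finally show ?case by simp
  qed simp
  \<comment> \<open>An \<open>N\<close>-th root turns halving in every \<open>N\<close> steps into a geometric rate; the factor \<open>2\<close> below absorbs the
    remainder \<open>n mod N\<close>.\<close>
  define q where "q = root N (1 / 2)"
  have qN: "q ^ N = 1 / 2" using \<open>N \<noteq> 0\<close> by (simp add: q_def)
  have q: "0 < q" "q < 1" using \<open>N \<noteq> 0\<close> by (auto simp: q_def)
  have "norm ((H ^^ n) v) \<le> 2 * (B * B) * q ^ n * norm v" for n v
  proof -
    have split: "n = N * (n div N) + n mod N" by simp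
    have "(H ^^ n) v = ((H ^^ N) ^^ (n div N)) ((H ^^ (n mod N)) v)"
      by (subst split) (simp only: funpow_add o_apply funpow_mult mult.commute)
    then have "norm ((H ^^ n) v) \<le> (1 / 2) ^ (n div N) * norm ((H ^^ (n mod N)) v)"
      using halves by simp
    also have "\<dots> \<le> (1 / 2) ^ (n div N) * ((B * B) * norm v)" by (intro mult_left_mono bounded) auto
    also have "(1 / 2) ^ (n div N) = 2 * (q ^ (N * (n div N)) * q ^ N)"
      by (simp add: power_mult qN)
    also have "\<dots> \<le> 2 * (q ^ (N * (n div N)) * q ^ (n mod N))"
      using q \<open>N \<noteq> 0\<close> by (intro mult_left_mono power_decreasing) (auto intro: less_imp_le)
    also have "\<dots> = 2 * q ^ n" by (simp only: power_add[symmetric] split[symmetric])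
    finally show ?thesis using B0 by (simp add: mult_right_mono mult.assoc mult.left_commute)
  qed
  then show ?thesis using that[of "2 * (B * B)" q] q B0 by simp
qed

definition positive_inverse :: "('v::banach_lattice \<Rightarrow> 'v) \<Rightarrow> ('v \<Rightarrow> 'v) \<Rightarrow> bool" where
  "positive_inverse N Q \<longleftrightarrow> linear Q \<and> (\<forall>v\<ge>0. 0 \<le> Q v) \<and> (\<forall>v. Q v - N (Q v) = v) \<and> (\<forall>v. Q (v - N v) = v)"

lemma power_decay_imp_positive_inverse:
  fixes H :: "'v::banach_lattice \<Rightarrow> 'v"
  assumes lin: "linear H" and pos: "\<And>v. 0 \<le> v \<Longrightarrow> 0 \<le> H v"
    and q: "0 < q" "q < 1" and K: "\<And>n v. norm ((H ^^ n) v) \<le> K * q ^ n * norm v"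
  shows "\<exists>Q. positive_inverse H Q"
proof -
  have bl: "bounded_linear H" by (rule positive_linear_bounded[OF lin pos])
  obtain Q where Q: "bounded_linear Q" "\<And>z. Q z - H (Q z) = z" "\<And>z. Q (z - H z) = z"
    "\<And>z. (\<lambda>n. (H ^^ n) z) sums Q z"
    using neumann_inverse[OF bl K] q by (meson less_imp_le)
  have "0 \<le> Q v" if "0 \<le> v" for v
    by (rule tendsto_nonneg[OF Q(4)[unfolded sums_def] sequentially_bot])
      (intro always_eventually allI sum_nonneg funpow_nonneg pos that)
  then show ?thesis using Q bounded_linear.linear unfolding positive_inverse_def by blast
qed

text \<open>The positive inverse dominates all partial sums of the Neumann series, since
  \<open>\<Sum>\<^sub>k\<^sub><\<^sub>n H\<^sup>k v = Q v - Q H\<^sup>n v\<close>. Geometric decay of the powers then inverts the complexified \<open>z - H\<close> for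
  every \<open>z\<close> outside a disc of radius less than one.\<close>

lemma positive_inverse_imp_spectral_radius:
  fixes H :: "'v::banach_lattice \<Rightarrow> 'v"
  assumes lin: "linear H" and pos: "\<And>v. 0 \<le> v \<Longrightarrow> 0 \<le> H v" and Q: "positive_inverse H Q"
  shows "spectral_radius H < 1"
proof -
  have linQ: "linear Q" and posQ: "\<And>v. 0 \<le> v \<Longrightarrow> 0 \<le> Q v" and QH: "\<And>v. Q (v - H v) = v"
    using Q unfolding positive_inverse_def by auto
  have "bounded_linear Q" by (rule positive_linear_bounded[OF linQ posQ])
  then obtain C where C: "\<And>v. norm (Q v) \<le> C * norm v"
    using bounded_linear.bounded by (metis mult.commute)
  note plin = funpow_linear[OF lin] and ppos = funpow_nonneg[of H, OF pos]
  have part: "(\<Sum>k<n. (H ^^ k) v) = Q v - Q ((H ^^ n) v)" for n v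
  proof (induction n)
    case (Suc n)
    have "(H ^^ n) v = Q ((H ^^ n) v) - Q ((H ^^ Suc n) v)"
      using QH[of "(H ^^ n) v"] by (simp add: linear_diff[OF linQ])
    then have "(\<Sum>k<Suc n. (H ^^ k) v) = (Q v - Q ((H ^^ n) v)) + (Q ((H ^^ n) v) - Q ((H ^^ Suc n) v))"
      by (simp only: sum.lessThan_Suc Suc)
    then show ?case by simp
  qed simp
  have "norm (\<Sum>k<n. (H ^^ k) v) \<le> C * norm v" if v: "0 \<le> v" for n v
  proof -
    have "(\<Sum>k<n. (H ^^ k) v) \<le> Q v"
      unfolding part using posQ[OF ppos[OF _ v]] by simp
    then have "norm (\<Sum>k<n. (H ^^ k) v) \<le> norm (Q v)"
      by (intro norm_mono_nonneg sum_nonneg ppos v) auto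
    then show ?thesis using C[of v] by simp
  qed
  from positive_partial_sums_imp_power_decay[OF lin pos this]
  obtain K q where K: "0 \<le> K" and q: "0 < q" "q < 1" and decay: "\<And>n v. norm ((H ^^ n) v) \<le> K * q ^ n * norm v"
    by blast
  have "cmod z \<le> q" if "z \<in> spectrum UNIV H" for z
  proof (rule ccontr)
    assume "\<not> cmod z \<le> q"
    then have z: "q < cmod z" "z \<noteq> 0" using q by auto
    define N where "N w = cscale (1 / z) (H (fst w), H (snd w))" for w
    have bl: "bounded_linear H" by (rule positive_linear_bounded[OF lin pos])
    have Npow: "(N ^^ n) w = cscale ((1 / z) ^ n) ((H ^^ n) (fst w), (H ^^ n) (snd w))" for n w
    proof (induction n)
      case (Suc n)
      have "N (cscale a u) = cscale (1 / z) (cscale a (H (fst u), H (snd u)))" for a u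
        unfolding N_def by (simp add: cscale_def linear_diff[OF lin] linear_add[OF lin] linear_scale[OF lin])
      then show ?case using Suc by (simp add: cscale_mult[symmetric])
    qed simp
    have Nb: "norm ((N ^^ n) w) \<le> 8 * K * (q / cmod z) ^ n * norm w" for n w
    proof -
      have "norm ((N ^^ n) w) \<le> 4 * cmod ((1 / z) ^ n) * norm ((H ^^ n) (fst w), (H ^^ n) (snd w))"
        unfolding Npow by (rule norm_cscale)
      also have "\<dots> \<le> 4 * cmod ((1 / z) ^ n) * (K * q ^ n * norm w + K * q ^ n * norm w)"
      proof (intro mult_left_mono order_trans[OF norm_prod_le_add] add_mono)
        show "norm (fst ((H ^^ n) (fst w), (H ^^ n) (snd w))) \<le> K * q ^ n * norm w"
          using order_trans[OF decay[of n "fst w"]] mult_left_mono[OF norm_fst_le_prod[of w], of "K * q ^ n"] K q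
          by simp
        show "norm (snd ((H ^^ n) (fst w), (H ^^ n) (snd w))) \<le> K * q ^ n * norm w"
          using order_trans[OF decay[of n "snd w"]] mult_left_mono[OF norm_snd_le_prod[of w], of "K * q ^ n"] K q
          by simp
      qed auto
      also have "\<dots> = 8 * K * (q / cmod z) ^ n * norm w"
        by (simp add: norm_divide norm_power power_divide)
      finally show ?thesis .
    qed
    have blN: "bounded_linear N"
    proof (rule bounded_linear_intro)
      show "N (x + y) = N x + N y" for x y
        by (simp add: N_def linear_add[OF lin] cscale_add[symmetric])
      show "N (c *\<^sub>R x) = c *\<^sub>R N x" for c x
        by (simp add: N_def linear_scale[OF lin] cscale_scaleR[symmetric])
      show "norm (N x) \<le> norm x * (8 * K * (q / cmod z))" for x
        using Nb[of 1 x] by (simp add: mult_ac)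
    qed
    obtain Q' where Q': "bounded_linear Q'" "\<And>w. Q' w - N (Q' w) = w" "\<And>w. Q' (w - N w) = w"
      using neumann_inverse[OF blN Nb] q z by (auto simp: divide_less_eq)
    obtain C' where C': "0 < C'" "\<And>w. norm (Q' w) \<le> norm w * C'"
      using bounded_linear.pos_bounded[OF Q'(1)] by blast
    have shift: "complex_shift H z w = cscale z (w - N w)" for w
      using z by (simp add: complex_shift_def N_def cscale_diff cscale_mult[symmetric])
    have inv: "cscale (1 / z) (cscale z u) = u" "cscale z (cscale (1 / z) u) = u" for u :: "'v \<times> 'v"
      using z by (simp_all add: cscale_mult[symmetric])
    define R where "R u = Q' (cscale (1 / z) u)" for u
    have "bij_betw (complex_shift H z) (UNIV \<times> UNIV) UNIV"
      by (rule bij_betwI[of _ _ _ R]) (auto simp: R_def shift inv Q')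
    moreover have "norm w \<le> (4 * cmod (1 / z) * C') * norm (complex_shift H z w)" for w
    proof -
      have "w = R (complex_shift H z w)" by (simp add: R_def shift inv Q')
      then have "norm w \<le> norm (cscale (1 / z) (complex_shift H z w)) * C'"
        unfolding R_def using C'(2) by metis
      also have "\<dots> \<le> (4 * cmod (1 / z) * norm (complex_shift H z w)) * C'"
        using C'(1) by (intro mult_right_mono norm_cscale) auto
      finally show ?thesis by (simp add: mult_ac)
    qed
    ultimately have "z \<in> resolvent_set UNIV H" unfolding resolvent_set_def by blast
    then show False using that by (simp add: spectrum_def)
  qed
  then have "spectral_radius H \<le> ereal q"
    unfolding spectral_radius_def by (intro SUP_least) simp
  also have "\<dots> < 1" using q by simp
  finally show ?thesis .
qed

text \<open>The resolvent is positive at large points and exists on \<open>[1, \<infinity>)\<close>, so positivity descends to \<open>1\<close>.\<close>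

lemma spectral_radius_less_one_imp_positive_inverse:
  fixes H :: "'v::banach_lattice \<Rightarrow> 'v"
  assumes lin: "linear H" and pos: "\<And>v. 0 \<le> v \<Longrightarrow> 0 \<le> H v" and r: "spectral_radius H < 1"
  shows "\<exists>Q. positive_inverse H Q"
proof -
  have bl: "bounded_linear H" by (rule positive_linear_bounded[OF lin pos])
  obtain C where C: "0 < C" "\<And>v. norm (H v) \<le> norm v * C"
    using bounded_linear.pos_bounded[OF bl] by blast
  define \<Lambda> where "\<Lambda> = 2 * C + 1"
  have \<Lambda>: "1 \<le> \<Lambda>" using C(1) by (simp add: \<Lambda>_def)
  define N where "N v = (1 / \<Lambda>) *\<^sub>R H v" for v
  have linN: "linear N"
    by (rule linearI) (simp_all add: N_def linear_add[OF lin] linear_scale[OF lin] scaleR_add_right)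
  have posN: "0 \<le> N v" if "0 \<le> v" for v
    using pos[OF that] \<Lambda> by (simp add: N_def scaleR_nonneg_nonneg)
  have Nb: "norm ((N ^^ n) v) \<le> 1 * (1 / 2) ^ n * norm v" for n v
  proof (induction n)
    case (Suc n)
    have "norm (N u) \<le> 1 / 2 * norm u" for u
    proof -
      have "norm (H u) \<le> norm u * (\<Lambda> / 2)"
        using C(2)[of u] mult_left_mono[of C "\<Lambda> / 2" "norm u"] by (simp add: \<Lambda>_def)
      then show ?thesis using \<Lambda> by (simp add: N_def field_simps)
    qed
    then have "norm ((N ^^ Suc n) v) \<le> 1 / 2 * norm ((N ^^ n) v)" by simp
    then show ?case using Suc by simp
  qed simp
  obtain Q where "positive_inverse N Q"
    using power_decay_imp_positive_inverse[OF linN posN _ _ Nb] by auto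
  then have linQ: "linear Q" and posQ: "\<And>v. 0 \<le> v \<Longrightarrow> 0 \<le> Q v"
    and Q: "\<And>v. Q v - N (Q v) = v" "\<And>v. Q (v - N v) = v" unfolding positive_inverse_def by auto
  have HN: "H v = \<Lambda> *\<^sub>R N v" for v using \<Lambda> by (simp add: N_def)
  have "positive_resolvent UNIV H \<Lambda> (\<lambda>v. (1 / \<Lambda>) *\<^sub>R Q v)"
    unfolding positive_resolvent_def resolvent_op_def
  proof (intro conjI allI impI ballI UNIV_I)
    show "bounded_linear (\<lambda>v. (1 / \<Lambda>) *\<^sub>R Q v)"
      by (intro bounded_linear_const_scaleR positive_linear_bounded linQ posQ)
    show "0 \<le> (1 / \<Lambda>) *\<^sub>R Q v" if "0 \<le> v" for v
      using posQ[OF that] \<Lambda> by (simp add: scaleR_nonneg_nonneg)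
    show "\<Lambda> *\<^sub>R ((1 / \<Lambda>) *\<^sub>R Q v) - H ((1 / \<Lambda>) *\<^sub>R Q v) = v" for v
      using Q(1)[of v] \<Lambda> by (simp add: linear_scale[OF lin] N_def)
    show "(1 / \<Lambda>) *\<^sub>R Q (\<Lambda> *\<^sub>R v - H v) = v" for v
      using Q(2)[of v] \<Lambda> by (simp add: HN scaleR_diff_right[symmetric] linear_scale[OF linQ])
  qed
  moreover have "linear_op UNIV H"
    unfolding linear_op_def by (auto simp: linear_add[OF lin] linear_scale[OF lin])
  moreover have "complex_of_real m \<in> resolvent_set UNIV H" if "1 \<le> m" for m
  proof (rule ccontr)
    assume "\<not> ?thesis"
    then have "complex_of_real m \<in> spectrum UNIV H" by (simp add: spectrum_def)
    then have "ereal (cmod (complex_of_real m)) \<le> spectral_radius H"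
      unfolding spectral_radius_def by (rule SUP_upper)
    then have "ereal (cmod (complex_of_real m)) < 1" using r by (rule le_less_trans)
    then show False using that by (simp add: one_ereal_def)
  qed
  ultimately obtain R where "positive_resolvent UNIV H 1 R"
    using positive_resolvent_descend_resolvent_set \<Lambda> by blast
  then show ?thesis
    unfolding positive_resolvent_def resolvent_op_def positive_inverse_def
    by (auto intro!: exI[of _ R] bounded_linear.linear)
qed

section \<open>Vector-valued Lebesgue spaces\<close>

lemma strongly_measurable_combine:
  fixes f :: "'a \<Rightarrow> 'v::real_normed_vector" and g :: "'a \<Rightarrow> 'w::real_normed_vector"
  assumes f: "strongly_measurable M f" and g: "strongly_measurable M g"
    and c: "\<And>s t x. (s \<longlonglongrightarrow> f x) \<Longrightarrow> (t \<longlonglongrightarrow> g x) \<Longrightarrow> (\<lambda>i::nat. c (s i) (t i)) \<longlonglongrightarrow> c (f x) (g x)"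
  shows "strongly_measurable M (\<lambda>x. c (f x) (g x) :: 'u::real_normed_vector)"
proof -
  obtain s t where s: "\<And>i::nat. simple_function M (s i)" "AE x in M. (\<lambda>i. s i x) \<longlonglongrightarrow> f x"
    and t: "\<And>i::nat. simple_function M (t i)" "AE x in M. (\<lambda>i. t i x) \<longlonglongrightarrow> g x"
    using f g unfolding strongly_measurable_def by blast
  have "simple_function M (\<lambda>x. c (s i x) (t i x))" for i
    by (rule simple_function_compose2[OF s(1) t(1)])
  moreover have "AE x in M. (\<lambda>i. c (s i x) (t i x)) \<longlonglongrightarrow> c (f x) (g x)"
    using s(2) t(2) by eventually_elim (rule c)
  ultimately show ?thesis
    unfolding strongly_measurable_def by (intro exI[of _ "\<lambda>i x. c (s i x) (t i x)"]) auto
qed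

text \<open>The limit of the simple functions exists only almost everywhere, so completeness of Lebesgue
  measure is needed.\<close>

lemma strongly_measurable_norm_powr:
  fixes f :: "real \<Rightarrow> 'v::real_normed_vector"
  assumes f: "strongly_measurable (lebesgue_on S) f" and S: "S \<in> sets lebesgue"
  shows "(\<lambda>x. norm (f x) powr p) \<in> borel_measurable (lebesgue_on S)"
proof -
  obtain s where s: "\<And>i::nat. simple_function (lebesgue_on S) (s i)"
    and lim: "AE x in lebesgue_on S. (\<lambda>i. s i x) \<longlonglongrightarrow> f x"
    using f unfolding strongly_measurable_def by blast
  define g where "g x = lim (\<lambda>i. norm (s i x))" for x
  have "(\<lambda>x. norm (s i x)) \<in> borel_measurable (lebesgue_on S)" for i
    by (rule borel_measurable_simple_function[OF simple_function_compose1[OF s]])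
  then have g: "g \<in> borel_measurable (lebesgue_on S)"
    unfolding g_def by (rule borel_measurable_lim_metric)
  have ae: "AE x in lebesgue_on S. g x = norm (f x)"
    using lim
  proof eventually_elim
    case (elim x)
    then show ?case unfolding g_def by (intro limI tendsto_norm)
  qed
  have "(\<lambda>x. indicator S x * g x) \<in> borel_measurable lebesgue"
    using g S by (subst (asm) borel_measurable_restrict_space_iff) auto
  moreover have "AE x in lebesgue. indicator S x * g x = indicator S x * norm (f x)"
    using ae S by (subst (asm) AE_restrict_space_iff) (auto elim!: eventually_mono simp: indicator_def)
  ultimately have "(\<lambda>x. indicator S x * norm (f x)) \<in> borel_measurable lebesgue"
    by (rule borel_measurable_AE)
  then have "(\<lambda>x. norm (f x)) \<in> borel_measurable (lebesgue_on S)"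
    using S by (subst borel_measurable_restrict_space_iff) auto
  then show ?thesis by measurable
qed

lemma powr_norm_add_le:
  fixes x y :: "'v::real_normed_vector"
  assumes "0 \<le> p"
  shows "norm (x + y) powr p \<le> 2 powr p * (norm x powr p + norm y powr p)"
proof -
  have "norm (x + y) \<le> 2 * max (norm x) (norm y)"
    using norm_triangle_ineq[of x y] by linarith
  then have "norm (x + y) powr p \<le> (2 * max (norm x) (norm y)) powr p"
    using assms by (intro powr_mono2) auto
  also have "\<dots> = 2 powr p * max (norm x) (norm y) powr p" by (simp add: powr_mult)
  also have "\<dots> \<le> 2 powr p * (norm x powr p + norm y powr p)"
    by (intro mult_left_mono) (auto simp: max_def)
  finally show ?thesis .
qed

lemma Lp_add:
  fixes f g :: "real \<Rightarrow> 'v::real_normed_vector"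
  assumes p: "0 \<le> p" and S: "S \<in> sets lebesgue" and f: "f \<in> Lp p S" and g: "g \<in> Lp p S"
  shows "(\<lambda>x. f x + g x) \<in> Lp p S"
proof -
  have m: "strongly_measurable (lebesgue_on S) (\<lambda>x. f x + g x)"
    by (rule strongly_measurable_combine[where c = "(+)"]) (use f g in \<open>auto simp: Lp_def intro: tendsto_add\<close>)
  have "integrable (lebesgue_on S) (\<lambda>x. norm (f x + g x) powr p)"
  proof (rule Bochner_Integration.integrable_bound)
    show "integrable (lebesgue_on S) (\<lambda>x. 2 powr p * (norm (f x) powr p + norm (g x) powr p))"
      using f g by (intro Bochner_Integration.integrable_mult_right Bochner_Integration.integrable_add) (auto simp: Lp_def)
    show "(\<lambda>x. norm (f x + g x) powr p) \<in> borel_measurable (lebesgue_on S)"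
      by (rule strongly_measurable_norm_powr[OF m S])
    show "AE x in lebesgue_on S. norm (norm (f x + g x) powr p) \<le> norm (2 powr p * (norm (f x) powr p + norm (g x) powr p))"
      using powr_norm_add_le[OF p] by (intro AE_I2) (simp add: abs_mult)
  qed
  then show ?thesis using m unfolding Lp_def by simp
qed

lemma Lp_uminus:
  fixes f :: "real \<Rightarrow> 'v::real_normed_vector"
  assumes f: "f \<in> Lp p S"
  shows "(\<lambda>x. - f x) \<in> Lp p S"
proof -
  have "strongly_measurable (lebesgue_on S) (\<lambda>x. - f x)"
    by (rule strongly_measurable_combine[where c = "\<lambda>x y. - x" and g = f])
      (use f in \<open>auto simp: Lp_def intro: tendsto_minus\<close>)
  then show ?thesis using f by (simp add: Lp_def)
qed

lemma Lp_diff: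
  fixes f g :: "real \<Rightarrow> 'v::real_normed_vector"
  assumes "0 \<le> p" "S \<in> sets lebesgue" "f \<in> Lp p S" "g \<in> Lp p S"
  shows "(\<lambda>x. f x - g x) \<in> Lp p S"
  using Lp_add[OF assms(1-3) Lp_uminus[OF assms(4)]] by simp

lemma continuous_norm_powr_integrable:
  fixes k :: "real \<Rightarrow> 'v::real_normed_vector"
  assumes "0 < p" "continuous_on {a..b} k"
  shows "integrable (lebesgue_on {a..b}) (\<lambda>s. norm (k s) powr p)"
  using assms by (intro continuous_imp_integrable_real continuous_on_powr' continuous_intros) auto

lemma Lp_scalar_multiple:
  fixes v :: "'v::real_normed_vector"
  assumes p: "0 < p" and k: "continuous_on {a..b} k"
  shows "(\<lambda>s. k s *\<^sub>R v) \<in> Lp p {a..b}"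
proof -
  have "k \<in> borel_measurable (lebesgue_on {a..b})"
    using k by (rule continuous_imp_measurable_on_sets_lebesgue) simp
  then obtain F where F: "\<And>i. simple_function (lebesgue_on {a..b}) (F i)"
    "\<And>x. x \<in> space (lebesgue_on {a..b}) \<Longrightarrow> (\<lambda>i. F i x) \<longlonglongrightarrow> k x"
    using borel_measurable_implies_sequence_metric[of k "lebesgue_on {a..b}" 0] by metis
  have "simple_function (lebesgue_on {a..b}) (\<lambda>x. F i x *\<^sub>R v)" for i
    by (rule simple_function_compose1[OF F(1)])
  moreover have "AE x in lebesgue_on {a..b}. (\<lambda>i. F i x *\<^sub>R v) \<longlonglongrightarrow> k x *\<^sub>R v"
    using F(2) by (intro AE_I2 tendsto_scaleR tendsto_const)
  ultimately have "strongly_measurable (lebesgue_on {a..b}) (\<lambda>s. k s *\<^sub>R v)"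
    unfolding strongly_measurable_def by (intro exI[of _ "\<lambda>i x. F i x *\<^sub>R v"]) auto
  moreover have "integrable (lebesgue_on {a..b}) (\<lambda>s. norm (k s *\<^sub>R v) powr p)"
    by (rule continuous_norm_powr_integrable[OF p]) (intro continuous_on_scaleR k continuous_on_const)
  ultimately show ?thesis unfolding Lp_def by simp
qed

lemma Lp_norm_powr:
  assumes "0 < p"
  shows "Lp_norm p S f powr p = (LINT s|lebesgue_on S. norm (f s) powr p)"
proof -
  have "0 \<le> (LINT s|lebesgue_on S. norm (f s) powr p)" by (intro Bochner_Integration.integral_nonneg) auto
  then show ?thesis using assms unfolding Lp_norm_def by (simp add: powr_powr powr_one)
qed

section \<open>The extrapolation space as an isometric copy of the state space\<close>

text \<open>\<open>J x\<close> is the common limit of \<open>j (s n)\<close> over all sequences with \<open>R (s n) \<rightarrow> x\<close>.\<close>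

lemma isometric_extension:
  fixes R :: "'x::banach \<Rightarrow> 'x" and j :: "'x \<Rightarrow> 'e::banach"
  assumes R: "linear R" and j: "linear j" and iso: "\<And>x. norm (j x) = norm (R x)"
    and dense: "closure (range R) = UNIV"
  obtains J where "linear J" "\<And>x. norm (J x) = norm x" "\<And>x. J (R x) = j x"
proof -
  have approx: "\<exists>s. (\<lambda>n. R (s n)) \<longlonglongrightarrow> x" for x
  proof -
    have "x \<in> closure (range R)" using dense by simp
    then obtain y where y: "\<And>n. y n \<in> range R" "y \<longlonglongrightarrow> x"
      unfolding closure_sequential by blast
    then obtain s where "\<And>n. y n = R (s n)" unfolding image_iff by metis
    then have "y = (\<lambda>n. R (s n))" by blast
    then show ?thesis using y(2) by blast
  qed
  have ex: "\<exists>e. \<forall>s. (\<lambda>n. R (s n)) \<longlonglongrightarrow> x \<longrightarrow> (\<lambda>n. j (s n)) \<longlonglongrightarrow> e" for x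
  proof -
    obtain s\<^sub>0 where s\<^sub>0: "(\<lambda>n. R (s\<^sub>0 n)) \<longlonglongrightarrow> x" using approx by blast
    have jdist: "dist (j a) (j b) = dist (R a) (R b)" for a b
      by (simp add: dist_norm linear_diff[OF j, symmetric] linear_diff[OF R, symmetric] iso)
    have "Cauchy (\<lambda>n. R (s\<^sub>0 n))" using s\<^sub>0 by (rule LIMSEQ_imp_Cauchy)
    then have "Cauchy (\<lambda>n. j (s\<^sub>0 n))" unfolding Cauchy_def jdist .
    then obtain e where e: "(\<lambda>n. j (s\<^sub>0 n)) \<longlonglongrightarrow> e" using Cauchy_convergent convergentD by blast
    have "(\<lambda>n. j (s n)) \<longlonglongrightarrow> e" if s: "(\<lambda>n. R (s n)) \<longlonglongrightarrow> x" for s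
    proof -
      have "(\<lambda>n. R (s n) - R (s\<^sub>0 n)) \<longlonglongrightarrow> x - x" by (intro tendsto_diff s s\<^sub>0)
      then have "(\<lambda>n. norm (R (s n) - R (s\<^sub>0 n))) \<longlonglongrightarrow> 0" by (simp add: tendsto_norm_zero)
      then have "(\<lambda>n. norm (j (s n) - j (s\<^sub>0 n))) \<longlonglongrightarrow> 0"
        using jdist by (simp add: dist_norm)
      then have "(\<lambda>n. j (s n) - j (s\<^sub>0 n)) \<longlonglongrightarrow> 0" by (simp add: tendsto_norm_zero_iff)
      from tendsto_add[OF this e] show ?thesis by simp
    qed
    then show ?thesis by blast
  qed
  then obtain J where J: "\<And>x s. (\<lambda>n. R (s n)) \<longlonglongrightarrow> x \<Longrightarrow> (\<lambda>n. j (s n)) \<longlonglongrightarrow> J x" by metis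
  have JR: "J (R x) = j x" for x
    using LIMSEQ_unique[OF J[of "\<lambda>n. x" "R x"] tendsto_const] by simp
  have "linear J"
  proof (rule linearI)
    fix x y :: 'x and c :: real
    obtain s t where s: "(\<lambda>n. R (s n)) \<longlonglongrightarrow> x" and t: "(\<lambda>n. R (t n)) \<longlonglongrightarrow> y" using approx by blast
    have "(\<lambda>n. R (s n + t n)) \<longlonglongrightarrow> x + y" using tendsto_add[OF s t] by (simp add: linear_add[OF R])
    from J[OF this] have "(\<lambda>n. j (s n) + j (t n)) \<longlonglongrightarrow> J (x + y)" by (simp add: linear_add[OF j])
    then show "J (x + y) = J x + J y" using tendsto_add[OF J[OF s] J[OF t]] LIMSEQ_unique by blast
    have "(\<lambda>n. R (c *\<^sub>R s n)) \<longlonglongrightarrow> c *\<^sub>R x"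
      using tendsto_scaleR[OF tendsto_const s] by (simp add: linear_scale[OF R])
    from J[OF this] have "(\<lambda>n. c *\<^sub>R j (s n)) \<longlonglongrightarrow> J (c *\<^sub>R x)" by (simp add: linear_scale[OF j])
    then show "J (c *\<^sub>R x) = c *\<^sub>R J x" using tendsto_scaleR[OF tendsto_const J[OF s]] LIMSEQ_unique by blast
  qed
  moreover have "norm (J x) = norm x" for x
  proof -
    obtain s where s: "(\<lambda>n. R (s n)) \<longlonglongrightarrow> x" using approx by blast
    have "(\<lambda>n. norm (R (s n))) \<longlonglongrightarrow> norm (J x)" using tendsto_norm[OF J[OF s]] by (simp add: iso)
    then show ?thesis using tendsto_norm[OF s] LIMSEQ_unique by blast
  qed
  ultimately show ?thesis using that JR by blast
qed

lemma isometry_dense_range_surj: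
  fixes J :: "'x::banach \<Rightarrow> 'e::banach"
  assumes lin: "linear J" and iso: "\<And>x. norm (J x) = norm x" and dense: "closure (range J) = UNIV"
  shows "surj J"
proof -
  have "y \<in> range J" for y
  proof -
    have "y \<in> closure (range J)" using dense by simp
    then obtain f where f: "\<And>n. f n \<in> range J" "f \<longlonglongrightarrow> y" unfolding closure_sequential by blast
    then obtain s where s: "\<And>n. f n = J (s n)" unfolding image_iff by metis
    have "dist (J a) (J b) = dist a b" for a b
      by (simp add: dist_norm linear_diff[OF lin, symmetric] iso)
    moreover have "Cauchy f" using f(2) by (rule LIMSEQ_imp_Cauchy)
    ultimately have "Cauchy s" unfolding Cauchy_def s by simp
    then obtain x where "s \<longlonglongrightarrow> x" using Cauchy_convergent convergentD by blast
    moreover have "bounded_linear J"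
      using lin iso by (intro bounded_linear_intro[where K = 1]) (auto simp: linear_add linear_scale)
    ultimately have "(\<lambda>n. J (s n)) \<longlonglongrightarrow> J x" by (rule bounded_linear.tendsto[rotated])
    then have "f \<longlonglongrightarrow> J x" using s by presburger
    then show ?thesis using f(2) LIMSEQ_unique by blast
  qed
  then show ?thesis by blast
qed

text \<open>\<open>J\<close> is \<open>\<mu> - A\<^sub>-\<^sub>1\<close>, an isometry of \<open>X\<close> onto the extrapolation space that conjugates the extended
  semigroup to \<open>T\<close>. It turns the control operator into \<open>J D\<^sub>\<mu>\<close> and integrals in the extrapolation space into
  integrals in \<open>X\<close>.\<close>

lemma (in positive_generator) extrapolation_isometry:
  fixes j :: "'x \<Rightarrow> 'e::banach"
  assumes \<mu>: "complex_of_real \<mu> \<in> resolvent_set D A" and ex: "extrapolation_space D A \<mu> j"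
  obtains R J where "resolvent_op D A \<mu> R" "bounded_linear J" "\<And>x. J (R x) = j x" "inj j"
    "\<forall>t\<ge>0. \<forall>x. ext_sg T j t (J x) = J (T t x)"
    "\<And>x. gen_map (ext_sg T j) (j x) = \<mu> *\<^sub>R j x - J x"
proof -
  obtain R where R: "resolvent_op D A \<mu> R" using resolvent_set_imp_resolvent_op[OF linear_generator \<mu>] by blast
  have blR: "bounded_linear R" and RD: "\<And>x. R x \<in> D" "\<And>x. \<mu> *\<^sub>R R x - A (R x) = x"
    and DR: "\<And>x. x \<in> D \<Longrightarrow> R (\<mu> *\<^sub>R x - A x) = x" using R unfolding resolvent_op_def by auto
  have linR: "linear R" using blR bounded_linear.linear by blast
  have res: "resolvent D A \<mu> x = R x" for x
    unfolding resolvent_def by (rule the_equality) (use RD DR in auto)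
  have linj: "linear j" and iso: "\<And>x. norm (j x) = norm (R x)" and densej: "closure (range j) = UNIV"
    using ex unfolding extrapolation_space_def res by auto
  have "range R = D" using RD(1) DR by (metis image_subset_iff subsetI subset_antisym rangeI)
  then have "closure (range R) = UNIV" using domain_dense by simp
  then obtain J where linJ: "linear J" and isoJ: "\<And>x. norm (J x) = norm x" and JR: "\<And>x. J (R x) = j x"
    using isometric_extension[OF linR linj iso] by blast
  have blJ: "bounded_linear J"
    using linJ isoJ by (intro bounded_linear_intro[where K = 1]) (auto simp: linear_add linear_scale)
  have "range j \<subseteq> range J" using JR by (metis image_subsetI rangeI)
  then have "closure (range J) = UNIV" using densej closure_mono by blast
  then have surj: "surj J" using isometry_dense_range_surj[OF linJ isoJ] by blast
  have inj_of_norm: "inj f" if "linear f" "\<And>x. f x = 0 \<Longrightarrow> x = 0" for f :: "'x \<Rightarrow> 'e"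
    using that by (simp add: linear_injective_0)
  have injJ: "inj J" by (rule inj_of_norm[OF linJ]) (metis isoJ norm_eq_zero)
  have injj: "inj j"
  proof (rule inj_of_norm[OF linj])
    fix x assume "j x = 0"
    then have "R x = 0" using iso[of x] by simp
    then have "A (0 *\<^sub>R R x) = x \<or> x = - A (0 *\<^sub>R R x)" using RD(2)[of x] by simp
    moreover have "A (0 *\<^sub>R R x) = 0 *\<^sub>R A (R x)"
      using linear_generator RD(1)[of x] unfolding linear_op_def by blast
    ultimately show "x = 0" by simp
  qed
  define K where "K = inv J"
  have KJ: "K (J x) = x" for x unfolding K_def using injJ by simp
  have JK: "J (K e) = e" for e unfolding K_def using surj by (rule surj_f_inv_f)
  have blK: "bounded_linear K"
  proof (rule bounded_linear_intro[where K = 1])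
    show "K (x + y) = K x + K y" for x y by (metis KJ JK linear_add[OF linJ])
    show "K (c *\<^sub>R x) = c *\<^sub>R K x" for c x by (metis KJ JK linear_scale[OF linJ])
    show "norm (K x) \<le> norm x * 1" for x using isoJ[of "K x"] by (simp add: JK)
  qed
  have ext: "ext_sg T j t (J x) = J (T t x)" if t: "0 \<le> t" for t x
  proof -
    define S where "S = Blinfun (\<lambda>e. J (T t (K e)))"
    have "bounded_linear (\<lambda>e. J (T t (K e)))"
      using bounded_linear_compose[OF blJ bounded_linear_compose[OF blinfun.bounded_linear_right blK]] .
    then have S: "S e = J (T t (K e))" for e unfolding S_def by (simp add: bounded_linear_Blinfun_apply)
    have Sj: "\<forall>x. S (j x) = j (T t x)"
      by (simp add: S JR[symmetric] KJ resolvent_commute[OF R t])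
    have "ext_sg T j t = S"
      unfolding ext_sg_def
    proof (rule the_equality[where P = "\<lambda>S. \<forall>x. blinfun_apply S (j x) = j (blinfun_apply (T t) x)", OF Sj])
      fix S' :: "'e \<Rightarrow>\<^sub>L 'e" assume S': "\<forall>x. S' (j x) = j (T t x)"
      have "closed {e. S' e = S e}"
        by (intro closed_Collect_eq) (auto intro!: continuous_intros)
      moreover have "range j \<subseteq> {e. S' e = S e}" using S' Sj by auto
      ultimately have "closure (range j) \<subseteq> {e. S' e = S e}" by (rule closure_minimal[rotated])
      then show "S' = S" using densej by (intro blinfun_eqI) auto
    qed
    then show ?thesis by (simp add: S KJ)
  qed
  have gen: "gen_map (ext_sg T j) (j x) = \<mu> *\<^sub>R j x - J x" for x
    unfolding gen_map_def
  proof (rule tendsto_Lim[OF trivial_limit_at_right_real])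
    have "has_generator_value (\<lambda>h. blinfun_apply (T h)) (R x) (A (R x))"
      using RD(1) by (simp add: generator_value_iff)
    then have "((\<lambda>h. J ((T h (R x) - R x) /\<^sub>R h)) \<longlongrightarrow> J (A (R x))) (at_right 0)"
      unfolding has_generator_value_def by (rule bounded_linear.tendsto[OF blJ])
    moreover have "\<forall>\<^sub>F h in at_right 0. J ((T h (R x) - R x) /\<^sub>R h) = (ext_sg T j h (j x) - j x) /\<^sub>R h"
      using eventually_at_right_less[of 0]
      by eventually_elim (simp add: ext JR[symmetric] linear_diff[OF linJ] linear_scale[OF linJ])
    moreover have "J (A (R x)) = \<mu> *\<^sub>R j x - J x"
    proof -
      have "A (R x) = \<mu> *\<^sub>R R x - x" using RD(2)[of x] by (simp add: algebra_simps)
      then show ?thesis by (simp add: linear_diff[OF linJ] linear_scale[OF linJ] JR)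
    qed
    ultimately show "((\<lambda>h. (ext_sg T j h (j x) - j x) /\<^sub>R h) \<longlongrightarrow> \<mu> *\<^sub>R j x - J x) (at_right 0)"
      using Lim_transform_eventually by fastforce
  qed
  have "\<forall>t\<ge>0. \<forall>x. ext_sg T j t (J x) = J (T t x)" using ext by blast
  then show ?thesis using that[OF R blJ JR injj _ gen] by blast
qed

section \<open>Dirichlet operators\<close>

locale boundary_system =
  fixes D :: "'x::banach_lattice set" and Am :: "'x \<Rightarrow> 'x"
    and G P :: "'x \<Rightarrow> 'v::banach_lattice" and T :: "real \<Rightarrow> 'x \<Rightarrow>\<^sub>L 'x"
  assumes linear_Am: "linear_op D Am" and linear_G: "linear_op D G" and onto: "G ` D = UNIV"
    and linear_P: "linear_op D P" and positive_P: "positive_op D P"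
    and generates_A: "generates (ker_dom D G) Am T" and positive_T: "positive_semigroup T"
begin

abbreviation DA :: "'x set" where "DA \<equiv> ker_dom D G"
abbreviation Dir :: "real \<Rightarrow> 'v \<Rightarrow> 'x" where "Dir \<equiv> dirichlet D Am G"
abbreviation H :: "real \<Rightarrow> 'v \<Rightarrow> 'v" where "H l v \<equiv> P (Dir l v)"

lemma subspace_D: "subspace D"
  using linear_Am unfolding linear_op_def by blast

lemma D_closed: "x \<in> D \<Longrightarrow> y \<in> D \<Longrightarrow> x + y \<in> D" "x \<in> D \<Longrightarrow> y \<in> D \<Longrightarrow> x - y \<in> D" "x \<in> D \<Longrightarrow> c *\<^sub>R x \<in> D"
  using subspace_D by (auto simp: subspace_add subspace_diff subspace_scale)

lemma linear_op_rules:
  assumes "linear_op D F"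
  shows "x \<in> D \<Longrightarrow> y \<in> D \<Longrightarrow> F (x + y) = F x + F y" "x \<in> D \<Longrightarrow> F (c *\<^sub>R x) = c *\<^sub>R F x"
    "x \<in> D \<Longrightarrow> y \<in> D \<Longrightarrow> F (x - y) = F x - F y"
proof -
  show add: "F (x + y) = F x + F y" if "x \<in> D" "y \<in> D" for x y
    using assms that unfolding linear_op_def by blast
  show scale: "F (c *\<^sub>R x) = c *\<^sub>R F x" if "x \<in> D" for c x
    using assms that unfolding linear_op_def by blast
  show "F (x - y) = F x - F y" if "x \<in> D" "y \<in> D" for x y
    using add[OF that(1) D_closed(3)[OF that(2), of "-1"]] scale[OF that(2), of "-1"] by simp
qed

lemmas Am_rules = linear_op_rules[OF linear_Am]
lemmas G_rules = linear_op_rules[OF linear_G]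
lemmas P_rules = linear_op_rules[OF linear_P]

lemma linear_op_DA: "linear_op DA Am"
proof -
  have "G 0 = 0" using G_rules(2)[of 0 0] subspace_0[OF subspace_D] by simp
  then have "subspace DA"
    unfolding ker_dom_def using subspace_D
    by (intro subspaceI) (auto simp: subspace_0 G_rules D_closed)
  then show ?thesis
    unfolding linear_op_def using Am_rules unfolding ker_dom_def by auto
qed

sublocale A: positive_generator DA Am T
  by unfold_locales (rule linear_op_DA generates_A positive_T)+

lemma DA_subset: "x \<in> DA \<Longrightarrow> x \<in> D \<and> G x = 0"
  by (simp add: ker_dom_def)

lemma resolventD:
  assumes "resolvent_op DA Am l R"
  shows "R x \<in> D" "G (R x) = 0" "Am (R x) = l *\<^sub>R R x - x" "linear R"
    "x \<in> D \<Longrightarrow> G x = 0 \<Longrightarrow> R (l *\<^sub>R x - Am x) = x"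
proof -
  have R: "R x \<in> DA" "l *\<^sub>R R x - Am (R x) = x" "bounded_linear R"
    and DR: "x \<in> DA \<Longrightarrow> R (l *\<^sub>R x - Am x) = x"
    using assms unfolding resolvent_op_def by auto
  show "R x \<in> D" "G (R x) = 0" using R(1) DA_subset by auto
  show "Am (R x) = l *\<^sub>R R x - x" using R(2) by (simp add: algebra_simps)
  show "linear R" using R(3) bounded_linear.linear by blast
  show "R (l *\<^sub>R x - Am x) = x" if "x \<in> D" "G x = 0" using DR that by (simp add: ker_dom_def)
qed

lemma dirichlet_unique:
  assumes R: "resolvent_op DA Am l R" and x: "x \<in> D" "Am x = l *\<^sub>R x"
  shows "Dir l (G x) = x"
  unfolding dirichlet_def
proof (rule the_equality)
  show "x \<in> D \<and> l *\<^sub>R x - Am x = 0 \<and> G x = G x" using x by simp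
  fix y assume y: "y \<in> D \<and> l *\<^sub>R y - Am y = 0 \<and> G y = G x"
  have "R (l *\<^sub>R (y - x) - Am (y - x)) = y - x"
    by (rule resolventD(5)[OF R]) (use x y in \<open>auto simp: D_closed G_rules\<close>)
  moreover have "l *\<^sub>R (y - x) - Am (y - x) = 0"
    using x y by (simp add: Am_rules algebra_simps)
  ultimately show "y = x" using linear_0[OF resolventD(4)[OF R]] by simp
qed

lemma dirichlet:
  assumes R: "resolvent_op DA Am l R"
  shows "Dir l v \<in> D" "Am (Dir l v) = l *\<^sub>R Dir l v" "G (Dir l v) = v"
proof -
  obtain y where y: "y \<in> D" "G y = v" using onto by (metis UNIV_I imageE)
  define x where "x = y - R (l *\<^sub>R y - Am y)"
  have x: "x \<in> D" "G x = v" "Am x = l *\<^sub>R x"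
    using y by (auto simp: x_def D_closed G_rules Am_rules resolventD(1-3)[OF R]) (simp add: algebra_simps)
  then have "Dir l v = x" using dirichlet_unique[OF R x(1,3)] by simp
  then show "Dir l v \<in> D" "Am (Dir l v) = l *\<^sub>R Dir l v" "G (Dir l v) = v" using x by auto
qed

text \<open>The domain of \<open>A\<^sub>m\<close> is the direct sum of \<open>ker G\<close> and \<open>ker (l - A\<^sub>m)\<close>.\<close>

lemma decompose:
  assumes R: "resolvent_op DA Am l R" and x: "x \<in> D"
  shows "x = R (l *\<^sub>R x - Am x) + Dir l (G x)"
proof -
  let ?y = "x - R (l *\<^sub>R x - Am x)"
  have "?y \<in> D" "Am ?y = l *\<^sub>R ?y" "G ?y = G x"
    using x by (auto simp: D_closed G_rules Am_rules resolventD(1-3)[OF R]) (simp add: algebra_simps)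
  then have "Dir l (G x) = ?y" using dirichlet_unique[OF R] by metis
  then show ?thesis by simp
qed

lemma linear_dirichlet:
  assumes R: "resolvent_op DA Am l R"
  shows "linear (Dir l)"
proof (rule linearI)
  note d = dirichlet[OF R]
  show "Dir l (v + w) = Dir l v + Dir l w" for v w
    using dirichlet_unique[OF R, of "Dir l v + Dir l w"] d by (simp add: D_closed G_rules Am_rules algebra_simps)
  show "Dir l (c *\<^sub>R v) = c *\<^sub>R Dir l v" for c v
    using dirichlet_unique[OF R, of "c *\<^sub>R Dir l v"] d by (simp add: D_closed G_rules Am_rules)
qed

lemma linear_transfer:
  assumes R: "resolvent_op DA Am l R"
  shows "linear (H l)"
proof (rule linearI)
  note d = dirichlet[OF R] and lin = linear_dirichlet[OF R]
  show "H l (v + w) = H l v + H l w" for v w using d by (simp add: linear_add[OF lin] P_rules)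
  show "H l (c *\<^sub>R v) = c *\<^sub>R H l v" for c v using d by (simp add: linear_scale[OF lin] P_rules)
qed

lemma dirichlet_shift:
  assumes R: "resolvent_op DA Am l R" and Q: "resolvent_op DA Am m Q"
  shows "Dir m v = Dir l v + (l - m) *\<^sub>R Q (Dir l v)"
proof -
  let ?x = "Dir l v + (l - m) *\<^sub>R Q (Dir l v)"
  have "?x \<in> D" "Am ?x = m *\<^sub>R ?x" "G ?x = v"
    by (auto simp: D_closed G_rules Am_rules dirichlet[OF R] resolventD(1-3)[OF Q]) (simp add: algebra_simps)
  then show ?thesis using dirichlet_unique[OF Q] by metis
qed

lemma dirichlet_nonneg_below:
  assumes R: "resolvent_op DA Am l R" and Q: "positive_resolvent DA Am m Q"
    and ml: "m \<le> l" and pos: "\<And>v. 0 \<le> v \<Longrightarrow> 0 \<le> Dir l v" and v: "0 \<le> v"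
  shows "0 \<le> Dir m v"
proof -
  have "0 \<le> (l - m) *\<^sub>R Q (Dir l v)"
    using Q pos[OF v] ml unfolding positive_resolvent_def by (intro scaleR_nonneg_nonneg) auto
  moreover have "resolvent_op DA Am m Q" using Q unfolding positive_resolvent_def by blast
  ultimately show ?thesis using dirichlet_shift[OF R, of m Q v] pos[OF v] by simp
qed

lemma transfer_nonneg:
  assumes R: "resolvent_op DA Am l R" and pos: "\<And>v. 0 \<le> v \<Longrightarrow> 0 \<le> Dir l v" and v: "0 \<le> v"
  shows "0 \<le> H l v"
  using positive_P dirichlet(1)[OF R] pos[OF v] unfolding positive_op_def by blast

section \<open>The response to exponential inputs\<close>

text \<open>The input \<open>e\<^sup>l\<^sup>t v\<close> started in the state \<open>D\<^sub>l v\<close> keeps the state at \<open>e\<^sup>l\<^sup>t D\<^sub>l v\<close>; starting at \<open>0\<close> instead subtracts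
  \<open>T(t) D\<^sub>l v\<close>, which need not lie in the domain of \<open>P\<close>. For the difference of two exponentials the correction is
  \<open>T(t) (D\<^sub>m v - D\<^sub>l v)\<close>, and \<open>D\<^sub>m v - D\<^sub>l v\<close> lies in the domain of \<open>A\<close>.\<close>

lemma exponential_io_map:
  fixes j :: "'x \<Rightarrow> 'e::banach"
  assumes \<mu>: "complex_of_real \<mu> \<in> resolvent_set DA Am" and ex: "extrapolation_space DA Am \<mu> j"
    and Rl: "resolvent_op DA Am l Rl" and Rm: "resolvent_op DA Am m Rm" and t: "0 \<le> t"
  shows "io_map T j (control_op D Am G T j \<mu>) P (\<lambda>s. (exp (l * s) - exp (m * s)) *\<^sub>R v) t
    = exp (l * t) *\<^sub>R H l v - exp (m * t) *\<^sub>R H m v + P (T t (Dir m v - Dir l v))"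
proof -
  obtain R J where R: "resolvent_op DA Am \<mu> R" and blJ: "bounded_linear J" and JR: "\<And>x. J (R x) = j x"
    and inj: "inj j" and ext: "\<forall>t\<ge>0. \<forall>x. ext_sg T j t (J x) = J (T t x)"
    and gen: "\<And>x. gen_map (ext_sg T j) (j x) = \<mu> *\<^sub>R j x - J x"
    by (rule A.extrapolation_isometry[OF \<mu> ex]) (rule that)
  interpret J: bounded_linear J by (rule blJ)
  have B: "control_op D Am G T j \<mu> w = J (Dir \<mu> w)" for w
    by (simp add: control_op_def gen)
  \<comment> \<open>With \<open>k\<close> a resolvent point, \<open>R(k) D\<^sub>\<mu> = R(\<mu>) D\<^sub>k\<close>; the right-hand side is in the range of \<open>R(\<mu>)\<close>, where \<open>J R = j\<close>.\<close>
  have commute: "Q (Dir \<mu> v) = R (Dir k v)" if Q: "resolvent_op DA Am k Q" for k Q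
  proof (cases "k = \<mu>")
    case True
    then have "Q x = R x" for x
      using resolvent_identity[OF Q R, of x] by simp
    then show ?thesis using True by simp
  next
    case False
    have "(\<mu> - k) *\<^sub>R Q (Dir \<mu> v) = Dir k v - Dir \<mu> v"
      using dirichlet_shift[OF R Q, of v] by (metis add_diff_cancel_left')
    moreover have "(k - \<mu>) *\<^sub>R R (Dir k v) = Dir \<mu> v - Dir k v"
      using dirichlet_shift[OF Q R, of v] by (metis add_diff_cancel_left')
    ultimately have "(\<mu> - k) *\<^sub>R Q (Dir \<mu> v) = (\<mu> - k) *\<^sub>R R (Dir k v)"
      by (metis minus_diff_eq scaleR_minus_left)
    then show ?thesis using False by simp
  qed
  have single: "((\<lambda>s. exp (k * s) *\<^sub>R T (t - s) (Dir \<mu> v)) has_integral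
      R (exp (k * t) *\<^sub>R Dir k v - T t (Dir k v))) {0..t}" if Q: "resolvent_op DA Am k Q" for k Q
  proof -
    have "((\<lambda>s. exp (- k * (t - s)) *\<^sub>R T (t - s) (Dir \<mu> v)) has_integral
        (Q (Dir \<mu> v) - exp (- k * t) *\<^sub>R T t (Q (Dir \<mu> v)))) {0..t}"
      by (rule has_integral_reflect_interval[OF A.resolvent_orbit_integral[OF Q t]])
    from has_integral_cmul[OF this, of "exp (k * t)"]
    have "((\<lambda>s. (exp (k * t) * exp (- k * (t - s))) *\<^sub>R T (t - s) (Dir \<mu> v)) has_integral
        (exp (k * t) *\<^sub>R Q (Dir \<mu> v) - (exp (k * t) * exp (- k * t)) *\<^sub>R T t (Q (Dir \<mu> v)))) {0..t}"
      by (simp add: scaleR_diff_right)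
    moreover have "exp (k * t) * exp (- k * (t - s)) = exp (k * s)" for s
      by (simp add: exp_add[symmetric] algebra_simps)
    moreover have "exp (k * t) * exp (- k * t) = 1" by (simp add: exp_add[symmetric])
    moreover have "exp (k * t) *\<^sub>R Q (Dir \<mu> v) - 1 *\<^sub>R T t (Q (Dir \<mu> v))
        = R (exp (k * t) *\<^sub>R Dir k v - T t (Dir k v))"
      using resolventD(4)[OF R] A.resolvent_commute[OF R t]
      by (simp add: commute[OF Q] linear_diff linear_scale)
    ultimately show ?thesis by simp
  qed
  define x where "x = exp (l * t) *\<^sub>R Dir l v - exp (m * t) *\<^sub>R Dir m v + T t (Dir m v - Dir l v)"
  have "((\<lambda>s. exp (l * s) *\<^sub>R T (t - s) (Dir \<mu> v) - exp (m * s) *\<^sub>R T (t - s) (Dir \<mu> v)) has_integral R x) {0..t}"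
  proof -
    have "R (exp (l * t) *\<^sub>R Dir l v - T t (Dir l v)) - R (exp (m * t) *\<^sub>R Dir m v - T t (Dir m v)) = R x"
      unfolding x_def linear_diff[OF resolventD(4)[OF R], symmetric]
      by (simp add: blinfun.diff_right algebra_simps)
    then show ?thesis using has_integral_diff[OF single[OF Rl] single[OF Rm]] by simp
  qed
  from has_integral_linear[OF this blJ]
  have hi: "((\<lambda>s. J (exp (l * s) *\<^sub>R T (t - s) (Dir \<mu> v) - exp (m * s) *\<^sub>R T (t - s) (Dir \<mu> v))) has_integral j x) {0..t}"
    by (simp add: o_def JR)
  have "input_map T j (control_op D Am G T j \<mu>) t (\<lambda>s. (exp (l * s) - exp (m * s)) *\<^sub>R v) = j x"
    unfolding input_map_def
  proof (rule integral_unique, rule has_integral_eq[OF _ hi])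
    fix s assume s: "s \<in> {0..t}"
    have "ext_sg T j (t - s) (control_op D Am G T j \<mu> ((exp (l * s) - exp (m * s)) *\<^sub>R v))
        = J (T (t - s) ((exp (l * s) - exp (m * s)) *\<^sub>R Dir \<mu> v))"
      using s by (simp add: B ext linear_scale[OF linear_dirichlet[OF R]])
    then show "J (exp (l * s) *\<^sub>R T (t - s) (Dir \<mu> v) - exp (m * s) *\<^sub>R T (t - s) (Dir \<mu> v))
        = ext_sg T j (t - s) (control_op D Am G T j \<mu> ((exp (l * s) - exp (m * s)) *\<^sub>R v))"
      by (simp add: blinfun.scaleR_right blinfun.diff_right scaleR_diff_left)
  qed
  then have "io_map T j (control_op D Am G T j \<mu>) P (\<lambda>s. (exp (l * s) - exp (m * s)) *\<^sub>R v) t = P x"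
    unfolding io_map_def using inj by simp
  also have "\<dots> = exp (l * t) *\<^sub>R H l v - exp (m * t) *\<^sub>R H m v + P (T t (Dir m v - Dir l v))"
  proof -
    have "Dir m v - Dir l v \<in> DA"
      using dirichlet[OF Rl, of v] dirichlet[OF Rm, of v] by (simp add: ker_dom_def D_closed G_rules)
    then have "T t (Dir m v - Dir l v) \<in> D" using A.generator_commute(1)[OF _ t] DA_subset by blast
    then show ?thesis
      unfolding x_def using dirichlet(1)[OF Rl, of v] dirichlet(1)[OF Rm, of v] by (simp add: P_rules D_closed)
  qed
  finally show ?thesis .
qed

end

section \<open>Consequences of the positive feedback condition\<close>

context boundary_system
begin

lemma exponential_input_W1p0:
  assumes p: "0 < p" and le: "m \<le> l" and v: "0 \<le> v"
  shows "(\<lambda>s. (exp (l * s) - exp (m * s)) *\<^sub>R v) \<in> W1p0_pos p \<tau>"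
proof -
  let ?f = "\<lambda>s. (exp (l * s) - exp (m * s)) *\<^sub>R v"
  let ?w = "\<lambda>s. (l * exp (l * s) - m * exp (m * s)) *\<^sub>R v"
  have "?w \<in> Lp p {0..\<tau>}"
    by (rule Lp_scalar_multiple[OF p]) (intro continuous_intros)
  moreover have "(?w has_integral (?f t - ?f 0)) {0..t}" if "t \<in> {0..\<tau>}" for t
  proof (rule fundamental_theorem_of_calculus)
    show "0 \<le> t" using that by simp
    fix s
    have "((\<lambda>s. exp (l * s) - exp (m * s)) has_real_derivative (l * exp (l * s) - m * exp (m * s))) (at s within {0..t})"
      by (auto intro!: derivative_eq_intros)
    then show "(?f has_vector_derivative ?w s) (at s within {0..t})"
      using has_vector_derivative_scaleR[OF _ has_vector_derivative_const[of v]] by fastforce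
  qed
  moreover have "0 \<le> ?f t" if "t \<in> {0..\<tau>}" for t
    using that le v by (intro scaleR_nonneg_nonneg) (auto intro: mult_right_mono)
  ultimately show ?thesis
    unfolding W1p0_pos_def by (intro CollectI conjI bexI[of _ ?w] ballI) auto
qed

text \<open>Pointwise \<open>e\<^sup>l\<^sup>s - e\<^sup>m\<^sup>s \<ge> (l - m) s\<close>, and \<open>(l - m)\<^sup>p \<ge> l - m\<close> as \<open>l - m \<ge> 1\<close>.\<close>

lemma exponential_difference_growth:
  fixes p \<tau> l m :: real
  assumes p: "1 \<le> p" and \<tau>: "0 < \<tau>" and m: "0 \<le> m" and l: "m + 1 \<le> l"
  shows "(l - m) * (\<tau> powr (p + 1) / (p + 1)) \<le> (LINT s|lebesgue_on {0..\<tau>}. \<bar>exp (l * s) - exp (m * s)\<bar> powr p)"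
proof -
  have int0: "integrable (lebesgue_on {0..\<tau>}) (\<lambda>s. \<bar>s\<bar> powr p)"
    using continuous_norm_powr_integrable[of p 0 \<tau> "\<lambda>s. s"] p by (simp add: continuous_on_id)
  have int1: "integrable (lebesgue_on {0..\<tau>}) (\<lambda>s. \<bar>exp (l * s) - exp (m * s)\<bar> powr p)"
    using continuous_norm_powr_integrable[of p 0 \<tau> "\<lambda>s. exp (l * s) - exp (m * s)"] p
    by (simp add: continuous_intros)
  have "(LINT s|lebesgue_on {0..\<tau>}. \<bar>s\<bar> powr p) = integral {0..\<tau>} (\<lambda>s. \<bar>s\<bar> powr p)"
    by (rule lebesgue_integral_eq_integral[OF int0]) simp
  also have "\<dots> = integral {0..\<tau>} (\<lambda>s. s powr p)"
    by (rule integral_cong) simp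
  also have "\<dots> = \<tau> powr (p + 1) / (p + 1)"
    using p \<tau> by (intro integral_unique has_integral_powr_from_0) auto
  finally have "(l - m) * (\<tau> powr (p + 1) / (p + 1)) = (LINT s|lebesgue_on {0..\<tau>}. (l - m) * \<bar>s\<bar> powr p)"
    by simp
  also have "\<dots> \<le> (LINT s|lebesgue_on {0..\<tau>}. \<bar>exp (l * s) - exp (m * s)\<bar> powr p)"
  proof (rule Bochner_Integration.integral_mono)
    show "integrable (lebesgue_on {0..\<tau>}) (\<lambda>s. (l - m) * \<bar>s\<bar> powr p)" using int0 by simp
    fix s assume "s \<in> space (lebesgue_on {0..\<tau>})"
    then have s: "0 \<le> s" by simp
    have "(l - m) * s \<le> 1 * (exp ((l - m) * s) - 1)" using exp_ge_add_one_self[of "(l - m) * s"] unfolding mult_1 le_diff_eq add.commute[of _ 1] .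
    also have "\<dots> \<le> exp (m * s) * (exp ((l - m) * s) - 1)"
      using s m l by (intro mult_right_mono) auto
    also have "\<dots> = exp (l * s) - exp (m * s)" by (simp add: algebra_simps exp_add[symmetric])
    finally have key: "(l - m) * s \<le> exp (l * s) - exp (m * s)" .
    have "(l - m) powr 1 \<le> (l - m) powr p" using p l by (intro powr_mono) auto
    then have "(l - m) * \<bar>s\<bar> powr p \<le> (l - m) powr p * s powr p"
      using s l by (intro mult_mono) auto
    also have "\<dots> = ((l - m) * s) powr p" by (simp add: powr_mult)
    also have "\<dots> \<le> \<bar>exp (l * s) - exp (m * s)\<bar> powr p"
      using key s l p by (intro powr_mono2) auto
    finally show "(l - m) * \<bar>s\<bar> powr p \<le> \<bar>exp (l * s) - exp (m * s)\<bar> powr p" .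
  qed (rule int1)
  finally show ?thesis .
qed

text \<open>The partial sums \<open>V\<close> enter only through \<open>V \<ge> 0\<close> and \<open>V - v \<le> H(l) V\<close>. With these the input
  \<open>f = (e\<^sup>l\<^sup>t - e\<^sup>m\<^sup>t) V\<close> satisfies \<open>f - F f \<le> h\<close> for \<open>h = e\<^sup>l\<^sup>t v + e\<^sup>m\<^sup>t H(m) V\<close>, whence \<open>f \<le> J h\<close>
  for the positive inverse \<open>J\<close> of \<open>I - F\<close>. Comparing
  \<open>L\<^sup>p\<close> norms, \<open>V\<close> occurs on the right with a factor that does not depend on \<open>l\<close>, so a large \<open>l\<close> absorbs it.\<close>

lemma feedback_partial_sums_bounded:
  fixes j :: "'x \<Rightarrow> 'e::banach"
  assumes p: "1 \<le> p"
    and \<mu>: "complex_of_real \<mu> \<in> resolvent_set DA Am" and ex: "extrapolation_space DA Am \<mu> j"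
    and feedback: "identity_positive_feedback p T j (control_op D Am G T j \<mu>) P"
    and m: "0 \<le> m" and res: "\<And>l. m \<le> l \<Longrightarrow> \<exists>R. positive_resolvent DA Am l R"
    and pos: "\<And>l v. m \<le> l \<Longrightarrow> 0 \<le> v \<Longrightarrow> 0 \<le> Dir l v"
  shows "\<exists>\<Lambda>\<ge>m. \<forall>l\<ge>\<Lambda>. \<exists>C. \<forall>n v. 0 \<le> v \<longrightarrow> norm (\<Sum>k<n. (H l ^^ k) v) \<le> C * norm v"
proof -
  have p0: "0 < p" using p by simp
  let ?io = "io_map T j (control_op D Am G T j \<mu>) P"
  obtain \<tau> F J where \<tau>: "0 < \<tau>" and F: "io_extension p \<tau> T j (control_op D Am G T j \<mu>) P F"
    and J: "Lp_operator p {0..\<tau>} J" and Jpos: "\<And>f. f \<in> Lp_pos p {0..\<tau>} \<Longrightarrow> J f \<in> Lp_pos p {0..\<tau>}"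
    and Jinv: "\<And>f. f \<in> Lp p {0..\<tau>} \<Longrightarrow> AE t in lebesgue_on {0..\<tau>}. J (\<lambda>s. f s - F f s) t = f t"
    using feedback unfolding identity_positive_feedback_def by blast
  let ?L = "lebesgue_on {0..\<tau>}"
  have FL: "F f \<in> Lp p {0..\<tau>}" if "f \<in> Lp p {0..\<tau>}" for f
    using F that unfolding io_extension_def Lp_operator_def by blast
  have Fio: "AE t in ?L. F f t = ?io f t" if "f \<in> W1p0_pos p \<tau>" for f
    using F that unfolding io_extension_def by blast
  have JL: "J f \<in> Lp p {0..\<tau>}" if "f \<in> Lp p {0..\<tau>}" for f
    using J that unfolding Lp_operator_def by blast
  have Jadd: "AE s in ?L. J (\<lambda>r. f r + g r) s = J f s + J g s" if "f \<in> Lp p {0..\<tau>}" "g \<in> Lp p {0..\<tau>}" for f g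
    using J that unfolding Lp_operator_def by blast
  obtain K\<^sub>0 where K\<^sub>0: "\<And>f. f \<in> Lp p {0..\<tau>} \<Longrightarrow> Lp_norm p {0..\<tau>} (J f) \<le> K\<^sub>0 * Lp_norm p {0..\<tau>} f"
    using J unfolding Lp_operator_def by blast
  define K where "K = max K\<^sub>0 0"
  have JK: "(LINT s|?L. norm (J f s) powr p) \<le> K powr p * (LINT s|?L. norm (f s) powr p)"
    if f: "f \<in> Lp p {0..\<tau>}" for f
  proof -
    have nn: "0 \<le> Lp_norm p {0..\<tau>} g" for g :: "real \<Rightarrow> 'v" unfolding Lp_norm_def by simp
    have "Lp_norm p {0..\<tau>} (J f) \<le> K * Lp_norm p {0..\<tau>} f"
      using K\<^sub>0[OF f] mult_right_mono[of K\<^sub>0 K "Lp_norm p {0..\<tau>} f"] nn[of f] by (simp add: K_def)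
    then have "Lp_norm p {0..\<tau>} (J f) powr p \<le> (K * Lp_norm p {0..\<tau>} f) powr p"
      using nn p by (intro powr_mono2) auto
    also have "\<dots> = K powr p * Lp_norm p {0..\<tau>} f powr p"
      by (simp add: powr_mult)
    finally show ?thesis unfolding Lp_norm_powr[OF p0] .
  qed
  obtain Rm where Rm: "positive_resolvent DA Am m Rm" using res by blast
  then have rm: "resolvent_op DA Am m Rm" unfolding positive_resolvent_def by blast
  have "bounded_linear (H m)"
    by (rule positive_linear_bounded[OF linear_transfer[OF rm] transfer_nonneg[OF rm pos]]) auto
  then obtain C\<^sub>0 where C\<^sub>0: "0 < C\<^sub>0" "\<And>v. norm (H m v) \<le> norm v * C\<^sub>0"
    using bounded_linear.pos_bounded by blast
  define c where "c = (LINT s|?L. \<bar>exp (m * s)\<bar> powr p)"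
  have c0: "0 \<le> c" unfolding c_def by (intro Bochner_Integration.integral_nonneg) auto
  define \<kappa> where "\<kappa> = K powr p * 2 powr p"
  have \<kappa>0: "0 \<le> \<kappa>" unfolding \<kappa>_def by simp
  define d where "d = \<tau> powr (p + 1) / (p + 1)"
  have d0: "0 < d" using \<tau> p unfolding d_def by simp
  \<comment> \<open>The coefficient of \<open>\<parallel>V\<parallel>\<^sup>p\<close> on the right will be \<open>X - 1\<close>, and the one on the left at least \<open>X\<close>.\<close>
  define X where "X = 1 + \<kappa> * c * C\<^sub>0 powr p"
  have X1: "1 \<le> X" using \<kappa>0 c0 unfolding X_def by simp
  show ?thesis
  proof (rule exI[of _ "m + 1 + X / d"], intro conjI allI impI)
    show "m \<le> m + 1 + X / d" using X1 d0 by simp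
    fix l assume l: "m + 1 + X / d \<le> l"
    have "0 \<le> X / d" using X1 d0 by simp
    then have l1: "m + 1 \<le> l" and ml: "m \<le> l" using l by auto
    obtain Rl where Rl: "positive_resolvent DA Am l Rl" using res[OF ml] by blast
    then have rl: "resolvent_op DA Am l Rl" unfolding positive_resolvent_def by blast
    define a where "a = (LINT s|?L. \<bar>exp (l * s) - exp (m * s)\<bar> powr p)"
    define b where "b = (LINT s|?L. \<bar>exp (l * s)\<bar> powr p)"
    have b0: "0 \<le> b" unfolding b_def by (intro Bochner_Integration.integral_nonneg) auto
    have "X \<le> (l - m) * d" using l d0 by (simp add: field_simps)
    also have "\<dots> \<le> a" unfolding a_def d_def by (rule exponential_difference_growth[OF p \<tau> m l1])
    finally have aX: "X \<le> a" .
    note linH = linear_transfer[OF rl] and posH = transfer_nonneg[OF rl pos[OF ml]]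
    have main: "norm V powr p \<le> \<kappa> * b * norm v powr p"
      if v: "0 \<le> v" and V: "0 \<le> V" "V - v \<le> H l V" for v V
    proof -
      define w where "w = H m V"
      have w: "0 \<le> w" unfolding w_def by (rule transfer_nonneg[OF rm pos V(1)]) auto
      define f where "f s = (exp (l * s) - exp (m * s)) *\<^sub>R V" for s
      define h where "h s = exp (l * s) *\<^sub>R v + exp (m * s) *\<^sub>R w" for s
      have fL: "f \<in> Lp p {0..\<tau>}"
        unfolding f_def by (rule Lp_scalar_multiple[OF p0]) (intro continuous_intros)
      have hL: "h \<in> Lp p {0..\<tau>}"
        unfolding h_def by (intro Lp_add Lp_scalar_multiple continuous_intros p0 less_imp_le[OF p0]) auto
      have fW: "f \<in> W1p0_pos p \<tau>"
        unfolding f_def by (rule exponential_input_W1p0[OF p0 ml V(1)])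
      have io: "f t - h t \<le> ?io f t" if t: "0 \<le> t" for t
      proof -
        have "Dir m V - Dir l V = (l - m) *\<^sub>R Rl (Dir m V)"
          using dirichlet_shift[OF rm rl, of V] by (simp add: algebra_simps)
        moreover have "0 \<le> (l - m) *\<^sub>R Rl (Dir m V)"
          using Rl pos[OF order_refl V(1)] ml unfolding positive_resolvent_def
          by (intro scaleR_nonneg_nonneg) auto
        ultimately have nn: "0 \<le> Dir m V - Dir l V" by simp
        have "Dir m V - Dir l V \<in> DA"
          using dirichlet[OF rl, of V] dirichlet[OF rm, of V] by (simp add: ker_dom_def D_closed G_rules)
        then have "T t (Dir m V - Dir l V) \<in> D" using A.generator_commute(1)[OF _ t] DA_subset by blast
        then have tail: "0 \<le> P (T t (Dir m V - Dir l V))"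
          using positive_P A.semigroup_nonneg[OF t nn] unfolding positive_op_def by blast
        have "0 \<le> exp (m * t) *\<^sub>R V" by (rule scaleR_nonneg_nonneg[OF _ V(1)]) simp
        then have "f t - h t \<le> exp (l * t) *\<^sub>R (V - v) - exp (m * t) *\<^sub>R w"
          by (simp add: f_def h_def algebra_simps)
        also have "\<dots> \<le> exp (l * t) *\<^sub>R H l V - exp (m * t) *\<^sub>R w"
          by (intro diff_right_mono scaleR_left_mono V(2)) simp
        also have "\<dots> \<le> exp (l * t) *\<^sub>R H l V - exp (m * t) *\<^sub>R w + P (T t (Dir m V - Dir l V))"
          using tail by simp
        also have "\<dots> = ?io f t"
          unfolding f_def w_def by (rule exponential_io_map[OF \<mu> ex rl rm t, symmetric])
        finally show ?thesis .
      qed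
      define g where "g s = f s - F f s" for s
      define q where "q s = h s - g s" for s
      have gL: "g \<in> Lp p {0..\<tau>}"
        unfolding g_def by (rule Lp_diff[OF less_imp_le[OF p0] _ fL FL[OF fL]]) simp
      have qL: "q \<in> Lp p {0..\<tau>}"
        unfolding q_def by (rule Lp_diff[OF less_imp_le[OF p0] _ hL gL]) simp
      have "AE t in ?L. 0 \<le> q t"
        using Fio[OF fW] AE_space
      proof eventually_elim
        case (elim t)
        then have "f t - h t \<le> F f t" using io[of t] by simp
        then show ?case by (simp add: q_def g_def algebra_simps)
      qed
      then have "J q \<in> Lp_pos p {0..\<tau>}" using Jpos qL unfolding Lp_pos_def by blast
      then have Jq: "AE t in ?L. 0 \<le> J q t" unfolding Lp_pos_def by blast
      have "(\<lambda>r. q r + g r) = h" by (simp add: q_def)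
      then have Jh: "AE t in ?L. J h t = J q t + J g t" using Jadd[OF qL gL] by simp
      have Jg: "AE t in ?L. J g t = f t" using Jinv[OF fL] unfolding g_def .
      have nf: "AE t in ?L. norm (f t) powr p \<le> norm (J h t) powr p"
        using Jq Jh Jg AE_space
      proof eventually_elim
        case (elim t)
        have "0 \<le> f t"
          unfolding f_def using elim(4) ml V(1)
          by (intro scaleR_nonneg_nonneg) (auto intro: mult_right_mono)
        moreover have "f t \<le> J h t" using elim by simp
        ultimately have "norm (f t) \<le> norm (J h t)" by (rule norm_mono_nonneg)
        then show ?case using p by (intro powr_mono2) auto
      qed
      have "a * norm V powr p = (LINT s|?L. norm (f s) powr p)"
        unfolding a_def f_def by (simp add: powr_mult)
      also have "\<dots> \<le> (LINT s|?L. norm (J h s) powr p)"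
        using fL JL[OF hL] by (intro integral_mono_AE nf) (auto simp: Lp_def)
      also have "\<dots> \<le> K powr p * (LINT s|?L. norm (h s) powr p)" by (rule JK[OF hL])
      also have "(LINT s|?L. norm (h s) powr p)
          \<le> (LINT s|?L. 2 powr p * (\<bar>exp (l * s)\<bar> powr p * norm v powr p + \<bar>exp (m * s)\<bar> powr p * norm w powr p))"
      proof (rule Bochner_Integration.integral_mono)
        show "integrable ?L (\<lambda>s. norm (h s) powr p)" using hL by (simp add: Lp_def)
        have "integrable ?L (\<lambda>s. \<bar>exp (k * s)\<bar> powr p)" for k
          using continuous_norm_powr_integrable[OF p0, of 0 \<tau> "\<lambda>s. exp (k * s)"] by (simp add: continuous_intros)
        then show "integrable ?L (\<lambda>s. 2 powr p * (\<bar>exp (l * s)\<bar> powr p * norm v powr p + \<bar>exp (m * s)\<bar> powr p * norm w powr p))"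
          by (intro Bochner_Integration.integrable_mult_right Bochner_Integration.integrable_add
              Bochner_Integration.integrable_mult_left)
        show "norm (h s) powr p \<le> 2 powr p * (\<bar>exp (l * s)\<bar> powr p * norm v powr p + \<bar>exp (m * s)\<bar> powr p * norm w powr p)" for s
          using powr_norm_add_le[of p "exp (l * s) *\<^sub>R v" "exp (m * s) *\<^sub>R w"] p0
          by (simp add: h_def powr_mult)
      qed
      also have "\<dots> = 2 powr p * (b * norm v powr p + c * norm w powr p)"
      proof -
        have i: "integrable ?L (\<lambda>s. \<bar>exp (k * s)\<bar> powr p * y)" for k y
          using continuous_norm_powr_integrable[OF p0, of 0 \<tau> "\<lambda>s. exp (k * s)"] by (simp add: continuous_intros)
        then show ?thesis
          unfolding b_def c_def Bochner_Integration.integral_mult_right_zero Bochner_Integration.integral_add[OF i i]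
          by simp
      qed
      finally have est: "a * norm V powr p \<le> K powr p * (2 powr p * (b * norm v powr p + c * norm w powr p))"
        by (simp add: mult_left_mono)
      have "norm w powr p \<le> (norm V * C\<^sub>0) powr p"
        using C\<^sub>0(2)[of V] p unfolding w_def by (intro powr_mono2) auto
      also have "\<dots> = C\<^sub>0 powr p * norm V powr p" by (simp add: powr_mult mult.commute)
      finally have "K powr p * (2 powr p * (b * norm v powr p + c * norm w powr p))
          \<le> K powr p * (2 powr p * (b * norm v powr p + c * (C\<^sub>0 powr p * norm V powr p)))"
        using c0 by (intro mult_left_mono add_left_mono) auto
      also have "\<dots> = \<kappa> * b * norm v powr p + (X - 1) * norm V powr p"
        by (simp add: \<kappa>_def X_def algebra_simps)
      finally have "a * norm V powr p \<le> \<kappa> * b * norm v powr p + (X - 1) * norm V powr p"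
        using est by linarith
      moreover have "X * norm V powr p \<le> a * norm V powr p" using aX by (intro mult_right_mono) auto
      ultimately show ?thesis by (simp add: algebra_simps)
    qed
    have "norm (\<Sum>k<n. (H l ^^ k) v) \<le> (\<kappa> * b) powr (1 / p) * norm v" if v: "0 \<le> v" for n v
    proof -
      define V where "V = (\<Sum>k<n. (H l ^^ k) v)"
      have V0: "0 \<le> V" unfolding V_def by (intro sum_nonneg funpow_nonneg posH v)
      have "V - v \<le> H l V"
      proof -
        have "v + H l V = (H l ^^ 0) v + (\<Sum>k<n. (H l ^^ Suc k) v)"
          unfolding V_def linear_sum[OF linH] by simp
        also have "\<dots> = (\<Sum>k<Suc n. (H l ^^ k) v)" by (simp only: sum.lessThan_Suc_shift)
        also have "\<dots> = V + (H l ^^ n) v" unfolding V_def by simp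
        finally have "H l V = V - v + (H l ^^ n) v" by (simp add: algebra_simps)
        then show ?thesis using funpow_nonneg[of "H l", OF posH v] by (simp add: le_add_same_cancel1)
      qed
      from main[OF v V0 this] have "(norm V powr p) powr (1 / p) \<le> (\<kappa> * b * norm v powr p) powr (1 / p)"
        using p by (intro powr_mono2) auto
      then show ?thesis
        using p unfolding V_def[symmetric] by (simp add: powr_powr powr_mult)
    qed
    then show "\<exists>C. \<forall>n v. 0 \<le> v \<longrightarrow> norm (\<Sum>k<n. (H l ^^ k) v) \<le> C * norm v" by blast
  qed
qed

end

section \<open>The perturbed generator\<close>

lemma positive_inverseI:
  fixes N :: "'v::banach_lattice \<Rightarrow> 'v"
  assumes lin: "linear N" and inj: "\<And>v. v - N v = 0 \<Longrightarrow> v = 0"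
    and Q: "\<And>v. Q v - N (Q v) = v" and pos: "\<And>v. 0 \<le> v \<Longrightarrow> 0 \<le> Q v"
  shows "positive_inverse N Q"
proof -
  have eq: "v = w" if "v - N v = w - N w" for v w
    using inj[of "v - w"] that by (simp add: linear_diff[OF lin] algebra_simps)
  have "linear Q"
  proof (rule linearI)
    show "Q (v + w) = Q v + Q w" for v w
    proof (rule eq)
      have "(Q v + Q w) - N (Q v + Q w) = (Q v - N (Q v)) + (Q w - N (Q w))"
        by (simp add: linear_add[OF lin])
      then show "Q (v + w) - N (Q (v + w)) = (Q v + Q w) - N (Q v + Q w)" by (simp only: Q)
    qed
    show "Q (c *\<^sub>R v) = c *\<^sub>R Q v" for c v
    proof (rule eq)
      have "c *\<^sub>R Q v - N (c *\<^sub>R Q v) = c *\<^sub>R (Q v - N (Q v))"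
        by (simp add: linear_scale[OF lin] scaleR_diff_right)
      then show "Q (c *\<^sub>R v) - N (Q (c *\<^sub>R v)) = c *\<^sub>R Q v - N (c *\<^sub>R Q v)" by (simp only: Q)
    qed
  qed
  moreover have "Q (v - N v) = v" for v by (rule eq) (simp add: Q)
  ultimately show ?thesis using Q pos unfolding positive_inverse_def by blast
qed

context boundary_system
begin

abbreviation DS :: "'x set" where "DS \<equiv> {x \<in> D. G x = P x}"

lemma linear_op_DS: "linear_op DS Am"
proof -
  have "G 0 = 0" "P 0 = 0"
    using G_rules(2)[of 0 0] P_rules(2)[of 0 0] subspace_0[OF subspace_D] by simp_all
  then have "subspace DS"
    using subspace_D by (intro subspaceI) (auto simp: subspace_0 G_rules P_rules D_closed)
  then show ?thesis unfolding linear_op_def using Am_rules by auto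
qed

text \<open>\<open>x = R f + D\<^sub>l g\<close> solves \<open>(l - A\<^sub>m) x = f\<close> with \<open>G x = g\<close>; the condition \<open>G x = P x\<close> reads
  \<open>g - H(l) g = P R f\<close>.\<close>

lemma perturbed_positive_resolvent:
  assumes R: "positive_resolvent DA Am l R" and pos: "\<And>v. 0 \<le> v \<Longrightarrow> 0 \<le> Dir l v"
    and Q: "positive_inverse (H l) Q"
  shows "positive_resolvent DS Am l (\<lambda>f. R f + Dir l (Q (P (R f))))"
proof -
  have r: "resolvent_op DA Am l R" and Rpos: "\<And>x. 0 \<le> x \<Longrightarrow> 0 \<le> R x"
    using R unfolding positive_resolvent_def by auto
  have linQ: "linear Q" and Qpos: "\<And>v. 0 \<le> v \<Longrightarrow> 0 \<le> Q v"
    and Q1: "\<And>v. Q v - H l (Q v) = v" and Q2: "\<And>v. Q (v - H l v) = v"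
    using Q unfolding positive_inverse_def by auto
  note d = dirichlet[OF r] and rD = resolventD[OF r] and linD = linear_dirichlet[OF r]
  define S where "S f = R f + Dir l (Q (P (R f)))" for f
  have linS: "linear S"
  proof (rule linearI)
    show "S (x + y) = S x + S y" for x y
      by (simp add: S_def linear_add[OF rD(4)] P_rules rD(1) linear_add[OF linQ] linear_add[OF linD])
    show "S (c *\<^sub>R x) = c *\<^sub>R S x" for c x
      by (simp add: S_def linear_scale[OF rD(4)] P_rules rD(1) linear_scale[OF linQ] linear_scale[OF linD] scaleR_add_right)
  qed
  have Spos: "0 \<le> S f" if f: "0 \<le> f" for f
  proof -
    have "0 \<le> P (R f)" using positive_P rD(1) Rpos[OF f] unfolding positive_op_def by blast
    then show ?thesis unfolding S_def by (intro add_nonneg_nonneg Rpos f pos Qpos)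
  qed
  have "S f \<in> DS" for f
    using Q1[of "P (R f)"] by (simp add: S_def D_closed rD(1,2) d G_rules P_rules diff_eq_eq)
  moreover have "l *\<^sub>R S f - Am (S f) = f" for f
    by (simp add: S_def rD(1,3) d Am_rules algebra_simps)
  moreover have "S (l *\<^sub>R x - Am x) = x" if x: "x \<in> DS" for x
  proof -
    define f where "f = l *\<^sub>R x - Am x"
    have xD: "x \<in> D" "G x = P x" using x by auto
    have dec: "x = R f + Dir l (G x)" unfolding f_def by (rule decompose[OF r xD(1)])
    have "P x = P (R f + Dir l (G x))" using dec by simp
    also have "\<dots> = P (R f) + H l (G x)" by (simp add: P_rules rD(1) d)
    finally have "P (R f) = P x - H l (G x)" by (metis add_diff_cancel_right')
    then have "P (R f) = G x - H l (G x)" using xD by simp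
    then have "Q (P (R f)) = G x" by (simp only: Q2)
    then show ?thesis using dec unfolding S_def f_def by simp
  qed
  ultimately show ?thesis
    using positive_linear_bounded[OF linS Spos] Spos
    unfolding positive_resolvent_def resolvent_op_def S_def by blast
qed

text \<open>The difference is \<open>D\<^sub>l G S x = D\<^sub>l P S x \<ge> 0\<close>.\<close>

lemma resolvent_le_perturbed:
  assumes r: "resolvent_op DA Am l R" and pos: "\<And>v. 0 \<le> v \<Longrightarrow> 0 \<le> Dir l v"
    and S: "positive_resolvent DS Am l S" and x: "0 \<le> x"
  shows "R x \<le> S x"
proof -
  have Sx: "S x \<in> DS" "l *\<^sub>R S x - Am (S x) = x" "0 \<le> S x"
    using S x unfolding positive_resolvent_def resolvent_op_def by auto
  then have "0 \<le> G (S x)" using positive_P unfolding positive_op_def by auto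
  then have "0 \<le> Dir l (G (S x))" by (rule pos)
  then show ?thesis using decompose[OF r, of "S x"] Sx by (metis (no_types, lifting) le_add_same_cancel1 mem_Collect_eq)
qed

text \<open>Here \<open>\<Lambda>\<close> is a point where \<open>I - H(\<Lambda>)\<close> is known to be invertible. Invertibility is carried from \<open>\<Lambda>\<close> to \<open>0\<close> by
  the resolvent \<open>U\<close> of the perturbed generator at \<open>0\<close>.\<close>

lemma stable_perturbed_imp_stable_unperturbed:
  assumes S: "generates DS Am S" "positive_semigroup S"
    and neg: "spectral_bound DS Am < 0"
    and \<Lambda>: "0 \<le> \<Lambda>" "positive_resolvent DA Am \<Lambda> R\<^sub>\<Lambda>" "\<And>v. 0 \<le> v \<Longrightarrow> 0 \<le> Dir \<Lambda> v"
    and Q: "positive_inverse (H \<Lambda>) Q"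
  shows "spectral_bound DA Am < 0 \<and> spectral_radius (H 0) < 1"
proof -
  interpret S: positive_generator DS Am S by unfold_locales (rule linear_op_DS S)+
  have r\<Lambda>: "resolvent_op DA Am \<Lambda> R\<^sub>\<Lambda>" using \<Lambda>(2) unfolding positive_resolvent_def by blast
  have Sres: "\<exists>U. positive_resolvent DS Am l U" if "0 \<le> l" for l
  proof (rule S.spectral_bound_less_imp_positive_resolvent)
    have "spectral_bound DS Am < ereal 0" using neg by (simp add: zero_ereal_def)
    also have "\<dots> \<le> ereal l" using that by simp
    finally show "spectral_bound DS Am < ereal l" .
  qed
  obtain U where U: "positive_resolvent DS Am 0 U" using Sres by blast
  then have u: "resolvent_op DS Am 0 U" and Upos: "\<And>x. 0 \<le> x \<Longrightarrow> 0 \<le> U x"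
    unfolding positive_resolvent_def by auto
  have UD: "U x \<in> DS" "Am (U x) = - x" for x
    using u unfolding resolvent_op_def by (auto simp: neg_eq_iff_add_eq_0 add_eq_0_iff2)
  obtain K where K: "0 < K" "\<And>x. norm (U x) \<le> K * norm x"
    using S.positive_resolvent_norm_bound[OF U] by blast
  have Dpos: "0 \<le> Dir l v" if "l \<le> \<Lambda>" "positive_resolvent DA Am l R" "0 \<le> v" for l R v
    using dirichlet_nonneg_below[OF r\<Lambda> that(2,1) \<Lambda>(3) that(3)] .
  have "\<exists>R. positive_resolvent DA Am 0 R"
  proof (rule positive_resolvent_descend[OF \<Lambda>(2,1)])
    fix m :: real assume m: "0 \<le> m"
    have "norm (R x) \<le> K * norm x" if l: "m \<le> l" "l \<le> \<Lambda>" and R: "positive_resolvent DA Am l R" for l R x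
    proof (rule positive_linear_norm_le)
      have r: "resolvent_op DA Am l R" and Rpos: "\<And>x. 0 \<le> x \<Longrightarrow> 0 \<le> R x"
        using R unfolding positive_resolvent_def by auto
      show "linear R" by (rule resolventD(4)[OF r])
      show "0 \<le> R x" if "0 \<le> x" for x by (rule Rpos[OF that])
      fix x :: 'x assume x: "0 \<le> x"
      obtain W where W: "positive_resolvent DS Am l W" using Sres l(1) m by (meson order_trans)
      then have w: "resolvent_op DS Am l W" and Wpos: "\<And>x. 0 \<le> x \<Longrightarrow> 0 \<le> W x"
        unfolding positive_resolvent_def by auto
      have linW: "linear W" using w bounded_linear.linear unfolding resolvent_op_def by blast
      have "R x \<le> W x" by (rule resolvent_le_perturbed[OF r Dpos[OF l(2) R] W x])
      also have "W x \<le> W (x + (l - 0) *\<^sub>R U x)"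
        using l(1) m Upos[OF x]
        by (intro positive_linear_mono[OF linW Wpos]) (auto intro!: scaleR_nonneg_nonneg)
      also have "\<dots> = U x" using resolvent_identity[OF u w, of x] by simp
      finally have "norm (R x) \<le> norm (U x)" by (rule norm_mono_nonneg[OF Rpos[OF x]])
      then show "norm (R x) \<le> K * norm x" using K(2)[of x] by simp
    qed
    then show "\<exists>M \<delta>. \<delta> > 0 \<and> (\<forall>l R. m \<le> l \<and> l < m + \<delta> \<and> l \<le> \<Lambda> \<and> positive_resolvent DA Am l R
        \<longrightarrow> (\<forall>x. norm (R x) \<le> M * norm x))"
      by (intro exI[of _ K] exI[of _ 1]) auto
  qed
  then obtain R where R: "positive_resolvent DA Am 0 R" by blast
  then have r: "resolvent_op DA Am 0 R" unfolding positive_resolvent_def by blast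
  have "spectral_bound DA Am < ereal 0" by (rule A.positive_resolvent_imp_spectral_bound_less[OF R])
  moreover have "spectral_radius (H 0) < 1"
  proof (rule positive_inverse_imp_spectral_radius)
    have D0: "0 \<le> Dir 0 v" if "0 \<le> v" for v by (rule Dpos[OF \<Lambda>(1) R that])
    show linH: "linear (H 0)" by (rule linear_transfer[OF r])
    show "0 \<le> H 0 v" if "0 \<le> v" for v by (rule transfer_nonneg[OF r D0 that])
    define y where "y v = Dir \<Lambda> (Q v)" for v
    \<comment> \<open>Correcting \<open>y v \<in> ker (\<Lambda> - A\<^sub>m)\<close> by an element of the perturbed domain leaves \<open>G - P\<close> unchanged and
    gives a vector in \<open>ker A\<^sub>m\<close>.\<close>
    define X where "X v = y v + \<Lambda> *\<^sub>R U (y v)" for v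
    have y: "y v \<in> D" "Am (y v) = \<Lambda> *\<^sub>R y v" "G (y v) = Q v" for v
      using dirichlet[OF r\<Lambda>] by (simp_all add: y_def)
    have Qv: "Q v - P (y v) = v" and Qpos: "0 \<le> v \<Longrightarrow> 0 \<le> Q v" for v
      using Q unfolding positive_inverse_def y_def by auto
    have UD': "U x \<in> D" "G (U x) = P (U x)" for x using UD(1)[of x] by auto
    have X: "X v \<in> D" "Am (X v) = 0" for v
      by (simp_all add: X_def y UD' UD(2) D_closed Am_rules)
    have GX: "G (X v) = v + P (X v)" for v
      using Qv[of v] by (simp add: X_def y UD' D_closed G_rules P_rules algebra_simps)
    have DX: "Dir 0 (G (X v)) = X v" for v
      by (rule dirichlet_unique[OF r X(1)]) (simp add: X)
    show "positive_inverse (H 0) (\<lambda>v. G (X v))"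
    proof (rule positive_inverseI[OF linH])
      show "G (X v) - H 0 (G (X v)) = v" for v
        unfolding DX using GX[of v] by simp
      show "0 \<le> G (X v)" if v: "0 \<le> v" for v
      proof -
        have "0 \<le> y v" unfolding y_def by (intro \<Lambda>(3) Qpos v)
        then have "0 \<le> X v" unfolding X_def using \<Lambda>(1) Upos by (intro add_nonneg_nonneg scaleR_nonneg_nonneg) auto
        then have "0 \<le> P (X v)" using positive_P X(1) unfolding positive_op_def by blast
        then show ?thesis unfolding GX using v by simp
      qed
      fix g assume g: "g - H 0 g = 0"
      have "Dir 0 g \<in> DS" using dirichlet[OF r] g by simp
      then have "U (0 *\<^sub>R Dir 0 g - Am (Dir 0 g)) = Dir 0 g" using u unfolding resolvent_op_def by blast
      moreover have "linear U" using u bounded_linear.linear unfolding resolvent_op_def by blast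
      ultimately have "Dir 0 g = 0" using dirichlet(2)[OF r] by (simp add: linear_0)
      then have "H 0 g = P (0 *\<^sub>R 0)" by simp
      also have "\<dots> = 0" using P_rules(2)[of 0 0] subspace_0[OF subspace_D] by simp
      finally show "g = 0" using g by simp
    qed
  qed
  ultimately show ?thesis by (simp add: zero_ereal_def)
qed

lemma stable_unperturbed_imp_stable_perturbed:
  assumes S: "generates DS Am S" "positive_semigroup S"
    and neg: "spectral_bound DA Am < 0" and rad: "spectral_radius (H 0) < 1"
    and \<Lambda>: "0 \<le> \<Lambda>" "positive_resolvent DA Am \<Lambda> R\<^sub>\<Lambda>" "\<And>v. 0 \<le> v \<Longrightarrow> 0 \<le> Dir \<Lambda> v"
  shows "spectral_bound DS Am < 0"
proof -
  interpret S: positive_generator DS Am S by unfold_locales (rule linear_op_DS S)+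
  have r\<Lambda>: "resolvent_op DA Am \<Lambda> R\<^sub>\<Lambda>" using \<Lambda>(2) unfolding positive_resolvent_def by blast
  have "spectral_bound DA Am < ereal 0" using neg by (simp add: zero_ereal_def)
  then obtain R where R: "positive_resolvent DA Am 0 R"
    using A.spectral_bound_less_imp_positive_resolvent by blast
  then have r: "resolvent_op DA Am 0 R" unfolding positive_resolvent_def by blast
  have D0: "0 \<le> Dir 0 v" if "0 \<le> v" for v
    by (rule dirichlet_nonneg_below[OF r\<Lambda> R \<Lambda>(1) \<Lambda>(3) that])
  obtain Q where Q: "positive_inverse (H 0) Q"
    using spectral_radius_less_one_imp_positive_inverse[OF linear_transfer[OF r] transfer_nonneg[OF r D0] rad] by auto
  have "spectral_bound DS Am < ereal 0"
    by (rule S.positive_resolvent_imp_spectral_bound_less[OF perturbed_positive_resolvent[OF R D0 Q]])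
  then show ?thesis by (simp add: zero_ereal_def)
qed

end

theorem theoremA2:
  fixes D :: "'x::banach_lattice set" and Am :: "'x \<Rightarrow> 'x"
    and G P :: "'x \<Rightarrow> 'v::banach_lattice"
    and T S :: "real \<Rightarrow> 'x \<Rightarrow>\<^sub>L 'x"
    and j :: "'x \<Rightarrow> 'e::banach" and p \<mu> :: real
  defines "DA \<equiv> ker_dom D G"
    and "B \<equiv> control_op D Am G T j \<mu>"
    and "DS \<equiv> {x \<in> D. G x = P x}"
  assumes p: "1 \<le> p"
    and Am: "linear_op D Am" "closed_op D Am" "closure D = UNIV"
    and G: "graph_bounded_op D Am G" "G ` D = UNIV"
    and P: "graph_bounded_op D Am P" "positive_op D P"
    and T: "generates DA Am T" "positive_semigroup T"
    and Dirichlet_pos: "\<forall>\<^sub>F l in at_top. positive_op UNIV (dirichlet D Am G l)"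
    and extrapolation: "complex_of_real \<mu> \<in> resolvent_set DA Am" "extrapolation_space DA Am \<mu> j"
    and triple: "positive_well_posed p D G P T j B"
    and regular: "weakly_regular_zero_feedthrough D Am G P"
    and feedback: "identity_positive_feedback p T j B P"
    and S: "generates DS Am S" "positive_semigroup S"
  shows "(spectral_bound DS Am < 0 \<longleftrightarrow>
            spectral_bound DA Am < 0 \<and> spectral_radius (\<lambda>v. P (dirichlet D Am G 0 v)) < 1)
       \<and> (spectral_bound DS Am < 0
            \<or> (spectral_bound DA Am < 0 \<and> spectral_radius (\<lambda>v. P (dirichlet D Am G 0 v)) < 1)
          \<longrightarrow> strongly_exp_stable S)"
proof -
  interpret sys: boundary_system D Am G P T
  proof
    show "linear_op D G" "linear_op D P" using G(1) P(1) unfolding graph_bounded_op_def by auto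
    show "generates (ker_dom D G) Am T" using T(1) unfolding DA_def .
  qed (rule Am G P T)+
  interpret S: positive_generator DS Am S
    by unfold_locales (unfold DS_def, (rule sys.linear_op_DS S[unfolded DS_def])+)
  obtain l\<^sub>1 where l\<^sub>1: "\<And>l. l\<^sub>1 \<le> l \<Longrightarrow> \<exists>R. positive_resolvent (ker_dom D G) Am l R"
    using sys.A.ex_large_positive_resolvent by blast
  obtain l\<^sub>2 where l\<^sub>2: "\<And>l. l\<^sub>2 \<le> l \<Longrightarrow> positive_op UNIV (dirichlet D Am G l)"
    using Dirichlet_pos unfolding eventually_at_top_linorder by blast
  define m where "m = max 0 (max l\<^sub>1 l\<^sub>2)"
  have m: "0 \<le> m" "\<And>l. m \<le> l \<Longrightarrow> \<exists>R. positive_resolvent (ker_dom D G) Am l R"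
    "\<And>l v. m \<le> l \<Longrightarrow> 0 \<le> v \<Longrightarrow> 0 \<le> dirichlet D Am G l v"
    using l\<^sub>1 l\<^sub>2 unfolding m_def positive_op_def by auto
  obtain \<Lambda> C where \<Lambda>: "m \<le> \<Lambda>"
    and C: "\<And>n v. 0 \<le> v \<Longrightarrow> norm (\<Sum>k<n. ((\<lambda>v. P (dirichlet D Am G \<Lambda> v)) ^^ k) v) \<le> C * norm v"
    using sys.feedback_partial_sums_bounded[OF p extrapolation[unfolded DA_def]
        feedback[unfolded B_def] m] by blast
  obtain R where R: "positive_resolvent (ker_dom D G) Am \<Lambda> R" using m(2)[OF \<Lambda>] by blast
  then have r: "resolvent_op (ker_dom D G) Am \<Lambda> R" unfolding positive_resolvent_def by blast
  note linH = sys.linear_transfer[OF r]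
  have posH: "0 \<le> P (dirichlet D Am G \<Lambda> v)" if "0 \<le> v" for v
    by (rule sys.transfer_nonneg[OF r m(3)[OF \<Lambda>] that])
  obtain K q where "0 \<le> K" "0 < q" "q < 1"
    "\<And>n v. norm (((\<lambda>v. P (dirichlet D Am G \<Lambda> v)) ^^ n) v) \<le> K * q ^ n * norm v"
    by (rule positive_partial_sums_imp_power_decay[OF linH posH C]) (assumption | rule that)+
  then obtain Q where Q: "positive_inverse (\<lambda>v. P (dirichlet D Am G \<Lambda> v)) Q"
    using power_decay_imp_positive_inverse[OF linH posH] by blast
  have "0 \<le> \<Lambda>" using m(1) \<Lambda> by simp
  have equiv: "spectral_bound DS Am < 0 \<longleftrightarrow>
      spectral_bound DA Am < 0 \<and> spectral_radius (\<lambda>v. P (dirichlet D Am G 0 v)) < 1"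
    unfolding DS_def DA_def
    using sys.stable_perturbed_imp_stable_unperturbed[OF S[unfolded DS_def] _ \<open>0 \<le> \<Lambda>\<close> R m(3)[OF \<Lambda>] Q]
      sys.stable_unperturbed_imp_stable_perturbed[OF S[unfolded DS_def] _ _ \<open>0 \<le> \<Lambda>\<close> R m(3)[OF \<Lambda>]]
    by blast
  then show ?thesis using S.spectral_bound_negative_imp_stable by blast
qed

end
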